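(* Let $n\ge1$ and let $P(\partial_z)=\sum_{i,j=1}^n a_{ij}\partial^2_{z_iz_j}$ ($z\in\mathbb{C}^n$) be a homogeneous elliptic operator of order $2$ with real coefficients, where $A=(a_{ij})$ is a real symmetric positive-definite matrix. Let $C$ be a real orthogonal matrix such that $\Lambda=C^TAC$ is diagonal (with positive diagonal entries) and let $\Lambda^{1/2}$ be the diagonal matrix of positive square roots. For $\varphi\in\mathcal{O}(D^n)$ define $$M_{\mu_B}(\varphi;z,t)=\frac{1}{\alpha(n)}\int_{B(0,1)}\varphi(z+tC\Lambda^{1/2}y)\,dy,\qquad M_{\mu_S}(\varphi;z,t)=\frac{1}{n\alpha(n)}\int_{S(0,1)}\varphi(z+tC\Lambda^{1/2}y)\,dS(y),$$ where $\alpha(n)=\pi^{n/2}/\Gamma(1+n/2)$, $dy$ is Lebesgue measure on the real unit ball $B(0,1)\subset\mathbb{R}^n$ and $dS$ is surface measure on the unit sphere $S(0,1)$. Let $d\in\mathbb{R}$ and let $\widehat u$ be the formal power series solution of $(\partial_t-P(\partial_z))u=0$, $u(0,z)=\varphi(z)$. Then: (i) $\widehat u$ converges to a holomorphic function $u\in\mathcal{O}(D^{n+1})$ if and only if $M_{\mu_B}(\varphi;z,t)\in\mathcal{O}^2(D^n\times\mathbb{C})$, and if and only if $M_{\mu_S}(\varphi;z,t)\in\mathcal{O}^2(D^n\times\mathbb{C})$; (ii) $\widehat u$ is $1$-summable in the direction $d$ if and only if $M_{\mu_B}(\varphi;z,t)\in\mathcal{O}^2(D^n\times(\widehat S_{d/2}\cup\widehat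 S_{d/2+\pi}))$, and if and only if $M_{\mu_S}(\varphi;z,t)\in\mathcal{O}^2(D^n\times(\widehat S_{d/2}\cup\widehat S_{d/2+\pi}))$.
   Context: Notation: $D^n_r=\{z\in\mathbb{C}^n:|z|<r\}$, $D_r=D^1_r$; $D^n$ denotes such a disc centred at the origin with some unspecified radius. The formal solution is $\widehat u(t,z)=\sum_{j\ge0}\frac{P^j(\partial_z)\varphi(z)}{j!}t^j$. Sectors: $S_d(\varepsilon)$ is the set of $t=\rho e^{i\theta}$ in the universal covering of $\mathbb{C}\setminus\{0\}$ with $\rho>0$, $|\theta-d|<\varepsilon/2$; a disc-sector $\widehat S_d(\varepsilon;r_1)=S_d(\varepsilon)\cup D_{r_1}$; $\widehat S_d$ denotes a disc-sector in direction $d$ with some unspecified $\varepsilon,r_1>0$. For $k>0$, a function $f(z,t)$ holomorphic on $D^n_r\times\widehat S_d(\varepsilon;r_1)$ belongs to $\mathcal{O}^k(D^n\times\widehat S_d)$ if for all $\tilde r<r$, $\tilde r_1<r_1$, $\tilde\varepsilon<\varepsilon$ there are $A,B$ with $\max_{|z|\le\tilde r}|f(z,t)|\le Ae^{B|t|^k}$ for $t\in\widehat S_d(\tilde\varepsilon;\tilde r_1)$; $\mathcal{O}^k(D^n\times\mathbb{C})$ analogously with $t\in\mathbb{C}$; membership in $\mathcal{O}^k(D^n\times(G_1\cup G_2))$ means membership for each of $G_1,G_2$. The same definitions apply with variable order $(t,z)$. A function initially defined only for small $|t|$ belongs to such a space if it extends holomorphically with the stated growth. $k$-summability: $\widehat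 u=\sum_j u_j(z)t^j$ (with $u_j\in\mathcal{O}(D^n)$) is $k$-summable in direction $d$ if there is a disc-sector $\widehat S_d$ with $\sum_j\frac{u_j(z)}{\Gamma(1+j/k)}t^j\in\mathcal{O}^k(\widehat S_d\times D^n)$. *)

theory Defs
  imports "HOL-Analysis.Analysis"
begin

text \<open>Points of C^n are vectors of type complex^'n (n = CARD('n)); discs D^n_r are Euclidean balls.\<close>

definition holo_n :: "(complex^'n::finite) set \<Rightarrow> (complex^'n \<Rightarrow> complex) \<Rightarrow> bool" where
  "holo_n S f \<longleftrightarrow> (\<forall>z\<in>S. \<exists>L. (f has_derivative L) (at z) \<and>
       (\<forall>c v. L (c *s v) = c * L v))"

definition holo_nt :: "((complex^'n::finite) \<times> complex) set \<Rightarrow> ((complex^'n::finite) \<times> complex \<Rightarrow> complex) \<Rightarrow> bool" where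
  "holo_nt S f \<longleftrightarrow> (\<forall>p\<in>S. \<exists>L. (f has_derivative L) (at p) \<and>
       (\<forall>c v w. L (c *s v, c * w) = c * L (v, w)))"

definition cpartial :: "'n \<Rightarrow> (complex^'n \<Rightarrow> complex) \<Rightarrow> complex^'n \<Rightarrow> complex" where
  "cpartial i f z = deriv (\<lambda>w. f (\<chi> k. if k = i then w else z $ k)) (z $ i)"

definition Pop :: "real^'n^'n \<Rightarrow> (complex^'n \<Rightarrow> complex) \<Rightarrow> complex^'n \<Rightarrow> complex" where
  "Pop A f = (\<lambda>z. \<Sum>i\<in>UNIV. \<Sum>j\<in>UNIV. complex_of_real (A $ i $ j) * cpartial i (cpartial j f) z)"

text \<open>Coefficients u_j(z) = P^j(d_z) phi(z) / j! of the formal solution.\<close>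
definition ucoef :: "real^'n^'n \<Rightarrow> (complex^'n \<Rightarrow> complex) \<Rightarrow> nat \<Rightarrow> complex^'n \<Rightarrow> complex" where
  "ucoef A \<phi> j z = (Pop A ^^ j) \<phi> z / of_nat (fact j)"

definition formal_converges :: "real^'n^'n \<Rightarrow> (complex^'n \<Rightarrow> complex) \<Rightarrow> bool" where
  "formal_converges A \<phi> \<longleftrightarrow> (\<exists>r>0. \<exists>u.
      (\<forall>z t. norm z < r \<longrightarrow> norm t < r \<longrightarrow> (\<lambda>j. ucoef A \<phi> j z * t ^ j) sums u (z, t)) \<and>
      holo_nt (ball 0 r \<times> ball 0 r) u)"

text \<open>Open sector S_d(eps) (for 0 < eps <= 2 pi it embeds into C minus 0) and disc-sector.\<close>
definition sector :: "real \<Rightarrow> real \<Rightarrow> complex set" where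
  "sector d \<epsilon> = {t. t \<noteq> 0 \<and> (\<exists>\<theta>. \<bar>\<theta> - d\<bar> < \<epsilon> / 2 \<and> t = of_real (norm t) * cis \<theta>)}"

definition disc_sector :: "real \<Rightarrow> real \<Rightarrow> real \<Rightarrow> complex set" where
  "disc_sector d \<epsilon> r1 = sector d \<epsilon> \<union> ball 0 r1"

definition O_entire :: "real \<Rightarrow> ((complex^'n::finite) \<times> complex \<Rightarrow> complex) \<Rightarrow> bool" where
  "O_entire k F \<longleftrightarrow> (\<exists>r>0. \<exists>f. holo_nt (ball 0 r \<times> UNIV) f \<and>
      (\<exists>\<delta>>0. \<forall>z t. norm z < \<delta> \<longrightarrow> norm t < \<delta> \<longrightarrow> f (z, t) = F (z, t)) \<and>
      (\<forall>r'. r' < r \<longrightarrow> (\<exists>A B. \<forall>z t. norm z \<le> r' \<longrightarrow>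
           norm (f (z, t)) \<le> A * exp (B * norm t powr k))))"

definition O_sector :: "real \<Rightarrow> real \<Rightarrow> ((complex^'n::finite) \<times> complex \<Rightarrow> complex) \<Rightarrow> bool" where
  "O_sector k d F \<longleftrightarrow> (\<exists>r>0. \<exists>r1>0. \<exists>\<epsilon>>0. \<epsilon> \<le> 2 * pi \<and> (\<exists>f.
      holo_nt (ball 0 r \<times> disc_sector d \<epsilon> r1) f \<and>
      (\<exists>\<delta>>0. \<forall>z t. norm z < \<delta> \<longrightarrow> norm t < \<delta> \<longrightarrow> f (z, t) = F (z, t)) \<and>
      (\<forall>r' r1' \<epsilon>'. r' < r \<longrightarrow> r1' < r1 \<longrightarrow> \<epsilon>' < \<epsilon> \<longrightarrow> (\<exists>A B. \<forall>z t. norm z \<le> r' \<longrightarrow>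
           t \<in> disc_sector d \<epsilon>' r1' \<longrightarrow> norm (f (z, t)) \<le> A * exp (B * norm t powr k)))))"

text \<open>k-summability of the formal solution in direction d: the k-Borel series
sum_j u_j(z) t^j / Gamma(1 + j/k) converges for small |z|,|t| and belongs to O^k.\<close>
definition k_summable :: "real \<Rightarrow> real \<Rightarrow> real^'n^'n \<Rightarrow> (complex^'n \<Rightarrow> complex) \<Rightarrow> bool" where
  "k_summable k d A \<phi> \<longleftrightarrow>
     (\<exists>\<delta>>0. \<forall>z t. norm z < \<delta> \<longrightarrow> norm t < \<delta> \<longrightarrow>
        summable (\<lambda>j. ucoef A \<phi> j z / of_real (Gamma (1 + real j / k)) * t ^ j)) \<and>
     O_sector k d (\<lambda>(z, t). \<Sum>j. ucoef A \<phi> j z / of_real (Gamma (1 + real j / k)) * t ^ j)"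

definition alpha_n :: "nat \<Rightarrow> real" where
  "alpha_n n = pi powr (real n / 2) / Gamma (1 + real n / 2)"

text \<open>Surface integral over the unit sphere S(0,1) of R^n, with the surface measure
sigma defined (as in Folland, Thm 2.49) by sigma(E) = n * lambda({r y. 0 < r <= 1, y in E}),
so that int_S g dS = n * int_{B(0,1)} g(y/|y|) dy.\<close>
definition sphere_integral :: "(real^'n \<Rightarrow> complex) \<Rightarrow> complex" where
  "sphere_integral g = of_nat CARD('n) * integral (ball 0 1) (\<lambda>y. g (scaleR (1 / norm y) y))"

definition shift_pt :: "real^'n^'n \<Rightarrow> complex^'n \<Rightarrow> complex \<Rightarrow> real^'n \<Rightarrow> complex^'n" where
  "shift_pt Q z t y = (\<chi> i. z $ i + t * complex_of_real ((Q *v y) $ i))"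

definition sqrt_diag :: "real^'n^'n \<Rightarrow> real^'n^'n" where
  "sqrt_diag L = (\<chi> i j. if i = j then sqrt (L $ i $ i) else 0)"

definition M_ball :: "real^'n^'n \<Rightarrow> real^'n^'n \<Rightarrow> (complex^'n \<Rightarrow> complex) \<Rightarrow> (complex^'n::finite) \<times> complex \<Rightarrow> complex" where
  "M_ball A C \<phi> = (\<lambda>(z, t). complex_of_real (1 / alpha_n CARD('n)) *
      integral (ball 0 1) (\<lambda>y. \<phi> (shift_pt (C ** sqrt_diag (transpose C ** A ** C)) z t y)))"

definition M_sphere :: "real^'n^'n \<Rightarrow> real^'n^'n \<Rightarrow> (complex^'n \<Rightarrow> complex) \<Rightarrow> (complex^'n::finite) \<times> complex \<Rightarrow> complex" where
  "M_sphere A C \<phi> = (\<lambda>(z, t). complex_of_real (1 / (real CARD('n) * alpha_n CARD('n))) *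
      sphere_integral (\<lambda>y. \<phi> (shift_pt (C ** sqrt_diag (transpose C ** A ** C)) z t y)))"

end

theory Submission
  imports Defs "HOL-Complex_Analysis.Complex_Analysis"
begin

text \<open>
  Expand \<open>\<phi>(z + t Q y) = \<Sum>\<^sub>m h\<^sub>m(y) t\<^sup>m\<close> with \<open>Q = C \<Lambda>\<^bsup>1/2\<^esup>\<close>. Since \<open>Q Q\<^sup>T = A\<close>, the Laplacian in \<open>y\<close> turns \<open>\<phi>\<close>
  into \<open>t\<^sup>2 P\<phi>\<close>, and integrating against the weight \<open>(1 - \<bar>y\<bar>\<^sup>2)\<^sup>2\<close> over the ball gives the recursion
  \<open>m (n + m - 2) \<sigma>\<^sub>m[\<phi>] = \<sigma>\<^sub>m\<^sub>-\<^sub>2[P\<phi>]\<close> for the integrals \<open>\<sigma>\<^sub>m\<close> of \<open>h\<^sub>m\<close> over the sphere. With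
  \<open>W\<^sub>a(z,s) = \<Sum>\<^sub>j u\<^sub>j(z) s\<^sup>j / (a)\<^sub>j\<close> this is Pizzetti's formula: the spherical mean is \<open>W\<^sub>a(z, t\<^sup>2/4)\<close> with \<open>a = n/2\<close>,
  the solid mean has \<open>a = n/2 + 1\<close>, and the Borel series of the formal solution is \<open>W\<^sub>1(z,s)\<close>.

  Part (i) then follows from Cauchy's estimates, applied on circles of radius about \<open>j\<^bsup>1/2\<^esup>\<close> to the coefficient of \<open>t\<^bsup>2j\<^esup>\<close>.
  For part (ii), \<open>s = t\<^sup>2/4\<close> exchanges the direction \<open>d\<close> with the pair of directions \<open>d/2\<close> and \<open>d/2 + \<pi>\<close> and the orders 1 and 2,
  and exponential growth of \<open>W\<^sub>a\<close> in a sector does not depend on the half-integer \<open>a\<close>: an integral transform with kernel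
  \<open>y\<^bsup>2a-1\<^esup> (1 - y\<^sup>2)\<^bsup>1/2\<^esup>\<close> on \<open>[0,1]\<close> leads from \<open>W\<^sub>a\<close> to the function with parameter \<open>a + 3/2\<close>, and \<open>1 + (s/a) \<partial>\<^sub>s\<close> leads from
  parameter \<open>a + 1\<close> back to \<open>a\<close>.
\<close>

section \<open>Holomorphic functions on complex normed spaces\<close>

text \<open>The growth spaces are defined through extension of a germ at the origin, so identities
  are needed only between power series near 0; the remaining work is the transfer of growth. It
  rests on the bound |u_j| \<le> M K^j j!, which comes out of the recursion itself: solve it for u_j
  and estimate the spherical integrals by Cauchy. This gives every W_a a positive radius of
  convergence. The weight vanishes to second order on the unit sphere, so no boundary integral
  appears; the price is that the ball integrals of |y|^k h_m are needed for k = 0, 2, 4. Since h_m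
  is homogeneous of degree m, each of them is a rational multiple of the spherical integral. Circles
  with R^2 about j balance two factors: exp(B R^2) stays geometric in j, while R^(2j) cancels the
  factorial growth of (a)_j. For odd n the parameters n/2 and 1 differ by an odd multiple of 1/2, so
  integer changes of the parameter alone cannot connect the means with the Borel series.\<close>

lemma compact_norm_bound:
  fixes f :: "'a::topological_space \<Rightarrow> 'b::real_normed_vector"
  assumes "compact K" "continuous_on K f"
  obtains M where "\<And>x. x \<in> K \<Longrightarrow> norm (f x) \<le> M"
proof -
  have "bounded (f ` K)" by (intro compact_imp_bounded compact_continuous_image assms)
  then show ?thesis using that unfolding bounded_iff by blast
qed

text \<open>Abstracts from the scalar multiplication, so that the functions of \<open>z\<close> and of \<open>(z, t)\<close> are treated together.\<close>
locale cspace =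
  fixes sc :: "complex \<Rightarrow> 'a::euclidean_space \<Rightarrow> 'a"
  assumes sc_add: "sc c (v + w) = sc c v + sc c w"
    and sc_plus: "sc (c + d) v = sc c v + sc d v"
    and sc_mult: "sc (c * d) v = sc c (sc d v)"
    and sc_of_real: "sc (of_real x) v = x *\<^sub>R v"
    and norm_sc: "norm (sc c v) = norm c * norm v"
begin

lemma bounded_bilinear_sc: "bounded_bilinear sc"
proof
  show "sc (a + a') b = sc a b + sc a' b" for a a' b by (rule sc_plus)
  show "sc a (b + b') = sc a b + sc a b'" for a b b' by (rule sc_add)
  show "sc (r *\<^sub>R a) b = r *\<^sub>R sc a b" for r a b
    by (metis scaleR_conv_of_real sc_mult sc_of_real)
  show "sc a (r *\<^sub>R b) = r *\<^sub>R sc a b" for a r b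
    by (metis sc_of_real sc_mult mult.commute)
  show "\<exists>K. \<forall>a b. norm (sc a b) \<le> norm a * norm b * K"
    by (rule exI[of _ 1]) (simp add: norm_sc)
qed

lemma sc_zero [simp]: "sc 0 v = 0" "sc c 0 = 0"
  by (simp_all add: bounded_bilinear.zero_left[OF bounded_bilinear_sc]
      bounded_bilinear.zero_right[OF bounded_bilinear_sc])

lemma continuous_on_sc [continuous_intros]:
  "continuous_on S f \<Longrightarrow> continuous_on S g \<Longrightarrow> continuous_on S (\<lambda>x. sc (f x) (g x))"
  by (rule bounded_bilinear.continuous_on[OF bounded_bilinear_sc])

definition hol :: "'a set \<Rightarrow> ('a \<Rightarrow> complex) \<Rightarrow> bool" where
  "hol S f \<longleftrightarrow> (\<forall>z\<in>S. \<exists>L. (f has_derivative L) (at z) \<and> (\<forall>c v. L (sc c v) = c * L v))"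

text \<open>A one-variable \<open>deriv\<close> along the complex line through z in direction v: a
  total function to which the one-variable Cauchy theory applies directly, and the full derivative
  wherever f is holomorphic (\<open>Dd_eq\<close>).\<close>

definition Dd :: "('a \<Rightarrow> complex) \<Rightarrow> 'a \<Rightarrow> 'a \<Rightarrow> complex" where
  "Dd f z v = deriv (\<lambda>c. f (z + sc c v)) 0"

lemma line_derivative:
  assumes "(f has_derivative L) (at (z + sc c v))" "\<And>c v. L (sc c v) = c * L v"
  shows "((\<lambda>c. f (z + sc c v)) has_field_derivative L v) (at c)"
proof -
  have d: "((\<lambda>c. z + sc c v) has_derivative (\<lambda>h. sc h v)) (at c)"
    using bounded_linear_imp_has_derivative[OF bounded_bilinear.bounded_linear_left[OF bounded_bilinear_sc]]
    by (auto intro!: derivative_eq_intros)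
  have "((\<lambda>c. f (z + sc c v)) has_derivative (\<lambda>h. L (sc h v))) (at c)"
    using diff_chain_at[OF d assms(1)] by (simp add: o_def)
  then show ?thesis
    by (simp add: has_field_derivative_def assms(2) mult.commute fun_eq_iff mult_commute_abs)
qed

lemma Dd_eq:
  assumes "(f has_derivative L) (at z)" "\<And>c v. L (sc c v) = c * L v"
  shows "Dd f z = L"
proof
  fix v
  have "((\<lambda>c. f (z + sc c v)) has_field_derivative L v) (at 0)"
    by (rule line_derivative) (use assms in auto)
  then show "Dd f z v = L v" unfolding Dd_def by (rule DERIV_imp_deriv)
qed

lemma hol_has_derivative:
  assumes "hol S f" "z \<in> S"
  shows "(f has_derivative Dd f z) (at z)" "Dd f z (sc c v) = c * Dd f z v"
proof -
  obtain L where "(f has_derivative L) (at z)" "\<And>c v. L (sc c v) = c * L v"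
    using assms unfolding hol_def by blast
  moreover from this have "Dd f z = L" by (rule Dd_eq)
  ultimately show "(f has_derivative Dd f z) (at z)" "Dd f z (sc c v) = c * Dd f z v" by auto
qed

lemma holI:
  assumes "\<And>z. z \<in> S \<Longrightarrow> (f has_derivative L z) (at z)" "\<And>z c v. z \<in> S \<Longrightarrow> L z (sc c v) = c * L z v"
  shows "hol S f"
  using assms unfolding hol_def by blast

lemma hol_subset: "hol S f \<Longrightarrow> T \<subseteq> S \<Longrightarrow> hol T f"
  unfolding hol_def by blast

lemma hol_local:
  assumes "\<And>z. z \<in> S \<Longrightarrow> \<exists>U g. open U \<and> z \<in> U \<and> hol U g \<and> (\<forall>w\<in>U. f w = g w)"
  shows "hol S f"
  unfolding hol_def
proof
  fix z assume "z \<in> S"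
  from assms[OF this] obtain U g where U: "open U" "z \<in> U" "hol U g" "\<And>w. w \<in> U \<Longrightarrow> f w = g w"
    by blast
  from hol_has_derivative[OF U(3,2)]
  have "(f has_derivative Dd g z) (at z)"
    using has_derivative_transform_within_open[of g "Dd g z" z UNIV U f] U by simp
  then show "\<exists>L. (f has_derivative L) (at z) \<and> (\<forall>c v. L (sc c v) = c * L v)"
    using hol_has_derivative(2)[OF U(3,2)] by blast
qed

lemma hol_cong:
  assumes "open S" "hol S g" "\<And>z. z \<in> S \<Longrightarrow> f z = g z"
  shows "hol S f"
proof (rule hol_local)
  fix z assume "z \<in> S"
  then show "\<exists>U g. open U \<and> z \<in> U \<and> hol U g \<and> (\<forall>w\<in>U. f w = g w)"
    using assms by (intro exI[of _ S] exI[of _ g]) simp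
qed

lemma hol_continuous_on: "hol S f \<Longrightarrow> continuous_on S f"
  by (meson continuous_at_imp_continuous_on hol_has_derivative(1) has_derivative_continuous)

lemma hol_const: "hol S (\<lambda>z. k)"
  by (rule holI[of _ _ "\<lambda>_ _. 0"]) auto

lemma hol_add: "hol S f \<Longrightarrow> hol S g \<Longrightarrow> hol S (\<lambda>z. f z + g z)"
  by (rule holI[of _ _ "\<lambda>z v. Dd f z v + Dd g z v"])
    (auto intro!: has_derivative_add simp: hol_has_derivative algebra_simps)

lemma hol_mult: "hol S f \<Longrightarrow> hol S g \<Longrightarrow> hol S (\<lambda>z. f z * g z)"
proof (rule holI[of _ _ "\<lambda>z v. f z * Dd g z v + Dd f z v * g z"])
  fix z assume "hol S f" "hol S g" "z \<in> S"
  then show "((\<lambda>z. f z * g z) has_derivative (\<lambda>v. f z * Dd g z v + Dd f z v * g z)) (at z)"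
    by (intro has_derivative_mult hol_has_derivative(1))
qed (simp add: hol_has_derivative(2) distrib_left)

lemma hol_cmult: "hol S f \<Longrightarrow> hol S (\<lambda>z. k * f z)"
  by (rule hol_mult[OF hol_const])

lemma hol_diff: "hol S f \<Longrightarrow> hol S g \<Longrightarrow> hol S (\<lambda>z. f z - g z)"
  using hol_add[OF _ hol_cmult[of S g "-1"]] by force

lemma hol_sum: "(\<And>i. i \<in> I \<Longrightarrow> hol S (f i)) \<Longrightarrow> hol S (\<lambda>z. \<Sum>i\<in>I. f i z)"
  by (induction I rule: infinite_finite_induct) (auto intro: hol_const hol_add)

lemma hol_line:
  assumes "hol S f" "z + sc c v \<in> S"
  shows "((\<lambda>c. f (z + sc c v)) has_field_derivative Dd f (z + sc c v) v) (at c)"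
  by (rule line_derivative) (use assms hol_has_derivative in auto)

lemma hol_line_holomorphic:
  assumes "hol S f" "\<And>c. c \<in> U \<Longrightarrow> z + sc c v \<in> S"
  shows "(\<lambda>c. f (z + sc c v)) holomorphic_on U"
  using hol_line[OF assms(1)] assms(2)
  by (meson holomorphic_onI field_differentiable_at_within field_differentiable_def)

lemma linear_Dd: "hol S f \<Longrightarrow> z \<in> S \<Longrightarrow> bounded_linear (Dd f z)"
  using hol_has_derivative(1) has_derivative_bounded_linear by blast

text \<open>The map taking c to z + c v carries the disc of radius \<sigma> about w into the closed
  ball of radius \<rho> about z, so the one-variable Cauchy estimate applies with a bound M taken on
  the ball. A general centre w is allowed because Taylor remainders need derivatives away from
  0.\<close>

lemma line_Cauchy_inequality:
  assumes "hol S f" "cball z \<rho> \<subseteq> S" "\<rho> > 0" "v \<noteq> 0" "\<And>w. w \<in> cball z \<rho> \<Longrightarrow> norm (f w) \<le> M"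
    "norm w + \<sigma> \<le> \<rho> / norm v" "\<sigma> > 0"
  shows "norm ((deriv ^^ n) (\<lambda>c. f (z + sc c v)) w) \<le> fact n * M / \<sigma> ^ n"
proof -
  have m: "z + sc c v \<in> cball z \<rho>" if "c \<in> cball w \<sigma>" for c
  proof -
    have "norm c \<le> norm w + \<sigma>"
      using that norm_triangle_ineq2[of c w] by (simp add: dist_norm norm_minus_commute)
    then have "norm c \<le> \<rho> / norm v" using assms by linarith
    then have "norm c * norm v \<le> \<rho>" using assms(4) by (simp add: field_simps)
    then show ?thesis by (simp add: dist_norm norm_sc)
  qed
  have h: "(\<lambda>c. f (z + sc c v)) holomorphic_on cball w \<sigma>"
    by (rule hol_line_holomorphic[OF assms(1)]) (use m assms(2) in blast)
  show ?thesis
  proof (rule Cauchy_inequality)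
    show "(\<lambda>c. f (z + sc c v)) holomorphic_on ball w \<sigma>"
      using h holomorphic_on_subset ball_subset_cball by blast
    show "continuous_on (cball w \<sigma>) (\<lambda>c. f (z + sc c v))"
      using h holomorphic_on_imp_continuous_on by blast
    show "cmod (f (z + sc x v)) \<le> M" if "cmod (w - x) = \<sigma>" for x
      by (rule assms(5), rule m) (use that in \<open>simp add: dist_norm\<close>)
  qed (use assms in auto)
qed

text \<open>The case n = 1 at the centre, with the largest radius \<rho> / |v| that the complex line
  allows. It turns sup bounds into derivative bounds, both for limits of sequences and for growth in
  sectors.\<close>

lemma norm_Dd_le:
  assumes "hol S f" "cball z \<rho> \<subseteq> S" "\<rho> > 0" "\<And>w. w \<in> cball z \<rho> \<Longrightarrow> norm (f w) \<le> M"
  shows "norm (Dd f z v) \<le> M / \<rho> * norm v"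
proof (cases "v = 0")
  case True
  have "z \<in> S" using assms(2,3) by auto
  then have "Dd f z 0 = 0" using linear_Dd[OF assms(1)] bounded_linear.linear linear_0 by blast
  then show ?thesis using True by simp
next
  case False
  show ?thesis
    using line_Cauchy_inequality[OF assms(1-3) False assms(4), of 0 "\<rho> / norm v" 1] assms(3) False
    by (simp add: Dd_def)
qed

text \<open>Weierstrass's theorem: the Cauchy estimate makes the derivatives uniformly Cauchy on a
  smaller ball, so limit and derivative may be exchanged; complex homogeneity of the derivatives
  survives pointwise limits.\<close>

lemma hol_uniform_limit:
  assumes S: "open S" and f: "\<And>n. hol S (f n)"
    and ul: "\<And>z. z \<in> S \<Longrightarrow> \<exists>\<rho>>0. ball z \<rho> \<subseteq> S \<and> uniform_limit (ball z \<rho>) f g sequentially"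
  shows "hol S g"
  unfolding hol_def
proof
  fix z assume "z \<in> S"
  then obtain \<rho> where \<rho>: "\<rho> > 0" "ball z \<rho> \<subseteq> S" "uniform_limit (ball z \<rho>) f g sequentially"
    using ul by blast
  \<comment> \<open>Closed balls of radius \<delta> about points of the \<delta>-ball stay inside
    the \<rho>-ball, where the convergence is uniform.\<close>
  define \<delta> where "\<delta> = \<rho> / 3"
  have \<delta>: "\<delta> > 0" using \<rho> by (simp add: \<delta>_def)
  have sub: "cball x \<delta> \<subseteq> ball z \<rho>" if "x \<in> ball z \<delta>" for x
  proof
    fix y assume "y \<in> cball x \<delta>"
    then show "y \<in> ball z \<rho>" using that dist_triangle[of z y x] \<rho>(1) by (simp add: \<delta>_def)
  qed
  have est: "\<exists>N. \<forall>m\<ge>N. \<forall>n\<ge>N. \<forall>x\<in>ball z \<delta>. \<forall>h. norm (Dd (f m) x h - Dd (f n) x h) \<le> e * norm h"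
    if "e > 0" for e
  proof -
    have "\<forall>\<^sub>F n in sequentially. \<forall>x\<in>ball z \<rho>. dist (f n x) (g x) < e * \<delta> / 2"
      using uniform_limitD[OF \<rho>(3), of "e * \<delta> / 2"] \<open>e > 0\<close> \<delta> by simp
    then obtain N where N: "\<And>n x. n \<ge> N \<Longrightarrow> x \<in> ball z \<rho> \<Longrightarrow> dist (f n x) (g x) < e * \<delta> / 2"
      unfolding eventually_sequentially by blast
    show ?thesis
    proof (rule exI[of _ N], intro allI impI ballI)
      fix m n x h assume mn: "m \<ge> N" "n \<ge> N" and x: "x \<in> ball z \<delta>"
      have xS: "x \<in> S" using sub[OF x] \<rho>(2) \<delta> by (meson centre_in_cball less_imp_le subsetD)
      have e: "Dd (\<lambda>y. f m y - f n y) x = (\<lambda>h. Dd (f m) x h - Dd (f n) x h)"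
        by (rule Dd_eq) (auto intro!: has_derivative_diff hol_has_derivative f xS
            simp: hol_has_derivative(2)[OF f xS] algebra_simps)
      have "norm (Dd (\<lambda>y. f m y - f n y) x h) \<le> e * \<delta> / \<delta> * norm h"
      proof (rule norm_Dd_le)
        show "hol S (\<lambda>y. f m y - f n y)" by (intro hol_diff f)
        show "cball x \<delta> \<subseteq> S" using sub[OF x] \<rho>(2) by blast
        show "norm (f m w - f n w) \<le> e * \<delta>" if "w \<in> cball x \<delta>" for w
        proof -
          have w: "w \<in> ball z \<rho>" using that sub[OF x] by blast
          show ?thesis using N[OF mn(1) w] N[OF mn(2) w] dist_triangle2[of "f m w" "f n w" "g w"]
            by (simp add: dist_norm)
        qed
      qed (use \<delta> in auto)
      then show "norm (Dd (f m) x h - Dd (f n) x h) \<le> e * norm h" using \<delta> by (simp add: e)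
    qed
  qed
  have "\<exists>l. (\<lambda>n. Dd (f n) x h) \<longlonglongrightarrow> l" if x: "x \<in> ball z \<delta>" for x h
  proof -
    have "Cauchy (\<lambda>n. Dd (f n) x h)"
    proof (rule CauchyI)
      fix e :: real assume "e > 0"
      then obtain N where N: "\<And>m n. m \<ge> N \<Longrightarrow> n \<ge> N \<Longrightarrow> norm (Dd (f m) x h - Dd (f n) x h) \<le> e / (norm h + 1) * norm h"
        using est[of "e / (norm h + 1)"] x by (metis add_nonneg_pos divide_pos_pos norm_ge_zero zero_less_one)
      have "e / (norm h + 1) * norm h < e"
        using \<open>e > 0\<close> by (simp add: field_simps add_pos_nonneg)
      then show "\<exists>M. \<forall>m\<ge>M. \<forall>n\<ge>M. norm (Dd (f m) x h - Dd (f n) x h) < e"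
        using N by (meson le_less_trans)
    qed
    then show ?thesis by (simp add: Cauchy_convergent_iff convergent_def)
  qed
  then obtain D where D: "\<And>x h. x \<in> ball z \<delta> \<Longrightarrow> (\<lambda>n. Dd (f n) x h) \<longlonglongrightarrow> D x h" by metis
  have "\<exists>g'. \<forall>x\<in>ball z \<delta>. (\<lambda>n. f n x) \<longlonglongrightarrow> g' x \<and> (g' has_derivative D x) (at x within ball z \<delta>)"
  proof (rule has_derivative_sequence)
    show "(f n has_derivative Dd (f n) x) (at x within ball z \<delta>)" if "x \<in> ball z \<delta>" for n x
      using hol_has_derivative(1)[OF f] sub[OF that] \<rho>(2) \<delta>
      by (meson centre_in_cball has_derivative_at_withinI less_imp_le subsetD)
    show "\<forall>\<^sub>F n in sequentially. \<forall>x\<in>ball z \<delta>. \<forall>h. norm (Dd (f n) x h - D x h) \<le> e * norm h"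
      if "e > 0" for e
    proof -
      obtain N where N: "\<And>m n x h. m \<ge> N \<Longrightarrow> n \<ge> N \<Longrightarrow> x \<in> ball z \<delta> \<Longrightarrow> norm (Dd (f m) x h - Dd (f n) x h) \<le> e * norm h"
        using est[OF \<open>e > 0\<close>] by blast
      have "norm (Dd (f m) x h - D x h) \<le> e * norm h" if "m \<ge> N" "x \<in> ball z \<delta>" for m x h
      proof (rule tendsto_upperbound)
        show "(\<lambda>n. norm (Dd (f m) x h - Dd (f n) x h)) \<longlonglongrightarrow> norm (Dd (f m) x h - D x h)"
          by (intro tendsto_intros D that)
        show "\<forall>\<^sub>F n in sequentially. norm (Dd (f m) x h - Dd (f n) x h) \<le> e * norm h"
          unfolding eventually_sequentially using N that by blast
      qed auto
      then show ?thesis unfolding eventually_sequentially by blast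
    qed
    show "z \<in> ball z \<delta>" using \<delta> by simp
    show "(\<lambda>n. f n z) \<longlonglongrightarrow> g z" using tendsto_uniform_limitI[OF \<rho>(3)] \<rho>(1) by simp
  qed auto
  then obtain g' where g': "\<And>x. x \<in> ball z \<delta> \<Longrightarrow> (\<lambda>n. f n x) \<longlonglongrightarrow> g' x"
     "\<And>x. x \<in> ball z \<delta> \<Longrightarrow> (g' has_derivative D x) (at x within ball z \<delta>)" by blast
  have gg: "g' x = g x" if "x \<in> ball z \<delta>" for x
  proof -
    have "x \<in> ball z \<rho>" using sub[OF that] \<delta> by (meson centre_in_cball less_imp_le subsetD)
    then show ?thesis using g'(1)[OF that] tendsto_uniform_limitI[OF \<rho>(3)] LIMSEQ_unique by blast
  qed
  have zz: "z \<in> ball z \<delta>" using \<delta> by simp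
  have "(g' has_derivative D z) (at z)"
    using g'(2)[OF zz] at_within_open[OF zz] by simp
  then have 1: "(g has_derivative D z) (at z)"
    using has_derivative_transform_within_open[of g' "D z" z UNIV "ball z \<delta>" g] gg zz by simp
  have 2: "D z (sc c v) = c * D z v" for c v
  proof -
    have "(\<lambda>n. Dd (f n) z (sc c v)) \<longlonglongrightarrow> c * D z v"
      unfolding hol_has_derivative(2)[OF f \<open>z \<in> S\<close>] by (intro tendsto_intros D zz)
    then show ?thesis using D[OF zz] LIMSEQ_unique by blast
  qed
  show "\<exists>L. (g has_derivative L) (at z) \<and> (\<forall>c v. L (sc c v) = c * L v)" using 1 2 by blast
qed

lemma hol_suminf:
  assumes S: "open S" and f: "\<And>n. hol S (f n)"
    and M: "\<And>n z. z \<in> S \<Longrightarrow> norm (f n z) \<le> M n" "summable M"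
  shows "hol S (\<lambda>z. \<Sum>n. f n z)"
proof (rule hol_uniform_limit[OF S, of "\<lambda>n z. \<Sum>i<n. f i z"])
  show "hol S (\<lambda>z. \<Sum>i<n. f i z)" for n by (intro hol_sum f)
  fix z assume "z \<in> S"
  then obtain \<rho> where \<rho>: "\<rho> > 0" "ball z \<rho> \<subseteq> S" using S openE by blast
  have "uniform_limit S (\<lambda>n z. \<Sum>i<n. f i z) (\<lambda>z. \<Sum>n. f n z) sequentially"
    by (rule Weierstrass_m_test) (use M in auto)
  then show "\<exists>\<rho>>0. ball z \<rho> \<subseteq> S \<and> uniform_limit (ball z \<rho>) (\<lambda>n z. \<Sum>i<n. f i z) (\<lambda>z. \<Sum>n. f n z) sequentially"
    using \<rho> uniform_limit_on_subset by blast
qed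

lemma hol_translate:
  assumes "hol S f" "\<And>z. z \<in> T \<Longrightarrow> z + v \<in> S"
  shows "hol T (\<lambda>z. f (z + v))"
proof (rule holI[of _ _ "\<lambda>z. Dd f (z + v)"])
  fix z assume z: "z \<in> T"
  have d: "((\<lambda>z. z + v) has_derivative (\<lambda>h. h)) (at z)" by (auto intro!: derivative_eq_intros)
  show "((\<lambda>z. f (z + v)) has_derivative Dd f (z + v)) (at z)"
    using diff_chain_at[OF d hol_has_derivative(1)[OF assms(1) assms(2)[OF z]]] by (simp add: o_def)
qed (use assms hol_has_derivative(2) in blast)

text \<open>The difference quotients converge locally uniformly by Taylor's theorem on complex lines.\<close>
lemma hol_Dd:
  assumes S: "open S" and f: "hol S f"
  shows "hol S (\<lambda>z. Dd f z v)"
proof (cases "v = 0")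
  case True
  have "hol S (\<lambda>z. 0)" by (rule hol_const)
  then show ?thesis
  proof (rule hol_cong[OF S])
    show "Dd f z v = 0" if "z \<in> S" for z
      using linear_Dd[OF f that] bounded_linear.linear linear_0 True by blast
  qed
next
  case False
  show ?thesis
  proof (rule hol_local)
    fix z0 assume "z0 \<in> S"
    then obtain \<rho> where \<rho>: "\<rho> > 0" "cball z0 \<rho> \<subseteq> S" using S open_contains_cball by blast
    obtain M where M: "\<And>w. w \<in> cball z0 \<rho> \<Longrightarrow> norm (f w) \<le> M"
      by (rule compact_norm_bound[OF compact_cball continuous_on_subset[OF hol_continuous_on[OF f] \<rho>(2)]]) blast
    define \<delta> where "\<delta> = \<rho> / 2"
    have \<delta>: "\<delta> > 0" using \<rho> by (simp add: \<delta>_def)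
    have sub: "cball z \<delta> \<subseteq> cball z0 \<rho>" if "z \<in> ball z0 \<delta>" for z
    proof
      fix y assume "y \<in> cball z \<delta>"
      then show "y \<in> cball z0 \<rho>" using that dist_triangle[of z0 y z] by (simp add: \<delta>_def)
    qed
    \<comment> \<open>Half of the radius available on the line, so that a disc of radius \<tau>
      about any point of the \<tau>-disc is still admissible for the Cauchy estimate.\<close>
    define \<tau> where "\<tau> = \<delta> / norm v / 2"
    have \<tau>: "\<tau> > 0" using \<delta> False by (simp add: \<tau>_def)
    have tv: "\<tau> * norm v = \<delta> / 2" using False by (simp add: \<tau>_def)
    define c :: "nat \<Rightarrow> complex" where "c n = of_real (\<tau> / real (n+1))" for n
    have c0: "c n \<noteq> 0" for n using \<tau> by (simp add: c_def del: of_nat_Suc of_real_divide)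
    have nc: "norm (c n) = \<tau> / real (n+1)" for n using \<tau> by (simp only: c_def norm_of_real) simp
    have cle: "norm (c n) \<le> \<tau>" for n using \<tau> by (simp add: nc field_simps)
    \<comment> \<open>Cauchy's bound 2! M / \<tau>^2 for the second derivative along the line; it
      controls the first-order Taylor remainder.\<close>
    define B where "B = 2 * M / \<tau>\<^sup>2"
    have est: "norm ((f (z + sc (c n) v) - f z) / c n - Dd f z v) \<le> B * norm (c n)"
      if z: "z \<in> ball z0 \<delta>" for z n
    proof -
      let ?g = "\<lambda>c. f (z + sc c v)"
      have hg: "?g holomorphic_on ball 0 (2*\<tau>)"
      proof (rule hol_line_holomorphic[OF f])
        fix d assume "d \<in> ball (0::complex) (2*\<tau>)"
        then have "norm d * norm v \<le> 2 * \<tau> * norm v" by (intro mult_right_mono) auto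
        then have "z + sc d v \<in> cball z \<delta>" using tv by (simp add: dist_norm norm_sc)
        then show "z + sc d v \<in> S" using sub[OF z] \<rho>(2) by blast
      qed
      have 1: "norm ((deriv ^^ 0) ?g (c n) - (\<Sum>i\<le>1. (deriv ^^ i) ?g 0 * (c n - 0) ^ i / fact i)) \<le> B * norm (c n - 0) ^ Suc 1 / fact 1"
      proof (rule complex_Taylor[where S = "cball 0 \<tau>" and f = "\<lambda>i. (deriv ^^ i) ?g"])
        show "convex (cball 0 \<tau> :: complex set)" by simp
        show "0 \<in> cball (0::complex) \<tau>" "c n \<in> cball 0 \<tau>" using \<tau> cle by auto
        show "((deriv ^^ i) ?g has_field_derivative (deriv ^^ Suc i) ?g x) (at x within cball 0 \<tau>)"
          if "x \<in> cball 0 \<tau>" for i x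
        proof -
          have "(deriv ^^ i) ?g holomorphic_on ball 0 (2*\<tau>)" by (intro holomorphic_higher_deriv hg) auto
          moreover have "x \<in> ball 0 (2*\<tau>)" using that \<tau> by auto
          ultimately have "((deriv ^^ i) ?g has_field_derivative deriv ((deriv ^^ i) ?g) x) (at x)"
            using holomorphic_derivI open_ball by blast
          then show ?thesis by (simp add: has_field_derivative_at_within)
        qed
        show "norm ((deriv ^^ Suc 1) ?g x) \<le> B" if "x \<in> cball 0 \<tau>" for x
        proof -
          have "norm ((deriv ^^ 2) ?g x) \<le> fact 2 * M / \<tau> ^ 2"
          proof (rule line_Cauchy_inequality[OF f _ \<delta> False])
            show "cball z \<delta> \<subseteq> S" using sub[OF z] \<rho>(2) by blast
            show "norm (f w) \<le> M" if "w \<in> cball z \<delta>" for w using M sub[OF z] that by blast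
            show "norm x + \<tau> \<le> \<delta> / norm v" using that by (simp add: \<tau>_def)
          qed (rule \<tau>)
          then show ?thesis by (simp add: B_def numeral_2_eq_2)
        qed
      qed
      have "norm (f (z + sc (c n) v) - (f z + Dd f z v * c n)) \<le> B * norm (c n) * norm (c n)"
        using 1 by (simp add: Dd_def power2_eq_square mult.assoc)
      moreover have "f (z + sc (c n) v) - (f z + Dd f z v * c n) = ((f (z + sc (c n) v) - f z) / c n - Dd f z v) * c n"
        using c0 by (simp add: field_simps)
      ultimately have "norm ((f (z + sc (c n) v) - f z) / c n - Dd f z v) * norm (c n) \<le> B * norm (c n) * norm (c n)"
        by (simp add: norm_mult)
      then show ?thesis using c0[of n] by simp
    qed
    have inS: "z + sc (c n) v \<in> S" if "z \<in> ball z0 \<delta>" for z n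
    proof -
      have "norm (c n) * norm v \<le> \<tau> * norm v" by (intro mult_right_mono cle) auto
      then have "z + sc (c n) v \<in> cball z \<delta>" using tv \<delta> by (simp add: dist_norm norm_sc)
      then show ?thesis using sub[OF that] \<rho>(2) by blast
    qed
    have ul: "uniform_limit (ball z0 \<delta>) (\<lambda>n z. (f (z + sc (c n) v) - f z) / c n) (\<lambda>z. Dd f z v) sequentially"
    proof (rule uniform_limitI)
      fix e :: real assume "e > 0"
      have "(\<lambda>n. B * norm (c n)) \<longlonglongrightarrow> B * 0"
        unfolding nc by (intro tendsto_intros LIMSEQ_Suc[OF lim_const_over_n, unfolded Suc_eq_plus1])
      then have "\<forall>\<^sub>F n in sequentially. B * norm (c n) < e"
        using \<open>e > 0\<close> by (simp add: order_tendstoD(2))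
      then show "\<forall>\<^sub>F n in sequentially. \<forall>z\<in>ball z0 \<delta>. dist ((f (z + sc (c n) v) - f z) / c n) (Dd f z v) < e"
      proof eventually_elim
        case (elim n)
        show ?case unfolding dist_norm using le_less_trans[OF est elim] by blast
      qed
    qed
    have "hol (ball z0 \<delta>) (\<lambda>z. Dd f z v)"
    proof (rule hol_uniform_limit[OF open_ball, of _ _ "\<lambda>n z. (f (z + sc (c n) v) - f z) / c n"])
      show "hol (ball z0 \<delta>) (\<lambda>z. (f (z + sc (c n) v) - f z) / c n)" for n
      proof -
        have "hol (ball z0 \<delta>) (\<lambda>z. f (z + sc (c n) v))" by (rule hol_translate[OF f inS])
        moreover have "hol (ball z0 \<delta>) f"
        proof (rule hol_subset[OF f])
          have "ball z0 \<delta> \<subseteq> cball z0 \<rho>" using \<rho>(1) by (auto simp: \<delta>_def)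
          then show "ball z0 \<delta> \<subseteq> S" using \<rho>(2) by blast
        qed
        ultimately have "hol (ball z0 \<delta>) (\<lambda>z. inverse (c n) * (f (z + sc (c n) v) - f z))"
          by (intro hol_cmult hol_diff)
        then show ?thesis by (simp add: field_simps)
      qed
      fix z assume "z \<in> ball z0 \<delta>"
      then obtain \<sigma> where "\<sigma> > 0" "ball z \<sigma> \<subseteq> ball z0 \<delta>" using open_ball openE by blast
      then show "\<exists>\<rho>>0. ball z \<rho> \<subseteq> ball z0 \<delta> \<and> uniform_limit (ball z \<rho>) (\<lambda>n z. (f (z + sc (c n) v) - f z) / c n) (\<lambda>z. Dd f z v) sequentially"
        using ul uniform_limit_on_subset by blast
    qed
    moreover have "z0 \<in> ball z0 \<delta>" using \<delta> by simp
    ultimately show "\<exists>U g. open U \<and> z0 \<in> U \<and> hol U g \<and> (\<forall>w\<in>U. Dd f w v = g w)"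
      using open_ball by blast
  qed
qed

end

section \<open>Integration over the unit ball\<close>

text \<open>Functions of y / |y| are continuous only away from the origin, which is a null set;
  hence the punctured ball and a separate bound.\<close>

lemma integrable_ball_punctured:
  fixes f :: "'a::euclidean_space \<Rightarrow> complex"
  assumes c: "continuous_on (ball 0 \<rho> - {0}) f" and b: "\<And>y. y \<in> ball 0 \<rho> \<Longrightarrow> norm (f y) \<le> B"
  shows "f integrable_on ball 0 \<rho>"
proof -
  have l: "ball (0::'a) \<rho> - {0} \<in> sets lebesgue" by auto
  have "f integrable_on (ball 0 \<rho> - {0})"
  proof (rule measurable_bounded_by_integrable_imp_integrable)
    show "f \<in> borel_measurable (lebesgue_on (ball 0 \<rho> - {0}))"
      by (rule continuous_imp_measurable_on_sets_lebesgue[OF c l])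
    show "(\<lambda>y. B) integrable_on ball (0::'a) \<rho> - {0}"
      by (intro integrable_on_const fmeasurable.Diff) (auto intro: negligible_imp_measurable)
    show "norm (f x) \<le> B" if "x \<in> ball 0 \<rho> - {0}" for x using that b by auto
  qed (rule l)
  moreover have "negligible {0::'a}" by simp
  ultimately show ?thesis
    using integrable_spike_set_eq[of "ball 0 \<rho> - {0}" "ball 0 \<rho>" f]
    by (metis (no_types, lifting) Diff_Diff_Int Diff_subset Un_Diff_cancel2 inf.cobounded2 negligible_subset Diff_eq_empty_iff sup_bot_left)
qed

lemma integrable_ball_continuous:
  fixes f :: "'a::euclidean_space \<Rightarrow> complex"
  assumes "continuous_on (cball 0 \<rho>) f"
  shows "f integrable_on ball 0 \<rho>"
proof -
  obtain B where B: "\<And>y. y \<in> cball 0 \<rho> \<Longrightarrow> norm (f y) \<le> B"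
    by (rule compact_norm_bound[OF compact_cball assms]) blast
  show ?thesis
  proof (rule integrable_ball_punctured)
    show "continuous_on (ball 0 \<rho> - {0}) f" using assms by (rule continuous_on_subset) auto
    show "norm (f y) \<le> B" if "y \<in> ball 0 \<rho>" for y using B that by auto
  qed
qed

text \<open>Integrals over balls are handled through an enclosing box, where affine substitution and
  differentiation under the integral are carried out.\<close>

lemma ball_subset_cbox: "ball (0::'a::euclidean_space) \<rho> \<subseteq> cbox (-(\<rho> *\<^sub>R One)) (\<rho> *\<^sub>R One)"
proof
  fix x :: 'a assume x: "x \<in> ball 0 \<rho>"
  have "\<bar>x \<bullet> i\<bar> \<le> \<rho>" if "i \<in> Basis" for i using Basis_le_norm[OF that, of x] x by auto
  then show "x \<in> cbox (-(\<rho> *\<^sub>R One)) (\<rho> *\<^sub>R One)" by (fastforce simp: mem_box abs_le_iff)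
qed

lemma has_integral_ball_scale:
  fixes f :: "'a::euclidean_space \<Rightarrow> complex"
  assumes f: "(f has_integral I) (ball 0 1)" and \<rho>: "\<rho> > 0"
  shows "((\<lambda>y. f ((1 / \<rho>) *\<^sub>R y)) has_integral (\<rho> ^ DIM('a) *\<^sub>R I)) (ball 0 \<rho>)"
proof -
  let ?f0 = "\<lambda>y. if y \<in> ball 0 1 then f y else 0"
  have "(?f0 has_integral I) (cbox (-(1 *\<^sub>R One)) (1 *\<^sub>R One))"
    using f by (subst has_integral_restrict[OF ball_subset_cbox])
  from has_integral_affinity'[OF this, of "1 / \<rho>" 0, unfolded add_0_right]
  have "((\<lambda>x. ?f0 ((1 / \<rho>) *\<^sub>R x)) has_integral (I /\<^sub>R (1 / \<rho>) ^ DIM('a))) (cbox (-(\<rho> *\<^sub>R One)) (\<rho> *\<^sub>R One))"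
    using \<rho> by simp
  moreover have "?f0 ((1 / \<rho>) *\<^sub>R x) = (if x \<in> ball 0 \<rho> then f ((1 / \<rho>) *\<^sub>R x) else 0)" for x
    using \<rho> by (auto simp: field_simps)
  moreover have "I /\<^sub>R (1 / \<rho>) ^ DIM('a) = \<rho> ^ DIM('a) *\<^sub>R I"
    using \<rho> by (simp add: power_divide)
  ultimately have "((\<lambda>x. if x \<in> ball 0 \<rho> then f ((1 / \<rho>) *\<^sub>R x) else 0) has_integral (\<rho> ^ DIM('a) *\<^sub>R I)) (cbox (-(\<rho> *\<^sub>R One)) (\<rho> *\<^sub>R One))"
    by (simp only:)
  then show ?thesis by (subst (asm) has_integral_restrict[OF ball_subset_cbox])
qed

text \<open>Compares the integrals of \<open>\<bar>y\<bar>\<^sup>m G\<close> and \<open>G\<close> over the shell \<open>\<rho> \<le> \<bar>y\<bar> < 1\<close>, divides by \<open>1 - \<rho>\<close> and lets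
  \<open>\<rho>\<close> tend to 1; this replaces integration in polar coordinates.\<close>
lemma integral_ball_radial:
  fixes G :: "'a::euclidean_space \<Rightarrow> complex"
  assumes c: "continuous_on (ball 0 1 - {0}) G" and b: "\<And>y. y \<in> ball 0 1 \<Longrightarrow> norm (G y) \<le> B"
    and hom: "\<And>c y. c > 0 \<Longrightarrow> G (c *\<^sub>R y) = G y"
  shows "integral (ball 0 1) (\<lambda>y. norm y ^ m *\<^sub>R G y) = (real DIM('a) / real (DIM('a) + m)) *\<^sub>R integral (ball 0 1) G"
proof -
  let ?n = "DIM('a)"
  define V where "V = measure lebesgue (ball (0::'a) 1)"
  have B0: "B \<ge> 0" using order_trans[OF norm_ge_zero b[of 0]] by simp
  have Gi: "(\<lambda>y. norm y ^ k *\<^sub>R G y) integrable_on ball 0 1" for k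
  proof (rule integrable_ball_punctured)
    show "continuous_on (ball 0 1 - {0}) (\<lambda>y. norm y ^ k *\<^sub>R G y)" by (intro continuous_intros c)
    show "norm (norm y ^ k *\<^sub>R G y) \<le> 1 * B" if "y \<in> ball 0 1" for y
      unfolding norm_scaleR
      using b[OF that] that B0 by (intro mult_mono) (auto simp: power_le_one)
  qed
  have scale: "((\<lambda>y. norm y ^ k *\<^sub>R H y) has_integral (\<rho> ^ (?n + k) *\<^sub>R I)) (ball 0 \<rho>)"
    if H: "((\<lambda>y. norm y ^ k *\<^sub>R H y) has_integral I) (ball 0 1)" and \<rho>: "\<rho> > 0"
      and homH: "\<And>c y. c > 0 \<Longrightarrow> H (c *\<^sub>R y) = H y" for k \<rho> I and H :: "'a \<Rightarrow> complex"
  proof -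
    have "((\<lambda>y. \<rho> ^ k *\<^sub>R (norm ((1 / \<rho>) *\<^sub>R y) ^ k *\<^sub>R H ((1 / \<rho>) *\<^sub>R y))) has_integral \<rho> ^ k *\<^sub>R (\<rho> ^ ?n *\<^sub>R I)) (ball 0 \<rho>)"
      by (intro has_integral_cmul has_integral_ball_scale[OF H \<rho>])
    moreover have "H ((1 / \<rho>) *\<^sub>R y) = H y" for y using homH \<rho> by simp
    moreover have "\<rho> ^ k * norm ((1 / \<rho>) *\<^sub>R y) ^ k = norm y ^ k" for y :: 'a
      using \<rho> by (simp add: power_mult_distrib[symmetric])
    ultimately show ?thesis by (simp add: power_add mult.commute)
  qed
  define K where "K k = integral (ball 0 1) (\<lambda>y. norm y ^ k *\<^sub>R G y)" for k
  have KI: "((\<lambda>y. norm y ^ k *\<^sub>R G y) has_integral K k) (ball 0 1)" for k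
    unfolding K_def using Gi by (rule integrable_integral)
  \<comment> \<open>By homogeneity the ball of radius \<rho> carries the fraction \<rho>^(n + k) of
    the integral, so 1 - \<rho>^(n + k) is left for the shell.\<close>
  have shell: "((\<lambda>y. if y \<in> ball 0 \<rho> then 0 else norm y ^ k *\<^sub>R H y) has_integral (1 - \<rho> ^ (?n + k)) *\<^sub>R I) (ball 0 1)"
    if H: "((\<lambda>y. norm y ^ k *\<^sub>R H y) has_integral I) (ball 0 1)" and \<rho>: "\<rho> > 0" "\<rho> < 1"
      and homH: "\<And>c y. c > 0 \<Longrightarrow> H (c *\<^sub>R y) = H y" for k \<rho> I and H :: "'a \<Rightarrow> complex"
  proof -
    have "((\<lambda>y. if y \<in> ball 0 \<rho> then norm y ^ k *\<^sub>R H y else 0) has_integral (\<rho> ^ (?n + k) *\<^sub>R I)) (ball 0 1)"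
      using scale[OF H \<rho>(1) homH] \<rho>(2) by (subst has_integral_restrict) auto
    from has_integral_diff[OF H this] show ?thesis
      by (rule has_integral_eq_rhs[OF has_integral_eq, rotated]) (auto simp: algebra_simps)
  qed
  \<comment> \<open>The constant 1 is also invariant under scaling; the shell formula with k = 0
    then yields the volume of the shell.\<close>
  have Vi: "((\<lambda>y::'a. norm y ^ 0 *\<^sub>R (1::complex)) has_integral of_real V) (ball 0 1)"
  proof -
    have "((\<lambda>y::'a. 1::real) has_integral V) (ball 0 1)"
      unfolding V_def lmeasure_integral[OF lmeasurable_ball]
      by (intro integrable_integral integrable_on_const lmeasurable_ball)
    from has_integral_linear[OF this bounded_linear_of_real[where 'a=complex]] show ?thesis by (simp add: o_def)
  qed
  \<comment> \<open>On the shell |y|^m differs from 1 by at most 1 - \<rho>^m. Both sides carry a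
    factor 1 - \<rho>; once it is cancelled, the powers have become geometric sums and the right
    side still tends to 0 as \<rho> tends to 1.\<close>
  have main: "norm ((\<Sum>i<?n + m. \<rho> ^ i) *\<^sub>R K m - (\<Sum>i<?n. \<rho> ^ i) *\<^sub>R K 0) \<le> (1 - \<rho> ^ m) * B * V * (\<Sum>i<?n. \<rho> ^ i)"
    if \<rho>: "\<rho> > 0" "\<rho> < 1" for \<rho> :: real
  proof -
    have i1: "((\<lambda>y. (if y \<in> ball 0 \<rho> then 0 else norm y ^ m *\<^sub>R G y) - (if y \<in> ball 0 \<rho> then 0 else norm y ^ 0 *\<^sub>R G y))
        has_integral ((1 - \<rho> ^ (?n + m)) *\<^sub>R K m - (1 - \<rho> ^ (?n + 0)) *\<^sub>R K 0)) (ball 0 1)"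
      by (intro has_integral_diff shell KI \<rho> hom)
    have "((\<lambda>y. if y \<in> ball 0 \<rho> then 0 else norm y ^ 0 *\<^sub>R (1::complex)) has_integral (1 - \<rho> ^ (?n + 0)) *\<^sub>R of_real V) (ball (0::'a) 1)"
      by (intro shell Vi \<rho>) simp
    from has_integral_Re[OF this]
    have "((\<lambda>y. if y \<in> ball 0 \<rho> then 0 else 1) has_integral (1 - \<rho> ^ ?n) * V) (ball (0::'a) 1)"
      by (simp add: if_distrib cong: if_cong)
    from has_integral_mult_right[OF this, of "(1 - \<rho> ^ m) * B"]
    have i2: "((\<lambda>y. (1 - \<rho> ^ m) * B * (if y \<in> ball 0 \<rho> then 0 else 1)) has_integral (1 - \<rho> ^ m) * B * ((1 - \<rho> ^ ?n) * V)) (ball (0::'a) 1)" .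
    have "norm ((1 - \<rho> ^ (?n + m)) *\<^sub>R K m - (1 - \<rho> ^ (?n + 0)) *\<^sub>R K 0) \<le> (1 - \<rho> ^ m) * B * ((1 - \<rho> ^ ?n) * V)"
      unfolding integral_unique[OF i1, symmetric] integral_unique[OF i2, symmetric]
    proof (rule integral_norm_bound_integral)
      fix y :: 'a assume y: "y \<in> ball 0 1"
      show "norm ((if y \<in> ball 0 \<rho> then 0 else norm y ^ m *\<^sub>R G y) - (if y \<in> ball 0 \<rho> then 0 else norm y ^ 0 *\<^sub>R G y))
        \<le> (1 - \<rho> ^ m) * B * (if y \<in> ball 0 \<rho> then 0 else 1)"
      proof (cases "y \<in> ball 0 \<rho>")
        case False
        have "\<rho> ^ m \<le> norm y ^ m" using False \<rho> by (intro power_mono) auto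
        moreover have "norm y ^ m \<le> 1" using y by (simp add: power_le_one)
        ultimately have "\<bar>norm y ^ m - 1\<bar> \<le> 1 - \<rho> ^ m" by simp
        then have "norm ((norm y ^ m - 1) *\<^sub>R G y) \<le> (1 - \<rho> ^ m) * B"
          unfolding norm_scaleR using b[OF y] by (intro mult_mono) auto
        then show ?thesis using False by (simp add: scaleR_diff_left)
      qed simp
    qed (use i1 i2 in \<open>auto simp: integrable_on_def\<close>)
    moreover have geo: "1 - \<rho> ^ k = (1 - \<rho>) * (\<Sum>i<k. \<rho> ^ i)" for k
      by (rule one_diff_power_eq)
    have "(1 - \<rho> ^ (?n + m)) *\<^sub>R K m - (1 - \<rho> ^ (?n + 0)) *\<^sub>R K 0
       = (1 - \<rho>) *\<^sub>R ((\<Sum>i<?n + m. \<rho> ^ i) *\<^sub>R K m - (\<Sum>i<?n. \<rho> ^ i) *\<^sub>R K 0)"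
      unfolding geo[of "?n + m"] geo[of "?n + 0"] by (simp add: scaleR_diff_right)
    ultimately have "(1 - \<rho>) * norm ((\<Sum>i<?n + m. \<rho> ^ i) *\<^sub>R K m - (\<Sum>i<?n. \<rho> ^ i) *\<^sub>R K 0)
       \<le> (1 - \<rho>) * ((1 - \<rho> ^ m) * B * V * (\<Sum>i<?n. \<rho> ^ i))"
      using \<rho> unfolding geo[of ?n] by (simp add: mult_ac)
    then show ?thesis using \<rho> by simp
  qed
  have "norm ((\<Sum>i<?n + m. 1 ^ i) *\<^sub>R K m - (\<Sum>i<?n. 1 ^ i) *\<^sub>R K 0) \<le> (1 - 1 ^ m) * B * V * (\<Sum>i<?n. (1::real) ^ i)"
  proof (rule tendsto_le)
    let ?F = "at_left (1::real)"
    show "((\<lambda>\<rho>. norm ((\<Sum>i<?n + m. \<rho> ^ i) *\<^sub>R K m - (\<Sum>i<?n. \<rho> ^ i) *\<^sub>R K 0)) \<longlongrightarrow> norm ((\<Sum>i<?n + m. 1 ^ i) *\<^sub>R K m - (\<Sum>i<?n. 1 ^ i) *\<^sub>R K 0)) ?F"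
      by (intro tendsto_intros)
    show "((\<lambda>\<rho>. (1 - \<rho> ^ m) * B * V * (\<Sum>i<?n. \<rho> ^ i)) \<longlongrightarrow> (1 - 1 ^ m) * B * V * (\<Sum>i<?n. (1::real) ^ i)) ?F"
      by (intro tendsto_intros)
    have "\<forall>\<^sub>F \<rho> in ?F. \<rho> > 0 \<and> \<rho> < (1::real)"
      by (intro eventually_conj eventually_at_left_real[THEN eventually_mono, of 0]) (auto simp: eventually_at_left_field intro: exI[of _ 0])
    then show "\<forall>\<^sub>F \<rho> in ?F. norm ((\<Sum>i<?n + m. \<rho> ^ i) *\<^sub>R K m - (\<Sum>i<?n. \<rho> ^ i) *\<^sub>R K 0) \<le> (1 - \<rho> ^ m) * B * V * (\<Sum>i<?n. \<rho> ^ i)"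
      by eventually_elim (use main in blast)
  qed auto
  then have "real (?n + m) *\<^sub>R K m = real ?n *\<^sub>R K 0" by simp
  moreover have "real (?n + m) \<noteq> 0" using DIM_positive[where 'a='a] by linarith
  ultimately have "K m = (real ?n / real (?n + m)) *\<^sub>R K 0"
    by (metis (no_types, lifting) divide_inverse_commute inverse_eq_divide scaleR_one scaleR_scaleR left_inverse)
  then show ?thesis unfolding K_def by simp
qed

text \<open>The ball of radius 2 and the exterior of the closed unit ball form an open cover on
  whose overlap both prescriptions are 0.\<close>

lemma continuous_on_extend_zero:
  fixes H :: "'a::real_normed_vector \<Rightarrow> 'b::real_normed_vector"
  assumes "continuous_on (ball 0 2) H" "\<And>y. norm y > 1 \<Longrightarrow> H y = 0"
  shows "continuous_on UNIV (\<lambda>y. if y \<in> ball 0 2 then H y else 0)"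
proof -
  have "continuous_on (ball 0 2 \<union> - cball 0 1) (\<lambda>y. if y \<in> ball 0 2 then H y else 0)"
  proof (rule continuous_on_open_Un)
    show "continuous_on (ball 0 2) (\<lambda>y. if y \<in> ball 0 2 then H y else 0)"
      using assms(1) by (rule continuous_on_eq) auto
    have "continuous_on (- cball 0 1) (\<lambda>y::'a. 0::'b)" by simp
    then show "continuous_on (- cball 0 1) (\<lambda>y. if y \<in> ball 0 2 then H y else 0)"
      by (rule continuous_on_eq) (use assms(2) in auto)
  qed auto
  moreover have "ball 0 2 \<union> - cball 0 1 = (UNIV :: 'a set)" by auto
  ultimately show ?thesis by simp
qed

text \<open>Squaring removes the corner of the positive part at 0. This is the source of the
  exponent 2 in the weight: the first power would have a jump in its derivative across the
  sphere.\<close>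

lemma DERIV_positive_part_square:
  "((\<lambda>x. (max 0 x)\<^sup>2) has_real_derivative 2 * max 0 x) (at x)"
proof -
  consider "x > 0" | "x < 0" | "x = 0" by linarith
  then show ?thesis
  proof cases
    case 1
    have "((\<lambda>x. x\<^sup>2) has_real_derivative 2 * max 0 x) (at x)" using 1 by (auto intro!: derivative_eq_intros)
    then show ?thesis
      by (rule DERIV_cong_ev[THEN iffD1, rotated 3, OF _ ]) (use 1 in \<open>auto simp: eventually_nhds intro!: exI[of _ "{0<..}"]\<close>)
  next
    case 2
    have "((\<lambda>x. 0) has_real_derivative 2 * max 0 x) (at x)" using 2 by simp
    then show ?thesis
      by (rule DERIV_cong_ev[THEN iffD1, rotated 3, OF _ ]) (use 2 in \<open>auto simp: eventually_nhds intro!: exI[of _ "{..<0}"]\<close>)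
  next
    case 3
    have "((\<lambda>h. (max 0 (0 + h))\<^sup>2 / h) \<longlongrightarrow> 0) (at (0::real))"
    proof (rule Lim_null_comparison)
      show "\<forall>\<^sub>F h in at (0::real). norm ((max 0 (0 + h))\<^sup>2 / h) \<le> norm h"
        by (rule always_eventually) (auto simp: max_def power2_eq_square)
      show "((\<lambda>h::real. norm h) \<longlongrightarrow> 0) (at 0)" by (rule tendsto_norm_zero) (rule tendsto_ident_at)
    qed
    then show ?thesis using 3 by (simp add: DERIV_def)
  qed
qed

text \<open>The weight \<open>(1 - \<bar>y\<bar>\<^sup>2)\<^sup>2\<close>, extended by zero, is continuously differentiable on the whole space, so that translation
  invariance of the integral may be differentiated under the integral sign.\<close>
lemma integral_ball_by_parts:
  fixes g g' :: "'a::euclidean_space \<Rightarrow> complex"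
  assumes g: "\<And>y. y \<in> ball 0 2 \<Longrightarrow> ((\<lambda>h. g (y + h *\<^sub>R e)) has_vector_derivative g' y) (at 0)"
    and cg: "continuous_on (ball 0 2) g" and cg': "continuous_on (ball 0 2) g'" and e: "norm e \<le> 1"
  shows "integral (ball 0 1) (\<lambda>y. (1 - (norm y)\<^sup>2)\<^sup>2 *\<^sub>R g' y)
       = integral (ball 0 1) (\<lambda>y. (4 * (1 - (norm y)\<^sup>2) * (y \<bullet> e)) *\<^sub>R g y)"
proof -
  define w where "w y = (max 0 (1 - (norm y)\<^sup>2))\<^sup>2" for y :: 'a
  define w' where "w' y = - 4 * max 0 (1 - (norm y)\<^sup>2) * (y \<bullet> e)" for y :: 'a
  have w0: "w y = 0" "w' y = 0" if "norm y > 1" for y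
  proof -
    have "(norm y)\<^sup>2 > 1" using that by (simp add: one_less_power)
    then show "w y = 0" "w' y = 0" by (auto simp: w_def w'_def)
  qed
  \<comment> \<open>\<open>g\<close> is controlled only on the ball of radius 2, whereas translation
    acts on the whole space; the cut is made where the weight is already 0.\<close>
  define F where "F y = (if y \<in> ball 0 2 then w y *\<^sub>R g y else 0)" for y
  define F' where "F' y = (if y \<in> ball 0 2 then w y *\<^sub>R g' y + w' y *\<^sub>R g y else 0)" for y
  have cF: "continuous_on UNIV F"
    unfolding F_def by (rule continuous_on_extend_zero) (use w0 in \<open>auto simp: w_def intro!: continuous_intros cg\<close>)
  have cF': "continuous_on UNIV F'"
    unfolding F'_def by (rule continuous_on_extend_zero) (use w0 in \<open>auto simp: w_def w'_def intro!: continuous_intros cg cg'\<close>)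
  have F0: "F y = 0" "F' y = 0" if "norm y > 1" for y using w0[OF that] by (simp_all add: F_def F'_def)
  have dw: "((\<lambda>h. w (y + h *\<^sub>R e)) has_real_derivative w' y) (at 0)" for y
  proof -
    have i: "((\<lambda>h. 1 - (norm (y + h *\<^sub>R e))\<^sup>2) has_real_derivative - 2 * (y \<bullet> e)) (at 0)"
      unfolding power2_norm_eq_inner by (auto intro!: derivative_eq_intros simp: inner_simps inner_commute algebra_simps)
    have "((\<lambda>h. (max 0 (1 - (norm (y + h *\<^sub>R e))\<^sup>2))\<^sup>2) has_real_derivative
        (2 * max 0 (1 - (norm (y + 0 *\<^sub>R e))\<^sup>2)) * (- 2 * (y \<bullet> e))) (at 0)"
      by (rule DERIV_chain2[OF DERIV_positive_part_square i])
    then show ?thesis by (simp add: w_def w'_def mult_ac)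
  qed
  have d0: "((\<lambda>h. F (y + h *\<^sub>R e)) has_vector_derivative F' y) (at 0)" for y
  proof -
    have ct: "continuous (at 0) (\<lambda>h. y + h *\<^sub>R e)" by (intro continuous_intros)
    show ?thesis
    proof (cases "y \<in> ball 0 2")
      case True
      have "((\<lambda>h. w (y + h *\<^sub>R e) *\<^sub>R g (y + h *\<^sub>R e)) has_vector_derivative
          (w (y + 0 *\<^sub>R e) *\<^sub>R g' y + w' y *\<^sub>R g (y + 0 *\<^sub>R e))) (at 0)"
        by (rule has_vector_derivative_scaleR[OF dw g[OF True]])
      then have *: "((\<lambda>h. w (y + h *\<^sub>R e) *\<^sub>R g (y + h *\<^sub>R e)) has_vector_derivative F' y) (at 0)"
        using True by (simp add: F'_def)
      have "open ((\<lambda>h. y + h *\<^sub>R e) -` ball 0 2)" by (intro open_vimage continuous_intros) simp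
      with * show ?thesis
        by (rule has_vector_derivative_transform_within_open) (use True in \<open>auto simp: F_def\<close>)
    next
      case False
      then have y: "norm y > 1" by simp
      have *: "((\<lambda>h. 0) has_vector_derivative F' y) (at 0)" using F0(2)[OF y] by simp
      have "open ((\<lambda>h. y + h *\<^sub>R e) -` (- cball 0 1))" by (intro open_vimage continuous_intros) auto
      with * show ?thesis
        by (rule has_vector_derivative_transform_within_open) (use y F0 in auto)
    qed
  qed
  have d: "((\<lambda>h. F (y + h *\<^sub>R e)) has_vector_derivative F' (y + k *\<^sub>R e)) (at k)" for y k
  proof -
    have "((\<lambda>h. h - k) has_real_derivative 1) (at k)" by (auto intro!: derivative_eq_intros)
    then have "((\<lambda>h. h - k) has_vector_derivative 1) (at k)" by (simp add: has_real_derivative_iff_has_vector_derivative)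
    from vector_diff_chain_at[OF this, of "\<lambda>h. F (y + k *\<^sub>R e + h *\<^sub>R e)" "F' (y + k *\<^sub>R e)"] d0[of "y + k *\<^sub>R e"]
    show ?thesis by (simp add: o_def algebra_simps scaleR_diff_left)
  qed
  let ?b = "cbox (-(2 *\<^sub>R One)) (2 *\<^sub>R One) :: 'a set"
  have sup: "\<And>H c. (\<And>y::'a. norm y \<ge> 2 \<Longrightarrow> H y = (0::complex)) \<Longrightarrow> integral ?b H = integral UNIV H"
  proof -
    fix H :: "'a \<Rightarrow> complex" assume H: "\<And>y::'a. norm y \<ge> 2 \<Longrightarrow> H y = 0"
    have "(\<lambda>y. if y \<in> ?b then H y else 0) = H"
    proof
      fix y show "(if y \<in> ?b then H y else 0) = H y"
        using ball_subset_cbox[of 2, where 'a='a] H[of y] by (cases "y \<in> ball 0 2") auto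
    qed
    then show "integral ?b H = integral UNIV H" using integral_restrict_UNIV[of ?b H] by simp
  qed
  \<comment> \<open>Since |e| \<le> 1, a shift with |h| < 1 keeps the support, which lies in the
    closed unit ball, within radius 2. The integral over the fixed box is therefore the full
    integral, and translation does not change it.\<close>
  have const: "integral ?b (\<lambda>y. F (y + h *\<^sub>R e)) = integral UNIV F" if "\<bar>h\<bar> < 1" for h
  proof -
    have "integral ?b (\<lambda>y. F (y + h *\<^sub>R e)) = integral UNIV (\<lambda>y. F (y + h *\<^sub>R e))"
    proof (rule sup)
      fix y :: 'a assume y: "norm y \<ge> 2"
      have "norm (h *\<^sub>R e) < 1" using that e by (simp add: mult_le_one le_less_trans[OF mult_left_le])
      then have "norm (y + h *\<^sub>R e) > 1" using y norm_diff_ineq[of y "h *\<^sub>R e"] by linarith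
      then show "F (y + h *\<^sub>R e) = 0" by (rule F0)
    qed
    also have "\<dots> = integral UNIV F"
    proof -
      have i: "integrable lborel F"
      proof -
        have "F absolutely_integrable_on ?b" by (rule absolutely_integrable_continuous) (use cF continuous_on_subset in blast)
        then have "(\<lambda>y. if y \<in> ?b then F y else 0) absolutely_integrable_on UNIV" by (simp add: absolutely_integrable_restrict_UNIV)
        moreover have "(\<lambda>y. if y \<in> ?b then F y else 0) = F"
        proof
          fix y show "(if y \<in> ?b then F y else 0) = F y"
            using ball_subset_cbox[of 2, where 'a='a] F0(1)[of y] by (cases "y \<in> ball 0 2") auto
        qed
        ultimately have "integrable lebesgue F" by (simp add: set_integrable_def)
        then show ?thesis using borel_measurable_continuous_onI[OF cF] by (simp add: integrable_completion)
      qed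
      have "integrable (distr lborel borel (\<lambda>y. h *\<^sub>R e + y)) F" using i by (simp add: lborel_distr_plus)
      then have i': "integrable lborel (\<lambda>y. F (h *\<^sub>R e + y))"
        by (subst (asm) integrable_distr_eq) (auto intro!: borel_measurable_continuous_onI cF)
      have "integral\<^sup>L (distr lborel borel (\<lambda>y. h *\<^sub>R e + y)) F = integral\<^sup>L lborel F" by (simp add: lborel_distr_plus)
      then have "integral\<^sup>L lborel (\<lambda>y. F (h *\<^sub>R e + y)) = integral\<^sup>L lborel F"
        by (subst (asm) integral_distr) (auto intro!: borel_measurable_continuous_onI cF)
      then show ?thesis
        using integral_unique[OF has_integral_integral_lborel[OF i]] integral_unique[OF has_integral_integral_lborel[OF i']]
        by (simp add: add.commute)
    qed
    finally show ?thesis .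
  qed
  \<comment> \<open>The derivative at 0 of a function of h that is constant: the integral of
    \<open>F'\<close> vanishes, and the product rule inside \<open>F'\<close> makes this the
    integration by parts.\<close>
  have "((\<lambda>h. integral ?b (\<lambda>y. F (y + h *\<^sub>R e))) has_vector_derivative integral ?b (\<lambda>y. F' (y + 0 *\<^sub>R e))) (at 0 within {-1<..<1})"
  proof (rule leibniz_rule_vector_derivative)
    show "((\<lambda>h. F (y + h *\<^sub>R e)) has_vector_derivative F' (y + h *\<^sub>R e)) (at h within {-1<..<1})" for h y
      using d has_vector_derivative_at_within by blast
    show "(\<lambda>y. F (y + h *\<^sub>R e)) integrable_on ?b" for h
      by (intro integrable_continuous continuous_on_compose2[OF cF] continuous_intros) auto
    show "continuous_on ({-1<..<1} \<times> ?b) (\<lambda>(h, y). F' (y + h *\<^sub>R e))"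
      unfolding split_beta by (intro continuous_on_compose2[OF cF'] continuous_intros) auto
  qed auto
  then have "((\<lambda>h. integral ?b (\<lambda>y. F (y + h *\<^sub>R e))) has_vector_derivative integral ?b F') (at 0)"
    by (subst (asm) at_within_open) auto
  moreover have "((\<lambda>h. integral ?b (\<lambda>y. F (y + h *\<^sub>R e))) has_vector_derivative 0) (at 0)"
    using has_vector_derivative_const[of "integral UNIV F" "at 0"]
    by (rule has_vector_derivative_transform_within_open[of _ _ _ "{-1<..<1}"]) (use const in \<open>auto simp: abs_if\<close>)
  ultimately have "integral ?b F' = 0" by (rule vector_derivative_unique_at)
  moreover have "integral ?b F' = integral (ball 0 1) F'"
  proof -
    have "(\<lambda>y. if y \<in> ball 0 1 then F' y else 0) = F'"
    proof
      fix y :: 'a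
      show "(if y \<in> ball 0 1 then F' y else 0) = F' y"
        using F0(2)[of y] by (cases "norm y = 1") (auto simp: F'_def w_def w'_def)
    qed
    then have "integral UNIV F' = integral (ball 0 1) F'" using integral_restrict_UNIV[of "ball 0 1" F'] by simp
    moreover have "integral ?b F' = integral UNIV F'" by (rule sup) (use F0 in auto)
    ultimately show ?thesis by simp
  qed
  moreover have "integral (ball 0 1) F' = integral (ball 0 1) (\<lambda>y. (1 - (norm y)\<^sup>2)\<^sup>2 *\<^sub>R g' y - (4 * (1 - (norm y)\<^sup>2) * (y \<bullet> e)) *\<^sub>R g y)"
  proof (rule integral_cong)
    fix y :: 'a assume "y \<in> ball 0 1"
    then have "norm y < 1" by simp
    then have "(norm y)\<^sup>2 \<le> 1" by (simp add: power_le_one)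
    then show "F' y = (1 - (norm y)\<^sup>2)\<^sup>2 *\<^sub>R g' y - (4 * (1 - (norm y)\<^sup>2) * (y \<bullet> e)) *\<^sub>R g y"
      using \<open>norm y < 1\<close> by (simp add: F'_def w_def w'_def max_def scaleR_minus_left[symmetric] left_diff_distrib
          del: scaleR_minus_left)
  qed
  moreover have "integral (ball 0 1) (\<lambda>y. (1 - (norm y)\<^sup>2)\<^sup>2 *\<^sub>R g' y - (4 * (1 - (norm y)\<^sup>2) * (y \<bullet> e)) *\<^sub>R g y)
     = integral (ball 0 1) (\<lambda>y. (1 - (norm y)\<^sup>2)\<^sup>2 *\<^sub>R g' y) - integral (ball 0 1) (\<lambda>y. (4 * (1 - (norm y)\<^sup>2) * (y \<bullet> e)) *\<^sub>R g y)"
  proof (rule Henstock_Kurzweil_Integration.integral_diff)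
    have "continuous_on (cball 0 1) g" "continuous_on (cball 0 1) g'"
      using cg cg' by (auto elim!: continuous_on_subset)
    then show "(\<lambda>y. (1 - (norm y)\<^sup>2)\<^sup>2 *\<^sub>R g' y) integrable_on ball 0 1"
      "(\<lambda>y. (4 * (1 - (norm y)\<^sup>2) * (y \<bullet> e)) *\<^sub>R g y) integrable_on ball 0 1"
      by (auto intro!: integrable_ball_continuous continuous_intros)
  qed
  ultimately show ?thesis by simp
qed

section \<open>Pizzetti's formula\<close>

lemma norm_vec_smult: "norm (c *s (v::complex^'n)) = norm c * norm v"
  by (simp add: norm_vec_def L2_set_def norm_mult power_mult_distrib sum_distrib_left[symmetric] real_sqrt_mult)

interpretation cn: cspace "\<lambda>c (v::complex^'n). c *s v"
proof
  show "of_real x *s v = x *\<^sub>R v" for x and v :: "complex^'n"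
    by (simp add: vec_eq_iff scaleR_conv_of_real[where 'a=complex])
qed (simp_all add: vector_add_ldistrib vector_sadd_rdistrib vector_smult_assoc norm_vec_smult)

lemma holo_n_iff_hol: "holo_n S f \<longleftrightarrow> cn.hol S f"
  by (simp add: holo_n_def cn.hol_def)

definition smult_pair :: "complex \<Rightarrow> (complex^'n) \<times> complex \<Rightarrow> (complex^'n) \<times> complex" where
  "smult_pair c p = (c *s fst p, c * snd p)"

interpretation cnt: cspace "smult_pair :: complex \<Rightarrow> (complex^'n) \<times> complex \<Rightarrow> _"
proof
  show "smult_pair (of_real x) p = x *\<^sub>R p" for x and p :: "(complex^'n) \<times> complex"
    by (simp add: smult_pair_def prod_eq_iff vec_eq_iff scaleR_conv_of_real[where 'a=complex])
  show "norm (smult_pair c p) = norm c * norm p" for c and p :: "(complex^'n) \<times> complex"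
    by (simp add: smult_pair_def norm_prod_def norm_vec_smult norm_mult power_mult_distrib distrib_left[symmetric] real_sqrt_mult)
qed (simp_all add: smult_pair_def vector_add_ldistrib vector_sadd_rdistrib vector_smult_assoc distrib_left distrib_right)

lemma holo_nt_iff_hol: "holo_nt S f \<longleftrightarrow> cnt.hol S f"
  by (simp add: holo_nt_def cnt.hol_def smult_pair_def split_paired_all)

lemma cpartial_eq_Dd:
  assumes "cn.hol S f" "z \<in> S"
  shows "cpartial i f z = cn.Dd f z (axis i 1)"
proof -
  have e: "(\<chi> k. if k = i then w else z $ k) = z + (w - z $ i) *s axis i 1" for w
    by (simp add: vec_eq_iff axis_def)
  have "((\<lambda>c. f (z + c *s axis i 1)) has_field_derivative cn.Dd f z (axis i 1)) (at (z $ i - z $ i))"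
    using cn.hol_line[OF assms(1), of z 0 "axis i 1"] assms(2) by simp
  moreover have "((\<lambda>w. w - z $ i) has_field_derivative 1) (at (z $ i))" by (auto intro!: derivative_eq_intros)
  ultimately have "((\<lambda>w. f (z + (w - z $ i) *s axis i 1)) has_field_derivative cn.Dd f z (axis i 1) * 1) (at (z $ i))"
    by (rule DERIV_chain2)
  then show ?thesis unfolding cpartial_def e by (simp add: DERIV_imp_deriv)
qed

lemma hol_cpartial:
  assumes "open S" "cn.hol S f"
  shows "cn.hol S (cpartial i f)"
  using cn.hol_Dd[OF assms, of "axis i 1"] cpartial_eq_Dd[OF assms(2)]
  by (rule cn.hol_cong[OF assms(1)])

lemma Dd_eq_sum_cpartial:
  assumes "cn.hol S f" "z \<in> S"
  shows "cn.Dd f z v = (\<Sum>j\<in>UNIV. v $ j * cpartial j f z)"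
proof -
  interpret bounded_linear "cn.Dd f z" by (rule cn.linear_Dd[OF assms])
  have "cn.Dd f z v = cn.Dd f z (\<Sum>j\<in>UNIV. v $ j *s axis j 1)" by (simp add: basis_expansion)
  also have "\<dots> = (\<Sum>j\<in>UNIV. v $ j * cpartial j f z)"
    unfolding sum cn.hol_has_derivative(2)[OF assms] cpartial_eq_Dd[OF assms] ..
  finally show ?thesis .
qed

lemma hol_Pop:
  assumes "open S" "cn.hol S f"
  shows "cn.hol S (Pop A f)"
  unfolding Pop_def by (intro cn.hol_sum cn.hol_cmult hol_cpartial assms)

lemma hol_Pop_power:
  assumes "open S" "cn.hol S f"
  shows "cn.hol S ((Pop A ^^ j) f)"
  by (induction j) (simp_all add: assms hol_Pop)

section \<open>Real directions in complex space and derivatives along them\<close>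

definition cvec :: "real^'n^'m \<Rightarrow> real^'n \<Rightarrow> complex^'m" where
  "cvec Q y = (\<chi> j. complex_of_real ((Q *v y) $ j))"

lemma shift_pt_eq: "shift_pt Q z t y = z + t *s cvec Q y"
  by (simp add: shift_pt_def cvec_def vec_eq_iff)

lemma cvec_add: "cvec Q (x + y) = cvec Q x + cvec Q y"
  by (simp add: cvec_def vec_eq_iff matrix_vector_right_distrib)

lemma cvec_scaleR: "cvec Q (c *\<^sub>R y) = of_real c *s cvec Q y"
  by (simp add: cvec_def vec_eq_iff matrix_vector_mult_scaleR)

lemma cvec_axis: "cvec Q (axis i 1) $ j = of_real (Q $ j $ i)"
  by (simp add: cvec_def matrix_vector_mult_basis column_def)

lemma cvec_component: "cvec Q y $ j = (\<Sum>i\<in>UNIV. of_real (Q $ j $ i) * of_real (y $ i))"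
  by (simp add: cvec_def matrix_vector_mult_def)

lemma norm_cvec: "norm (cvec Q y) = norm (Q *v y)"
  by (simp add: norm_vec_def L2_set_def cvec_def)

lemma norm_cvec_le: "norm (cvec Q y) \<le> onorm ((*v) Q) * norm y"
  unfolding norm_cvec by (rule onorm) (rule matrix_vector_mul_bounded_linear)

lemma continuous_on_cvec [continuous_intros]:
  "continuous_on S f \<Longrightarrow> continuous_on S (\<lambda>x. cvec Q (f x))"
  unfolding cvec_def
  by (intro continuous_intros continuous_on_compose2[OF linear_continuous_on[OF matrix_vector_mul_bounded_linear, of UNIV]]) auto

lemmas continuous_on_smult [continuous_intros] = cn.continuous_on_sc

lemma hol_shift_vector_derivative:
  assumes "cn.hol S f" "z + t *s cvec Q y \<in> S"
  shows "((\<lambda>h. f (z + t *s cvec Q (y + h *\<^sub>R e))) has_vector_derivative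
     t * (\<Sum>j\<in>UNIV. cvec Q e $ j * cpartial j f (z + t *s cvec Q y))) (at 0)"
proof -
  let ?p = "z + t *s cvec Q y"
  have d: "((\<lambda>h. of_real h * t) has_vector_derivative t) (at 0)"
    by (auto intro!: derivative_eq_intros)
  have "((\<lambda>c. f (?p + c *s cvec Q e)) has_field_derivative cn.Dd f ?p (cvec Q e)) (at (of_real 0 * t))"
    using cn.hol_line[OF assms(1), of ?p 0 "cvec Q e"] assms(2) by simp
  from field_vector_diff_chain_at[OF d this] show ?thesis
    by (simp add: o_def cvec_add cvec_scaleR vector_add_ldistrib vector_smult_assoc mult.commute add.assoc
        Dd_eq_sum_cpartial[OF assms])
qed

lemma continuous_on_hol_shift:
  assumes "cn.hol S f" "\<And>y. y \<in> U \<Longrightarrow> z + t *s cvec Q y \<in> S"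
  shows "continuous_on U (\<lambda>y. f (z + t *s cvec Q y))"
  by (rule continuous_on_compose2[OF cn.hol_continuous_on[OF assms(1)]])
    (use assms(2) in \<open>auto intro!: continuous_intros\<close>)

text \<open>Integration by parts in each coordinate direction, applied to the partial derivatives in
  y of f(z + t Q y) and summed over the coordinates. On the left the Laplacian appears, which Q Q^T
  = A turns into t^2 times the operator; on the right the gradient is paired with y, which gives the
  radial derivative.\<close>

lemma Pizzetti_Green:
  fixes Q A :: "real^'n^'n"
  assumes S: "open S" "cn.hol S f" and Q: "Q ** transpose Q = A"
    and dom: "\<And>y. norm y < 2 \<Longrightarrow> z + t *s cvec Q y \<in> S"
  shows "integral (ball 0 1) (\<lambda>y. (1 - (norm y)\<^sup>2)\<^sup>2 *\<^sub>R (t\<^sup>2 * Pop A f (z + t *s cvec Q y)))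
    = integral (ball 0 1) (\<lambda>y. (4 * (1 - (norm y)\<^sup>2)) *\<^sub>R (t * cn.Dd f (z + t *s cvec Q y) (cvec Q y)))"
proof -
  let ?p = "\<lambda>y. z + t *s cvec Q y"
  \<comment> \<open>\<open>g i\<close> and \<open>g' i\<close> are the first and second derivatives
    of f(z + t Q y) in the i-th coordinate of y.\<close>
  define g where "g i y = t * (\<Sum>j\<in>UNIV. cvec Q (axis i 1) $ j * cpartial j f (?p y))" for i y
  define g' where "g' i y = t * (\<Sum>j\<in>UNIV. cvec Q (axis i 1) $ j *
     (t * (\<Sum>k\<in>UNIV. cvec Q (axis i 1) $ k * cpartial k (cpartial j f) (?p y))))" for i y
  note hp = hol_cpartial[OF S] hol_cpartial[OF S(1) hol_cpartial[OF S]]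
  have dom': "?p y \<in> S" if "y \<in> ball 0 2" for y using dom that by simp
  have d: "((\<lambda>h. g i (y + h *\<^sub>R axis i 1)) has_vector_derivative g' i y) (at 0)" if "y \<in> ball 0 2" for i y
    unfolding g_def g'_def
    by (intro has_vector_derivative_mult_right has_vector_derivative_sum hol_shift_vector_derivative[OF hp(1)] dom' that)
  have cg: "continuous_on (ball 0 2) (g i)" for i
    unfolding g_def by (intro continuous_intros continuous_on_hol_shift[OF hp(1)] dom')
  have cg': "continuous_on (ball 0 2) (g' i)" for i
    unfolding g'_def by (intro continuous_intros continuous_on_hol_shift[OF hp(2)] dom')
  have int: "(\<lambda>y. (1 - (norm y)\<^sup>2)\<^sup>2 *\<^sub>R g' i y) integrable_on ball 0 1"
    "(\<lambda>y. (4 * (1 - (norm y)\<^sup>2) * (y \<bullet> axis i 1)) *\<^sub>R g i y) integrable_on ball 0 1" for i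
    by (intro integrable_ball_continuous continuous_intros continuous_on_subset[OF cg] continuous_on_subset[OF cg']; auto)+
  have "(\<Sum>i\<in>UNIV. integral (ball 0 1) (\<lambda>y. (1 - (norm y)\<^sup>2)\<^sup>2 *\<^sub>R g' i y))
    = (\<Sum>i\<in>UNIV. integral (ball 0 1) (\<lambda>y. (4 * (1 - (norm y)\<^sup>2) * (y \<bullet> axis i 1)) *\<^sub>R g i y))"
    by (intro sum.cong refl integral_ball_by_parts d cg cg') simp_all
  then have 1: "integral (ball 0 1) (\<lambda>y. \<Sum>i\<in>UNIV. (1 - (norm y)\<^sup>2)\<^sup>2 *\<^sub>R g' i y)
    = integral (ball 0 1) (\<lambda>y. \<Sum>i\<in>UNIV. (4 * (1 - (norm y)\<^sup>2) * (y \<bullet> axis i 1)) *\<^sub>R g i y)"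
    by (subst (1 2) Henstock_Kurzweil_Integration.integral_sum) (use int in auto)
  have 2: "(\<Sum>i\<in>UNIV. (1 - (norm y)\<^sup>2)\<^sup>2 *\<^sub>R g' i y) = (1 - (norm y)\<^sup>2)\<^sup>2 *\<^sub>R (t\<^sup>2 * Pop A f (?p y))" for y
  proof -
    have A: "(\<Sum>i\<in>UNIV. complex_of_real (Q $ j $ i) * of_real (Q $ k $ i)) = of_real (A $ k $ j)" for j k
      unfolding Q[symmetric] by (simp add: matrix_matrix_mult_def transpose_def mult.commute)
    have "(\<Sum>i\<in>UNIV. g' i y) = t\<^sup>2 * (\<Sum>i\<in>UNIV. \<Sum>j\<in>UNIV. \<Sum>k\<in>UNIV.
        (of_real (Q $ j $ i) * of_real (Q $ k $ i)) * cpartial k (cpartial j f) (?p y))"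
      unfolding g'_def by (simp add: cvec_axis sum_distrib_left power2_eq_square mult_ac)
    also have "(\<Sum>i\<in>UNIV. \<Sum>j\<in>UNIV. \<Sum>k\<in>UNIV. (of_real (Q $ j $ i) * of_real (Q $ k $ i)) * cpartial k (cpartial j f) (?p y))
       = (\<Sum>j\<in>UNIV. \<Sum>i\<in>UNIV. \<Sum>k\<in>UNIV. (of_real (Q $ j $ i) * of_real (Q $ k $ i)) * cpartial k (cpartial j f) (?p y))"
      by (rule sum.swap)
    also have "\<dots> = (\<Sum>j\<in>UNIV. \<Sum>k\<in>UNIV. \<Sum>i\<in>UNIV. (of_real (Q $ j $ i) * of_real (Q $ k $ i)) * cpartial k (cpartial j f) (?p y))"
      by (intro sum.cong refl sum.swap)
    also have "\<dots> = (\<Sum>j\<in>UNIV. \<Sum>k\<in>UNIV. of_real (A $ k $ j) * cpartial k (cpartial j f) (?p y))"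
      by (simp only: sum_distrib_right[symmetric] A)
    also have "\<dots> = Pop A f (?p y)" unfolding Pop_def by (rule sum.swap)
    finally show ?thesis by (simp add: scaleR_sum_right[symmetric])
  qed
  have 3: "integral (ball 0 1) (\<lambda>y. \<Sum>i\<in>UNIV. (4 * (1 - (norm y)\<^sup>2) * (y \<bullet> axis i 1)) *\<^sub>R g i y)
     = integral (ball 0 1) (\<lambda>y. (4 * (1 - (norm y)\<^sup>2)) *\<^sub>R (t * cn.Dd f (?p y) (cvec Q y)))"
  proof (rule integral_cong)
    fix y :: "real^'n" assume y: "y \<in> ball 0 1"
    have "?p y \<in> S" using y by (intro dom) simp
    then have "cn.Dd f (?p y) (cvec Q y) = (\<Sum>j\<in>UNIV. \<Sum>i\<in>UNIV. of_real (Q $ j $ i) * of_real (y $ i) * cpartial j f (?p y))"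
      by (simp add: Dd_eq_sum_cpartial[OF S(2)] cvec_component sum_distrib_right)
    also have "\<dots> = (\<Sum>i\<in>UNIV. \<Sum>j\<in>UNIV. of_real (Q $ j $ i) * of_real (y $ i) * cpartial j f (?p y))"
      by (rule sum.swap)
    finally have "t * cn.Dd f (?p y) (cvec Q y) = (\<Sum>i\<in>UNIV. (y $ i) *\<^sub>R g i y)"
      by (simp add: g_def cvec_axis sum_distrib_left scaleR_conv_of_real mult_ac)
    then show "(\<Sum>i\<in>UNIV. (4 * (1 - (norm y)\<^sup>2) * (y \<bullet> axis i 1)) *\<^sub>R g i y)
      = (4 * (1 - (norm y)\<^sup>2)) *\<^sub>R (t * cn.Dd f (?p y) (cvec Q y))" by (simp add: scaleR_sum_right inner_axis)
  qed
  show ?thesis using 1 unfolding 2 3 .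
qed

section \<open>Termwise integration and power series\<close>

lemma integral_sums_dominated:
  fixes c :: "nat \<Rightarrow> 'a::euclidean_space \<Rightarrow> complex"
  assumes ci: "\<And>m. c m integrable_on S" and Ci: "(\<lambda>_. suminf C) integrable_on S"
    and C: "\<And>m y. y \<in> S \<Longrightarrow> norm (c m y) \<le> C m" "summable C" "\<And>m. C m \<ge> 0"
    and s: "\<And>y. y \<in> S \<Longrightarrow> (\<lambda>m. c m y) sums f y"
  shows "(\<lambda>m. integral S (c m)) sums integral S f"
proof -
  have "(\<lambda>k. integral S (\<lambda>y. \<Sum>m<k. c m y)) \<longlonglongrightarrow> integral S f"
  proof (rule dominated_convergence(2)[where h = "\<lambda>_. suminf C"])
    show "(\<lambda>y. \<Sum>m<k. c m y) integrable_on S" for k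
      by (intro integrable_sum ci) auto
    show "norm (\<Sum>m<k. c m y) \<le> suminf C" if "y \<in> S" for k y
    proof -
      have "norm (\<Sum>m<k. c m y) \<le> (\<Sum>m<k. C m)" by (intro sum_norm_le C that)
      also have "\<dots> \<le> suminf C" using C by (intro sum_le_suminf) auto
      finally show ?thesis .
    qed
    show "(\<lambda>k. \<Sum>m<k. c m y) \<longlonglongrightarrow> f y" if "y \<in> S" for y
      using s[OF that] by (simp add: sums_def)
  qed (rule Ci)
  moreover have "integral S (\<lambda>y. \<Sum>m<k. c m y) = (\<Sum>m<k. integral S (c m))" for k
    by (rule Henstock_Kurzweil_Integration.integral_sum) (use ci in auto)
  ultimately show ?thesis by (simp add: sums_def)
qed

lemma integral_ball_sums:
  fixes c :: "nat \<Rightarrow> 'a::euclidean_space \<Rightarrow> complex"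
  assumes c: "\<And>m. continuous_on (ball 0 1 - {0}) (c m)"
    and C: "\<And>m y. y \<in> ball 0 1 \<Longrightarrow> norm (c m y) \<le> C m" "summable C"
    and s: "\<And>y. y \<in> ball 0 1 \<Longrightarrow> (\<lambda>m. c m y) sums f y"
  shows "(\<lambda>m. integral (ball 0 1) (c m)) sums integral (ball 0 1) f"
proof (rule integral_sums_dominated[OF _ _ C _ s])
  show "c m integrable_on ball 0 1" for m
    by (rule integrable_ball_punctured[OF c C(1)])
  show "C m \<ge> 0" for m using order_trans[OF norm_ge_zero C(1)[of 0]] by simp
qed (auto intro: integrable_on_const lmeasurable_ball)

lemma powser_unique:
  fixes a b :: "nat \<Rightarrow> complex"
  assumes \<tau>: "\<tau> > 0" and a: "\<And>t. norm t < \<tau> \<Longrightarrow> (\<lambda>n. a n * t ^ n) sums f t"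
    and b: "\<And>t. norm t < \<tau> \<Longrightarrow> (\<lambda>n. b n * t ^ n) sums f t"
  shows "a n = b n"
proof (rule ccontr)
  assume n: "a n \<noteq> b n"
  have s: "(\<lambda>n. (a n - b n) * (t - 0) ^ n) sums 0" if "norm (t - 0) < \<tau>" for t
    using sums_diff[OF a[of t] b[of t]] that by (simp add: algebra_simps)
  have "a 0 = b 0" using s[of 0] \<tau> by simp
  with n have "n > 0" by (cases n) auto
  then obtain \<sigma> where "\<sigma> > 0" "\<And>z::complex. z \<in> cball 0 \<sigma> - {0} \<Longrightarrow> (0::complex) \<noteq> 0"
    using powser_0_nonzero[OF \<tau> s, of n] n by auto
  moreover have "of_real \<sigma> \<in> cball (0::complex) \<sigma> - {0}" using \<open>\<sigma> > 0\<close> by simp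
  ultimately show False by blast
qed


text \<open>The operator s d/ds multiplies the n-th coefficient by n. It gives the Euler operator
  along rays in the recursion for the means, and later the factor that lowers the parameter of
  \<open>pseries\<close>.\<close>

lemma powser_times_deriv_sums:
  fixes c :: "nat \<Rightarrow> complex"
  assumes c: "\<And>t. norm t < R \<Longrightarrow> (\<lambda>n. c n * t ^ n) sums g t" and s: "norm s < R"
    and D: "(g has_field_derivative D) (at s)"
  shows "(\<lambda>n. of_nat n * c n * s ^ n) sums (s * D)"
proof -
  have sm: "summable (\<lambda>n. c n * t ^ n)" if "norm t < R" for t using c[OF that] by (rule sums_summable)
  have "((\<lambda>t. \<Sum>n. c n * t ^ n) has_field_derivative (\<Sum>n. diffs c n * s ^ n)) (at s)"
    by (rule termdiffs_strong'[OF sm s])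
  then have "(g has_field_derivative (\<Sum>n. diffs c n * s ^ n)) (at s)"
    by (rule has_field_derivative_transform_within_open[where S = "ball 0 R"])
      (use s c in \<open>auto simp: sums_iff\<close>)
  then have "D = (\<Sum>n. diffs c n * s ^ n)" using D by (rule DERIV_unique[rotated])
  then have "(\<lambda>n. diffs c n * s ^ n) sums D"
    using termdiff_converges[OF s sm] by (simp add: summable_sums)
  then have "(\<lambda>n. s * (diffs c n * s ^ n)) sums (s * D)" by (rule sums_mult)
  then have "(\<lambda>n. of_nat (Suc n) * c (Suc n) * s ^ Suc n) sums (s * D)"
    by (simp add: diffs_def mult_ac)
  then show ?thesis by (subst (asm) sums_Suc_iff) simp
qed

lemma alpha_n_pos: "alpha_n n > 0"
  by (simp add: alpha_n_def add_pos_nonneg)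

lemma has_integral_one_ball: "((\<lambda>y::real^'n. 1::real) has_integral alpha_n CARD('n)) (ball 0 1)"
proof -
  have "alpha_n CARD('n) = integral (ball (0::real^'n) 1) (\<lambda>y. 1)"
    unfolding lmeasure_integral[OF lmeasurable_ball, symmetric]
    by (simp add: alpha_n_def content_ball unit_ball_vol_def add.commute)
  then show ?thesis by (simp add: integrable_integral integrable_on_const)
qed

text \<open>The part of f(z + Q y) that is homogeneous of degree m in y, read off as a Taylor
  coefficient in t.\<close>

definition hcoef :: "real^'n^'n \<Rightarrow> (complex^'n \<Rightarrow> complex) \<Rightarrow> complex^'n \<Rightarrow> nat \<Rightarrow> real^'n \<Rightarrow> complex" where
  "hcoef Q f z m y = (deriv ^^ m) (\<lambda>t. f (z + t *s cvec Q y)) 0 / fact m"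

text \<open>The integrand depends only on the direction of y, so this is the surface integral of
  \<open>hcoef\<close> divided by n, not normalised by the volume.\<close>

definition smean :: "real^'n^'n \<Rightarrow> (complex^'n \<Rightarrow> complex) \<Rightarrow> complex^'n \<Rightarrow> nat \<Rightarrow> complex" where
  "smean Q f z m = integral (ball 0 1) (\<lambda>y. hcoef Q f z m (scaleR (1 / norm y) y))"

text \<open>The bound 2 on |y| gives the integration by parts its room beyond the unit ball; \<rho>
  is the radius of all Cauchy estimates in t.\<close>

locale shift_disc =
  fixes Q :: "real^'n^'n" and S :: "(complex^'n) set" and z :: "complex^'n" and \<rho> :: real
  assumes open_S: "open S" and rho_pos: "\<rho> > 0"
    and dom: "\<And>t y. norm t \<le> \<rho> \<Longrightarrow> norm y < 2 \<Longrightarrow> z + t *s cvec Q y \<in> S"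
begin

lemma shift_holomorphic:
  assumes "cn.hol S f" "norm y < 2"
  shows "(\<lambda>t. f (z + t *s cvec Q y)) holomorphic_on cball 0 \<rho>"
  by (rule cn.hol_line_holomorphic[OF assms(1)]) (use dom assms in auto)

lemma shift_holomorphic_ball:
  assumes "cn.hol S f" "norm y < 2"
  shows "(\<lambda>t. f (z + t *s cvec Q y)) holomorphic_on ball 0 \<rho>"
  using shift_holomorphic[OF assms] holomorphic_on_subset ball_subset_cball by blast

lemma hcoef_sums:
  assumes "cn.hol S f" "norm y < 2" "norm t < \<rho>"
  shows "(\<lambda>m. hcoef Q f z m y * t ^ m) sums f (z + t *s cvec Q y)"
  using holomorphic_power_series[OF shift_holomorphic_ball[OF assms(1,2)], of t] assms(3)
  by (simp add: hcoef_def)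

lemma hcoef_deriv_sums:
  assumes f: "cn.hol S f" and y: "norm y < 2" and t: "norm t < \<rho>"
  shows "(\<lambda>m. of_nat m * hcoef Q f z m y * t ^ m) sums (t * cn.Dd f (z + t *s cvec Q y) (cvec Q y))"
proof -
  have "z + t *s cvec Q y \<in> S" using dom t y by simp
  from powser_times_deriv_sums[OF hcoef_sums[OF f y] t cn.hol_line[OF f this]] show ?thesis .
qed

lemma shift_bounded:
  assumes f: "cn.hol S f"
  obtains M where "\<And>t y. norm t \<le> \<rho> \<Longrightarrow> norm y \<le> 1 \<Longrightarrow> norm (f (z + t *s cvec Q y)) \<le> M"
proof -
  let ?F = "\<lambda>p. f (z + fst p *s cvec Q (snd p))"
  have "continuous_on (cball 0 \<rho> \<times> cball 0 1) ?F"
    by (rule continuous_on_compose2[OF cn.hol_continuous_on[OF f]]) (auto intro!: continuous_intros dom)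
  then obtain M where "\<And>p. p \<in> cball 0 \<rho> \<times> cball 0 1 \<Longrightarrow> norm (?F p) \<le> M"
    by (rule compact_norm_bound[OF compact_Times[OF compact_cball compact_cball]]) blast
  then show ?thesis using that[of M] by force
qed

lemma norm_hcoef_le:
  assumes f: "cn.hol S f" and M: "\<And>t y. norm t \<le> \<rho> \<Longrightarrow> norm y \<le> 1 \<Longrightarrow> norm (f (z + t *s cvec Q y)) \<le> M"
    and y: "norm y \<le> 1"
  shows "norm (hcoef Q f z m y) \<le> M / \<rho> ^ m"
proof -
  have "norm ((deriv ^^ m) (\<lambda>t. f (z + t *s cvec Q y)) 0) \<le> fact m * M / \<rho> ^ m"
  proof (rule Cauchy_inequality)
    show "continuous_on (cball 0 \<rho>) (\<lambda>t. f (z + t *s cvec Q y))"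
      by (rule holomorphic_on_imp_continuous_on, rule shift_holomorphic[OF f]) (use y in simp)
    show "(\<lambda>t. f (z + t *s cvec Q y)) holomorphic_on ball 0 \<rho>"
      by (rule shift_holomorphic_ball[OF f]) (use y in simp)
    show "norm (f (z + t *s cvec Q y)) \<le> M" if "norm (0 - t) = \<rho>" for t
      using M[OF _ y, of t] that by simp
  qed (rule rho_pos)
  then show ?thesis by (simp add: hcoef_def norm_divide field_simps)
qed

text \<open>Scaling y by c is scaling t by c in the one-variable function. With c in [0, 1] the
  scaled disc stays inside the disc of radius \<rho>.\<close>

lemma hcoef_scaleR:
  assumes f: "cn.hol S f" and y: "norm y < 2" and c: "0 \<le> c" "c \<le> 1"
  shows "hcoef Q f z m (c *\<^sub>R y) = c ^ m *\<^sub>R hcoef Q f z m y"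
proof -
  have "(deriv ^^ m) (\<lambda>w. f (z + (of_real c * w) *s cvec Q y)) 0
     = of_real c ^ m * (deriv ^^ m) (\<lambda>t. f (z + t *s cvec Q y)) (of_real c * 0)"
  proof (rule higher_deriv_compose_linear[OF shift_holomorphic_ball[OF f y]])
    show "of_real c * w \<in> ball 0 \<rho>" if "w \<in> ball 0 \<rho>" for w :: complex
      using that c mult_left_le_one_le[of "norm w" c] by (simp add: norm_mult)
  qed (use rho_pos in auto)
  then show ?thesis
    by (simp add: hcoef_def cvec_scaleR vector_smult_assoc mult.commute[of _ "of_real c"] scaleR_conv_of_real[where 'a=complex])
qed

text \<open>Cauchy's formula on the circle of radius \<rho> writes the coefficient as a parameter
  integral whose integrand \<open>F\<close> is jointly continuous in y and the circle
  parameter.\<close>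

lemma continuous_on_hcoef:
  assumes f: "cn.hol S f"
  shows "continuous_on (ball 0 2) (hcoef Q f z m)"
proof -
  define F where "F y x = f (z + circlepath 0 \<rho> x *s cvec Q y) / circlepath 0 \<rho> x ^ Suc m
     * (2 * of_real pi * \<i> * of_real \<rho> * exp (2 * of_real pi * \<i> * of_real x))" for y x
  have nz: "circlepath 0 \<rho> x \<noteq> 0" "norm (circlepath 0 \<rho> x) = \<rho>" for x
    using rho_pos by (simp_all add: circlepath norm_mult)
  have "continuous_on (ball 0 2 \<times> cbox 0 1) (\<lambda>(y, x). F y x)"
    unfolding F_def split_beta
  proof (intro continuous_intros)
    have cc: "continuous_on (ball 0 2 \<times> cbox 0 1) (\<lambda>p::(real^'n) \<times> real. circlepath 0 \<rho> (snd p))"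
      unfolding circlepath by (intro continuous_intros)
    then show "continuous_on (ball 0 2 \<times> cbox 0 1) (\<lambda>p::(real^'n) \<times> real. circlepath 0 \<rho> (snd p))" .
    show "continuous_on (ball 0 2 \<times> cbox 0 1) (\<lambda>p. f (z + circlepath 0 \<rho> (snd p) *s cvec Q (fst p)))"
      by (rule continuous_on_compose2[OF cn.hol_continuous_on[OF f]])
        (use cc nz dom in \<open>auto intro!: continuous_intros\<close>)
  qed (use nz in auto)
  then have c: "continuous_on (ball 0 2) (\<lambda>y. 1 / (2 * pi * \<i>) * integral (cbox 0 1) (F y))"
    by (intro continuous_intros integral_continuous_on_param)
  show ?thesis
  proof (rule continuous_on_eq[OF c])
    fix y :: "real^'n" assume "y \<in> ball 0 2"
    then have y: "norm y < 2" by simp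
    let ?g = "\<lambda>t. f (z + t *s cvec Q y)"
    have "((\<lambda>u. ?g u / (u - 0) ^ Suc m) has_contour_integral ((2 * pi * \<i>) / fact m * (deriv ^^ m) ?g 0)) (circlepath 0 \<rho>)"
      by (intro Cauchy_has_contour_integral_higher_derivative_circlepath holomorphic_on_imp_continuous_on
          shift_holomorphic shift_holomorphic_ball f y) (use rho_pos in auto)
    then have "contour_integral (circlepath 0 \<rho>) (\<lambda>u. ?g u / (u - 0) ^ Suc m) = 2 * pi * \<i> * hcoef Q f z m y"
      by (simp add: contour_integral_unique hcoef_def)
    moreover have "contour_integral (circlepath 0 \<rho>) (\<lambda>u. ?g u / (u - 0) ^ Suc m) = integral (cbox 0 1) (F y)"
      unfolding contour_integral_integral F_def by (simp add: vector_derivative_circlepath)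
    ultimately have "integral (cbox 0 1) (F y) = 2 * pi * \<i> * hcoef Q f z m y" by (simp only:)
    then show "1 / (2 * pi * \<i>) * integral (cbox 0 1) (F y) = hcoef Q f z m y" by simp
  qed
qed

lemma hcoef_sphere:
  assumes f: "cn.hol S f"
  shows "continuous_on (ball 0 1 - {0}) (\<lambda>y. hcoef Q f z m (scaleR (1 / norm y) y))"
    and "\<exists>B. \<forall>y. norm (hcoef Q f z m (scaleR (1 / norm y) y)) \<le> B"
    and "c > 0 \<Longrightarrow> hcoef Q f z m (scaleR (1 / norm (c *\<^sub>R y)) (c *\<^sub>R y)) = hcoef Q f z m (scaleR (1 / norm y) y)"
    and "norm y \<le> 1 \<Longrightarrow> hcoef Q f z m y = norm y ^ m *\<^sub>R hcoef Q f z m (scaleR (1 / norm y) y)"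
proof -
  have n1: "norm (scaleR (1 / norm y) y) \<le> 1" for y :: "real^'n" by simp
  show "continuous_on (ball 0 1 - {0}) (\<lambda>y. hcoef Q f z m (scaleR (1 / norm y) y))"
    by (rule continuous_on_compose2[OF continuous_on_hcoef[OF f]]) (auto intro!: continuous_intros split: if_splits)
  obtain M where "\<And>t y. norm t \<le> \<rho> \<Longrightarrow> norm y \<le> 1 \<Longrightarrow> norm (f (z + t *s cvec Q y)) \<le> M"
    using shift_bounded[OF f] by blast
  then show "\<exists>B. \<forall>y. norm (hcoef Q f z m (scaleR (1 / norm y) y)) \<le> B"
    using norm_hcoef_le[OF f _ n1] by blast
  show "c > 0 \<Longrightarrow> hcoef Q f z m (scaleR (1 / norm (c *\<^sub>R y)) (c *\<^sub>R y)) = hcoef Q f z m (scaleR (1 / norm y) y)"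
    by simp
  assume y: "norm y \<le> 1"
  show "hcoef Q f z m y = norm y ^ m *\<^sub>R hcoef Q f z m (scaleR (1 / norm y) y)"
    using hcoef_scaleR[OF f, of "scaleR (1 / norm y) y" "norm y" m] y by (cases "y = 0") auto
qed

text \<open>By homogeneity the integrand is |y|^(m + k) times a function of the direction, so
  \<open>integral_ball_radial\<close> applies with exponent m + k.\<close>

lemma integral_hcoef_power:
  assumes f: "cn.hol S f"
  shows "((\<lambda>y. norm y ^ k *\<^sub>R hcoef Q f z m y) has_integral
      (real CARD('n) / real (CARD('n) + m + k)) *\<^sub>R smean Q f z m) (ball 0 1)"
proof -
  let ?G = "\<lambda>y. hcoef Q f z m (scaleR (1 / norm y) y)"
  obtain B where B: "\<And>y. norm (?G y) \<le> B" using hcoef_sphere(2)[OF f] by blast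
  have B0: "B \<ge> 0" using order_trans[OF norm_ge_zero B] by simp
  have "(\<lambda>y. norm y ^ (m + k) *\<^sub>R ?G y) integrable_on ball 0 1"
  proof (rule integrable_ball_punctured)
    show "continuous_on (ball 0 1 - {0}) (\<lambda>y. norm y ^ (m + k) *\<^sub>R ?G y)" by (intro continuous_intros hcoef_sphere f)
    show "norm (norm y ^ (m + k) *\<^sub>R ?G y) \<le> 1 * B" if "y \<in> ball 0 1" for y
      unfolding norm_scaleR using that B0 B by (intro mult_mono) (auto simp: power_le_one)
  qed
  then have "((\<lambda>y. norm y ^ (m + k) *\<^sub>R ?G y) has_integral integral (ball 0 1) (\<lambda>y. norm y ^ (m + k) *\<^sub>R ?G y)) (ball 0 1)"
    by (rule integrable_integral)
  also have "integral (ball 0 1) (\<lambda>y. norm y ^ (m + k) *\<^sub>R ?G y) = (real CARD('n) / real (CARD('n) + m + k)) *\<^sub>R smean Q f z m"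
    using integral_ball_radial[of ?G B "m + k"] hcoef_sphere(1)[OF f] B by (simp add: smean_def add.assoc)
  finally show ?thesis
  proof (rule has_integral_eq[rotated])
    fix y :: "real^'n" assume "y \<in> ball 0 1"
    then have h: "hcoef Q f z m y = norm y ^ m *\<^sub>R ?G y" by (intro hcoef_sphere(4)[OF f]) simp
    show "norm y ^ (m + k) *\<^sub>R ?G y = norm y ^ k *\<^sub>R hcoef Q f z m y"
      unfolding h by (simp add: power_add mult.commute)
  qed
qed

lemma integral_weighted_sums:
  assumes c: "\<And>m. continuous_on (ball 0 1 - {0}) (c m)" and M: "\<And>m y. y \<in> ball 0 1 \<Longrightarrow> norm (c m y) \<le> C m"
    and C: "summable (\<lambda>m. C m * norm t ^ m)"
    and w: "continuous_on (ball 0 1 - {0}) w" "\<And>y. y \<in> ball 0 1 \<Longrightarrow> \<bar>w y\<bar> \<le> W"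
    and s: "\<And>y. y \<in> ball (0::real^'n) 1 \<Longrightarrow> (\<lambda>m. c m y * t ^ m) sums F y"
  shows "(\<lambda>m. integral (ball 0 1) (\<lambda>y. w y *\<^sub>R c m y) * t ^ m) sums integral (ball 0 1) (\<lambda>y. w y *\<^sub>R (F y :: complex))"
proof -
  have "(\<lambda>m. integral (ball 0 1) (\<lambda>y. w y *\<^sub>R (c m y * t ^ m))) sums integral (ball 0 1) (\<lambda>y. w y *\<^sub>R F y)"
  proof (rule integral_ball_sums)
    show "continuous_on (ball 0 1 - {0}) (\<lambda>y. w y *\<^sub>R (c m y * t ^ m))" for m by (intro continuous_intros c w)
    show "norm (w y *\<^sub>R (c m y * t ^ m)) \<le> W * (C m * norm t ^ m)" if "y \<in> ball 0 1" for m y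
      unfolding norm_scaleR norm_mult norm_power real_norm_def
      using w(2)[OF that] M[OF that, of m] by (intro mult_mono mult_right_mono) (auto intro: order_trans[OF norm_ge_zero])
    show "summable (\<lambda>m. W * (C m * norm t ^ m))" by (intro summable_mult C)
    show "(\<lambda>m. w y *\<^sub>R (c m y * t ^ m)) sums (w y *\<^sub>R F y)" if "y \<in> ball 0 1" for y
      by (intro sums_scaleR_right s that)
  qed
  then show ?thesis by (simp only: mult_scaleR_left[symmetric] Henstock_Kurzweil_Integration.integral_mult_left)
qed

end

text \<open>Factor by factor, (b + i) / (a + i) \<le> max 1 (b / a). Exchanging one Pochhammer
  symbol for another, in particular for j! = (1)_j, thus costs only a geometric factor.\<close>

lemma pochhammer_le:
  fixes a b :: real
  assumes "a > 0" "b > 0"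
  shows "pochhammer b j \<le> max 1 (b / a) ^ j * pochhammer a j"
proof (induction j)
  case (Suc j)
  let ?C = "max 1 (b / a)"
  have "b \<le> ?C * a" using assms by (simp add: max_def field_simps)
  moreover have "real j \<le> ?C * real j" by (simp add: mult_le_cancel_right1)
  ultimately have "b + real j \<le> ?C * (a + real j)" by (simp add: distrib_left)
  then have "pochhammer b j * (b + real j) \<le> (?C ^ j * pochhammer a j) * (?C * (a + real j))"
    using Suc assms by (intro mult_mono) (auto intro!: mult_nonneg_nonneg pochhammer_nonneg)
  then show ?case by (simp add: pochhammer_Suc mult_ac)
qed simp

section \<open>The recursion for the spherical integrals and its solution\<close>

context shift_disc
begin

text \<open>Both sides of \<open>Pizzetti_Green\<close> are expanded in powers of t and compared.
  The radial derivative contributes the degree k on one side, t^2 shifts the index by two on the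
  other, and the weighted ball integrals reduce to spherical integrals with rational factors. Degree
  1 meets no shifted term, so its spherical integral is 0.\<close>

lemma
  assumes f: "cn.hol S f" and Q: "Q ** transpose Q = A"
  shows smean_1: "smean Q f z 1 = 0"
    and smean_Pop: "real ((m + 2) * (CARD('n) + m)) *\<^sub>R smean Q f z (m + 2) = smean Q (Pop A f) z m"
proof -
  let ?n = "real CARD('n)" and ?P = "Pop A f"
  have P: "cn.hol S ?P" by (rule hol_Pop[OF open_S f])
  obtain M where M: "\<And>t y. norm t \<le> \<rho> \<Longrightarrow> norm y \<le> 1 \<Longrightarrow> norm (f (z + t *s cvec Q y)) \<le> M"
    using shift_bounded[OF f] by blast
  obtain M' where M': "\<And>t y. norm t \<le> \<rho> \<Longrightarrow> norm y \<le> 1 \<Longrightarrow> norm (?P (z + t *s cvec Q y)) \<le> M'"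
    using shift_bounded[OF P] by blast
  have hc: "continuous_on (ball 0 1 - {0}) (hcoef Q g z m)" if "cn.hol S g" for g m
    by (rule continuous_on_subset[OF continuous_on_hcoef[OF that]]) auto
  define a where "a k = integral (ball 0 1) (\<lambda>y. (4 * (1 - (norm y)\<^sup>2)) *\<^sub>R (of_nat k * hcoef Q f z k y))" for k
  define b where "b k = integral (ball 0 1) (\<lambda>y. (1 - (norm y)\<^sup>2)\<^sup>2 *\<^sub>R hcoef Q ?P z k y)" for k
  \<comment> \<open>The coefficients of t^2 times the series with coefficients
    \<open>b\<close>.\<close>
  define b' where "b' k = (if k < 2 then 0 else b (k - 2))" for k
  have w1: "\<bar>1 - (norm y)\<^sup>2\<bar> \<le> 1" if "y \<in> ball (0::real^'n) 1" for y
  proof -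
    have "(norm y)\<^sup>2 \<le> 1" using that by (simp add: power_le_one)
    then show ?thesis by simp
  qed
  have lhs: "(\<lambda>k. a k * t ^ k) sums integral (ball 0 1) (\<lambda>y. (4 * (1 - (norm y)\<^sup>2)) *\<^sub>R (t * cn.Dd f (z + t *s cvec Q y) (cvec Q y)))"
    if t: "norm t < \<rho>" for t
    unfolding a_def
  proof (rule integral_weighted_sums[where C = "\<lambda>m. of_nat m * (M / \<rho> ^ m)" and W = 4])
    show "continuous_on (ball 0 1 - {0}) (\<lambda>y. of_nat m * hcoef Q f z m y)" for m
      by (intro continuous_intros hc f)
    show "norm (of_nat m * hcoef Q f z m y) \<le> of_nat m * (M / \<rho> ^ m)" if "y \<in> ball 0 1" for m y
      unfolding norm_mult norm_of_nat using that by (intro mult_left_mono norm_hcoef_le[OF f M]) auto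
    let ?x = "norm t / \<rho>"
    have "norm ?x < 1" using t rho_pos by simp
    then have "summable (\<lambda>m. ?x * (of_nat (Suc m) * ?x ^ m))"
      by (intro summable_mult sums_summable[OF geometric_deriv_sums])
    then have "summable (\<lambda>m. of_nat (Suc m) * ?x ^ Suc m)" by (simp only: power_Suc mult_ac)
    then have "summable (\<lambda>m. of_nat m * ?x ^ m)" by (rule summable_Suc_iff[THEN iffD1])
    then have "summable (\<lambda>m. M * (of_nat m * ?x ^ m))" by (rule summable_mult)
    then show "summable (\<lambda>m. of_nat m * (M / \<rho> ^ m) * norm t ^ m)" by (simp add: power_divide mult_ac)
    show "continuous_on (ball 0 1 - {0}) (\<lambda>y::real^'n. 4 * (1 - (norm y)\<^sup>2))" by (intro continuous_intros)
    show "\<bar>4 * (1 - (norm y)\<^sup>2)\<bar> \<le> 4" if "y \<in> ball 0 1" for y :: "real^'n" using w1[OF that] by simp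
    show "(\<lambda>m. of_nat m * hcoef Q f z m y * t ^ m) sums (t * cn.Dd f (z + t *s cvec Q y) (cvec Q y))" if "y \<in> ball 0 1" for y
      by (rule hcoef_deriv_sums[OF f]) (use that t in auto)
  qed
  have "(\<lambda>k. b k * t ^ k) sums integral (ball 0 1) (\<lambda>y. (1 - (norm y)\<^sup>2)\<^sup>2 *\<^sub>R ?P (z + t *s cvec Q y))"
    if t: "norm t < \<rho>" for t
    unfolding b_def
  proof (rule integral_weighted_sums[where C = "\<lambda>m. M' / \<rho> ^ m" and W = 1])
    show "norm (hcoef Q ?P z m y) \<le> M' / \<rho> ^ m" if "y \<in> ball 0 1" for m y
      using that by (intro norm_hcoef_le[OF P M']) auto
    have "summable (\<lambda>m. M' * (norm t / \<rho>) ^ m)"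
      using t rho_pos by (intro summable_mult summable_geometric) auto
    then show "summable (\<lambda>m. M' / \<rho> ^ m * norm t ^ m)" by (simp add: power_divide)
    show "\<bar>(1 - (norm y)\<^sup>2)\<^sup>2\<bar> \<le> 1" if "y \<in> ball 0 1" for y :: "real^'n"
      using w1[OF that] by (simp add: abs_square_le_1)
    show "(\<lambda>m. hcoef Q ?P z m y * t ^ m) sums (?P (z + t *s cvec Q y))" if "y \<in> ball 0 1" for y
      by (rule hcoef_sums[OF P]) (use that t in auto)
  qed (intro hc P continuous_intros)+
  then have "(\<lambda>k. t\<^sup>2 * (b k * t ^ k)) sums (t\<^sup>2 * integral (ball 0 1) (\<lambda>y. (1 - (norm y)\<^sup>2)\<^sup>2 *\<^sub>R ?P (z + t *s cvec Q y)))"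
    if "norm t < \<rho>" for t
    using that by (intro sums_mult) blast
  then have b2: "(\<lambda>k. b' (k + 2) * t ^ (k + 2)) sums (t\<^sup>2 * integral (ball 0 1) (\<lambda>y. (1 - (norm y)\<^sup>2)\<^sup>2 *\<^sub>R ?P (z + t *s cvec Q y)))"
    if "norm t < \<rho>" for t
    using that by (simp add: b'_def power2_eq_square mult_ac)
  have e: "(\<Sum>i<2. b' i * t ^ i) = 0" for t :: complex by (simp add: b'_def)
  have rhs0: "(\<lambda>k. b' k * t ^ k) sums (t\<^sup>2 * integral (ball 0 1) (\<lambda>y. (1 - (norm y)\<^sup>2)\<^sup>2 *\<^sub>R ?P (z + t *s cvec Q y)))"
    if "norm t < \<rho>" for t
    using b2[OF that] unfolding sums_iff_shift[of "\<lambda>k. b' k * t ^ k" 2] e by simp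
  have rhs: "(\<lambda>k. b' k * t ^ k) sums integral (ball 0 1) (\<lambda>y. (4 * (1 - (norm y)\<^sup>2)) *\<^sub>R (t * cn.Dd f (z + t *s cvec Q y) (cvec Q y)))"
    if t: "norm t < \<rho>" for t
  proof -
    have "integral (ball 0 1) (\<lambda>y. (1 - (norm y)\<^sup>2)\<^sup>2 *\<^sub>R (t\<^sup>2 * ?P (z + t *s cvec Q y)))
      = integral (ball 0 1) (\<lambda>y. (4 * (1 - (norm y)\<^sup>2)) *\<^sub>R (t * cn.Dd f (z + t *s cvec Q y) (cvec Q y)))"
      by (rule Pizzetti_Green[OF open_S f Q]) (use dom t in auto)
    moreover have "integral (ball 0 1) (\<lambda>y. (1 - (norm y)\<^sup>2)\<^sup>2 *\<^sub>R (t\<^sup>2 * ?P (z + t *s cvec Q y)))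
       = t\<^sup>2 * integral (ball 0 1) (\<lambda>y. (1 - (norm y)\<^sup>2)\<^sup>2 *\<^sub>R ?P (z + t *s cvec Q y))"
      by (simp only: mult_scaleR_right[symmetric] Henstock_Kurzweil_Integration.integral_mult_right)
    ultimately show ?thesis using rhs0[OF t] by simp
  qed
  have ab: "a k = b' k" for k
    by (rule powser_unique[OF rho_pos lhs rhs])
  have np: "?n > 0" by simp
  \<comment> \<open>The weight 4 (1 - |y|^2) splits into the radial exponents 0 and 2; an exponent l
    contributes n / (n + k + l) times the spherical integral.\<close>
  have a: "a k = (4 * real k * ?n * (1 / (?n + real k) - 1 / (?n + real k + 2))) *\<^sub>R smean Q f z k" for k
  proof -
    have i: "((\<lambda>y. (4 * real k) *\<^sub>R (norm y ^ 0 *\<^sub>R hcoef Q f z k y - norm y ^ 2 *\<^sub>R hcoef Q f z k y)) has_integral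
      (4 * real k) *\<^sub>R ((?n / real (CARD('n) + k + 0)) *\<^sub>R smean Q f z k - (?n / real (CARD('n) + k + 2)) *\<^sub>R smean Q f z k)) (ball 0 1)"
      by (intro has_integral_cmul has_integral_diff integral_hcoef_power f)
    have "(4 * real k) *\<^sub>R (norm y ^ 0 *\<^sub>R hcoef Q f z k y - norm y ^ 2 *\<^sub>R hcoef Q f z k y)
       = (4 * (1 - (norm y)\<^sup>2)) *\<^sub>R (of_nat k * hcoef Q f z k y)" for y
      by (simp add: scaleR_conv_of_real algebra_simps)
    then have "a k = (4 * real k) *\<^sub>R ((?n / real (CARD('n) + k + 0)) *\<^sub>R smean Q f z k - (?n / real (CARD('n) + k + 2)) *\<^sub>R smean Q f z k)"
      unfolding a_def using integral_unique[OF i] by (simp only:)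
    then show ?thesis by (simp add: scaleR_diff_left[symmetric] right_diff_distrib)
  qed
  have b: "b k = (?n * (1 / (?n + real k) - 2 / (?n + real k + 2) + 1 / (?n + real k + 4))) *\<^sub>R smean Q ?P z k" for k
  proof -
    have i: "((\<lambda>y. norm y ^ 0 *\<^sub>R hcoef Q ?P z k y - 2 *\<^sub>R (norm y ^ 2 *\<^sub>R hcoef Q ?P z k y) + norm y ^ 4 *\<^sub>R hcoef Q ?P z k y) has_integral
      ((?n / real (CARD('n) + k + 0)) *\<^sub>R smean Q ?P z k - 2 *\<^sub>R ((?n / real (CARD('n) + k + 2)) *\<^sub>R smean Q ?P z k)
       + (?n / real (CARD('n) + k + 4)) *\<^sub>R smean Q ?P z k)) (ball 0 1)"
      by (intro has_integral_add has_integral_cmul has_integral_diff integral_hcoef_power P)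
    have "norm y ^ 0 *\<^sub>R hcoef Q ?P z k y - 2 *\<^sub>R (norm y ^ 2 *\<^sub>R hcoef Q ?P z k y) + norm y ^ 4 *\<^sub>R hcoef Q ?P z k y
       = (1 - (norm y)\<^sup>2)\<^sup>2 *\<^sub>R hcoef Q ?P z k y" for y
      by (simp add: scaleR_conv_of_real power2_eq_square power4_eq_xxxx algebra_simps)
    then have "b k = (?n / real (CARD('n) + k + 0)) *\<^sub>R smean Q ?P z k - 2 *\<^sub>R ((?n / real (CARD('n) + k + 2)) *\<^sub>R smean Q ?P z k)
       + (?n / real (CARD('n) + k + 4)) *\<^sub>R smean Q ?P z k"
      unfolding b_def using integral_unique[OF i] by (simp only:)
    moreover have "(?n / x) *\<^sub>R v - 2 *\<^sub>R ((?n / y) *\<^sub>R v) + (?n / w) *\<^sub>R v = (?n * (1 / x - 2 / y + 1 / w)) *\<^sub>R v"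
      for x y w and v :: complex
    proof -
      have "?n * (1 / x - 2 / y + 1 / w) = ?n / x - 2 * (?n / y) + ?n / w" by (simp add: ring_distribs)
      then show ?thesis by (simp only: scaleR_add_left scaleR_diff_left scaleR_scaleR)
    qed
    ultimately show ?thesis by (simp only: of_nat_add) simp
  qed
  have "(4 * ?n * (1 / (?n + 1) - 1 / (?n + 1 + 2))) *\<^sub>R smean Q f z 1 = 0"
    using ab[of 1] a[of 1] by (simp add: b'_def)
  moreover have "4 * ?n * (1 / (?n + 1) - 1 / (?n + 1 + 2)) \<noteq> 0"
  proof -
    have "1 / (?n + 1 + 2) < 1 / (?n + 1)" using np by (intro divide_strict_left_mono) auto
    then show ?thesis using np by simp
  qed
  ultimately show "smean Q f z 1 = 0" by (metis scaleR_eq_0_iff)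
  define N where "N = ?n + real m"
  have N: "N > 0" unfolding N_def using np by (intro add_pos_nonneg) auto
  \<comment> \<open>With N = n + m, 1/N - 2/(N + 2) + 1/(N + 4) = 8 / (N (N + 2) (N + 4)), and 4 (m
    + 2) (1/(N + 2) - 1/(N + 4)) is the same number times (m + 2) N. After multiplication by n the
    common factor is \<kappa>, and it cancels.\<close>
  define \<kappa> where "\<kappa> = 8 * ?n / (N * (N + 2) * (N + 4))"
  have \<kappa>: "\<kappa> \<noteq> 0" using np N by (simp add: \<kappa>_def)
  have "a (m + 2) = b m" using ab[of "m + 2"] by (simp add: b'_def)
  moreover have "4 * real (m + 2) * ?n * (1 / (?n + real (m + 2)) - 1 / (?n + real (m + 2) + 2)) = \<kappa> * real ((m + 2) * (CARD('n) + m))"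
  proof -
    have "4 * x * y * (1 / (N + 2) - 1 / (N + 2 + 2)) = 8 * y / (N * (N + 2) * (N + 4)) * (x * N)" for x y :: real
      using N by (simp add: divide_simps; simp add: algebra_simps)
    moreover have "?n + real (m + 2) = N + 2" "real ((m + 2) * (CARD('n) + m)) = real (m + 2) * N"
      by (simp_all only: N_def of_nat_add of_nat_mult of_nat_numeral add.assoc)
    ultimately show ?thesis by (simp only: \<kappa>_def)
  qed
  moreover have "?n * (1 / (?n + real m) - 2 / (?n + real m + 2) + 1 / (?n + real m + 4)) = \<kappa>"
  proof -
    have "y * (1 / N - 2 / (N + 2) + 1 / (N + 4)) = 8 * y / (N * (N + 2) * (N + 4))" for y :: real
      using N by (simp add: divide_simps; simp add: algebra_simps)
    then show ?thesis by (simp add: \<kappa>_def N_def)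
  qed
  ultimately have "\<kappa> *\<^sub>R (real ((m + 2) * (CARD('n) + m)) *\<^sub>R smean Q f z (m + 2)) = \<kappa> *\<^sub>R smean Q ?P z m"
    unfolding a b by (simp only: scaleR_scaleR)
  then show "real ((m + 2) * (CARD('n) + m)) *\<^sub>R smean Q f z (m + 2) = smean Q ?P z m"
    using \<kappa> by (simp only: scaleR_cancel_left) simp
qed

lemma smean_0: "smean Q f z 0 = alpha_n CARD('n) *\<^sub>R f z"
  using has_integral_scaleR_left[OF has_integral_one_ball[where 'n = 'n], of "f z"]
  by (simp add: smean_def hcoef_def integral_unique)

lemma smean_odd:
  assumes "cn.hol S f" "Q ** transpose Q = A"
  shows "smean Q f z (2 * j + 1) = 0"
  using assms(1)
proof (induction j arbitrary: f)
  case 0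
  then show ?case using smean_1[OF _ assms(2)] by simp
next
  case (Suc j)
  have "real ((2 * j + 1 + 2) * (CARD('n) + (2 * j + 1))) *\<^sub>R smean Q f z (2 * j + 1 + 2) = 0"
    using smean_Pop[OF Suc.prems assms(2), of "2 * j + 1"] Suc.IH[OF hol_Pop[OF open_S Suc.prems], of A] by simp
  moreover have "real ((2 * j + 1 + 2) * (CARD('n) + (2 * j + 1))) \<noteq> 0" unfolding of_nat_eq_0_iff by simp
  ultimately have "smean Q f z (2 * j + 1 + 2) = 0" by (simp only: scaleR_eq_0_iff) simp
  moreover have "2 * Suc j + 1 = 2 * j + 1 + 2" by simp
  ultimately show ?case by (simp only:)
qed

text \<open>The recursion factor (2j + 2)(n + 2j) is 4 (j + 1)(n/2 + j), whence 4^j, j! and (n/2)_j.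
  The induction peels the innermost operator off, so its hypothesis is used for
  \<open>Pop A f\<close>.\<close>

lemma smean_even:
  assumes "cn.hol S f" "Q ** transpose Q = A"
  shows "(4 ^ j * fact j * pochhammer (real CARD('n) / 2) j) *\<^sub>R smean Q f z (2 * j)
    = alpha_n CARD('n) *\<^sub>R (Pop A ^^ j) f z"
  using assms(1)
proof (induction j arbitrary: f)
  case 0
  then show ?case by (simp add: smean_0)
next
  case (Suc j)
  let ?c = "4 ^ j * fact j * pochhammer (real CARD('n) / 2) j"
  have "(4 ^ Suc j * fact (Suc j) * pochhammer (real CARD('n) / 2) (Suc j)) *\<^sub>R smean Q f z (2 * Suc j)
     = ?c *\<^sub>R (real ((2 * j + 2) * (CARD('n) + 2 * j)) *\<^sub>R smean Q f z (2 * j + 2))"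
  proof -
    have "4 ^ Suc j * fact (Suc j) * pochhammer (real CARD('n) / 2) (Suc j) = ?c * real ((2 * j + 2) * (CARD('n) + 2 * j))"
      by (simp add: pochhammer_Suc field_simps)
    moreover have "2 * Suc j = 2 * j + 2" by simp
    ultimately show ?thesis by (simp only: scaleR_scaleR)
  qed
  also have "\<dots> = ?c *\<^sub>R smean Q (Pop A f) z (2 * j)"
    by (simp only: smean_Pop[OF Suc.prems assms(2)])
  also have "\<dots> = alpha_n CARD('n) *\<^sub>R (Pop A ^^ j) (Pop A f) z"
    by (rule Suc.IH[OF hol_Pop[OF open_S Suc.prems]])
  finally show ?case by (simp add: funpow_swap1)
qed

lemma smean_even_ucoef:
  assumes "cn.hol S f" "Q ** transpose Q = A"
  shows "smean Q f z (2 * j) = alpha_n CARD('n) *\<^sub>R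
     (ucoef A f j z / of_real (pochhammer (real CARD('n) / 2) j) / 4 ^ j)"
proof -
  have p: "pochhammer (real CARD('n) / 2) j > 0" by (rule pochhammer_pos) simp
  have "of_real (4 ^ j * fact j * pochhammer (real CARD('n) / 2) j) * smean Q f z (2 * j)
    = of_real (alpha_n CARD('n)) * (Pop A ^^ j) f z"
    using smean_even[OF assms, of j] by (simp only: scaleR_conv_of_real)
  then show ?thesis
    using p by (simp add: ucoef_def scaleR_conv_of_real field_simps)
qed

text \<open>Odd degrees vanish, so both expansions run over even powers. In the solid mean the
  radial integration adds n / (n + 2j), which later turns (n/2)_j into (n/2 + 1)_j.\<close>

lemma sphere_mean_sums:
  assumes f: "cn.hol S f" and Q: "Q ** transpose Q = A" and t: "norm t < \<rho>"
  shows "(\<lambda>j. smean Q f z (2 * j) * t ^ (2 * j)) sums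
     integral (ball 0 1) (\<lambda>y. f (z + t *s cvec Q (scaleR (1 / norm y) y)))"
    and "(\<lambda>j. (real CARD('n) / real (CARD('n) + 2 * j)) *\<^sub>R smean Q f z (2 * j) * t ^ (2 * j)) sums
     integral (ball 0 1) (\<lambda>y. f (z + t *s cvec Q y))"
proof -
  obtain M where M: "\<And>t y. norm t \<le> \<rho> \<Longrightarrow> norm y \<le> 1 \<Longrightarrow> norm (f (z + t *s cvec Q y)) \<le> M"
    using shift_bounded[OF f] by blast
  have "summable (\<lambda>m. M * (norm t / \<rho>) ^ m)"
    using t rho_pos by (intro summable_mult summable_geometric) auto
  then have C: "summable (\<lambda>m. M / \<rho> ^ m * norm t ^ m)" by (simp add: power_divide)
  have n1: "norm (scaleR (1 / norm y) y) \<le> 1" for y :: "real^'n" by simp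
  have "(\<lambda>m. integral (ball 0 1) (\<lambda>y. 1 *\<^sub>R hcoef Q f z m (scaleR (1 / norm y) y)) * t ^ m) sums
     integral (ball 0 1) (\<lambda>y. 1 *\<^sub>R f (z + t *s cvec Q (scaleR (1 / norm y) y)))"
  proof (rule integral_weighted_sums[where W = 1, OF hcoef_sphere(1)[OF f] _ C])
    show "norm (hcoef Q f z m (scaleR (1 / norm y) y)) \<le> M / \<rho> ^ m" for m y
      by (rule norm_hcoef_le[OF f M n1])
    show "(\<lambda>m. hcoef Q f z m (scaleR (1 / norm y) y) * t ^ m) sums f (z + t *s cvec Q (scaleR (1 / norm y) y))" for y
      by (rule hcoef_sums[OF f le_less_trans[OF n1] t]) simp
  qed auto
  then have 1: "(\<lambda>m. smean Q f z m * t ^ m) sums integral (ball 0 1) (\<lambda>y. f (z + t *s cvec Q (scaleR (1 / norm y) y)))"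
    by (simp add: smean_def)
  have "(\<lambda>m. integral (ball 0 1) (\<lambda>y. 1 *\<^sub>R hcoef Q f z m y) * t ^ m) sums
     integral (ball 0 1) (\<lambda>y. 1 *\<^sub>R f (z + t *s cvec Q y))"
  proof (rule integral_weighted_sums[where W = 1, OF _ _ C])
    show "continuous_on (ball 0 1 - {0}) (hcoef Q f z m)" for m
      by (rule continuous_on_subset[OF continuous_on_hcoef[OF f]]) auto
    show "norm (hcoef Q f z m y) \<le> M / \<rho> ^ m" if "y \<in> ball 0 1" for m y
      by (rule norm_hcoef_le[OF f M]) (use that in auto)
    show "(\<lambda>m. hcoef Q f z m y * t ^ m) sums f (z + t *s cvec Q y)" if "y \<in> ball 0 1" for y
      by (rule hcoef_sums[OF f _ t]) (use that in auto)
  qed auto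
  moreover have "integral (ball 0 1) (hcoef Q f z m) = (real CARD('n) / real (CARD('n) + m)) *\<^sub>R smean Q f z m" for m
    using integral_unique[OF integral_hcoef_power[OF f, of 0 m]] by simp
  ultimately have 2: "(\<lambda>m. (real CARD('n) / real (CARD('n) + m)) *\<^sub>R smean Q f z m * t ^ m) sums integral (ball 0 1) (\<lambda>y. f (z + t *s cvec Q y))"
    by simp
  have sm: "strict_mono (\<lambda>j::nat. 2 * j)" by (simp add: strict_mono_def)
  have odd: "smean Q f z m = 0" if "m \<notin> range (\<lambda>j. 2 * j)" for m
  proof -
    have "odd m" using that by (auto elim!: evenE)
    then show ?thesis using smean_odd[OF f Q] by (auto elim!: oddE)
  qed
  show "(\<lambda>j. smean Q f z (2 * j) * t ^ (2 * j)) sums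
     integral (ball 0 1) (\<lambda>y. f (z + t *s cvec Q (scaleR (1 / norm y) y)))"
    using sums_mono_reindex[OF sm, of "\<lambda>m. smean Q f z m * t ^ m"] 1 odd by simp
  show "(\<lambda>j. (real CARD('n) / real (CARD('n) + 2 * j)) *\<^sub>R smean Q f z (2 * j) * t ^ (2 * j)) sums
     integral (ball 0 1) (\<lambda>y. f (z + t *s cvec Q y))"
    using sums_mono_reindex[OF sm, of "\<lambda>m. (real CARD('n) / real (CARD('n) + m)) *\<^sub>R smean Q f z m * t ^ m"] 2 odd by simp
qed

lemma norm_smean_le:
  assumes f: "cn.hol S f" and M: "\<And>t y. norm t \<le> \<rho> \<Longrightarrow> norm y \<le> 1 \<Longrightarrow> norm (f (z + t *s cvec Q y)) \<le> M"
  shows "norm (smean Q f z m) \<le> alpha_n CARD('n) * (M / \<rho> ^ m)"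
proof -
  have n1: "norm (scaleR (1 / norm y) y) \<le> 1" for y :: "real^'n" by simp
  have le: "norm (hcoef Q f z m (scaleR (1 / norm y) y)) \<le> M / \<rho> ^ m" for y
    by (rule norm_hcoef_le[OF f M n1])
  have "norm (smean Q f z m) \<le> integral (ball (0::real^'n) 1) (\<lambda>y. M / \<rho> ^ m)"
    unfolding smean_def
    by (rule integral_norm_bound_integral)
      (use le hcoef_sphere(1)[OF f] in \<open>auto intro!: integrable_ball_punctured integrable_on_const\<close>)
  also have "\<dots> = alpha_n CARD('n) * (M / \<rho> ^ m)"
    using integral_unique[OF has_integral_scaleR_left[OF has_integral_one_ball, of "M / \<rho> ^ m"]]
    by (simp only: real_scaleR_def mult_1)
  finally show ?thesis .
qed

end


text \<open>Besides the two expansions this provides the factorial bound on the coefficients: the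
  spherical integral of degree 2j is u_j up to explicit factors, and Cauchy's estimate bounds it by
  a constant times \<rho>^(-2j).\<close>

lemma mean_expansion:
  fixes A Q :: "real^'n^'n"
  assumes r: "r > 0" and f: "cn.hol (ball 0 r) f" and Q: "Q ** transpose Q = A"
  obtains \<rho> K M where "\<rho> > 0" "K \<ge> 1" "M \<ge> 0" "\<rho> \<le> r"
    and "\<And>z j. norm z < \<rho> \<Longrightarrow> norm (ucoef A f j z) \<le> M * K ^ j * fact j"
    and "\<And>z t. norm z < \<rho> \<Longrightarrow> norm t < \<rho> \<Longrightarrow>
      (\<lambda>j. ucoef A f j z / of_real (pochhammer (real CARD('n) / 2) j) * (t\<^sup>2 / 4) ^ j) sums
        ((1 / alpha_n CARD('n)) *\<^sub>R integral (ball 0 1) (\<lambda>y. f (z + t *s cvec Q (scaleR (1 / norm y) y))))"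
    and "\<And>z t. norm z < \<rho> \<Longrightarrow> norm t < \<rho> \<Longrightarrow>
      (\<lambda>j. ucoef A f j z / of_real (pochhammer (real CARD('n) / 2 + 1) j) * (t\<^sup>2 / 4) ^ j) sums
        ((1 / alpha_n CARD('n)) *\<^sub>R integral (ball 0 1) (\<lambda>y. f (z + t *s cvec Q y)))"
proof -
  define \<kappa> where "\<kappa> = onorm ((*v) Q) + 1"
  have \<kappa>: "\<kappa> > 0" using onorm_pos_le[OF matrix_vector_mul_bounded_linear, of Q] by (simp add: \<kappa>_def)
  \<comment> \<open>For |y| \<le> 2 and |t| \<le> \<rho> the displacement is at most 2 \<kappa>
    \<rho> = r / 4, so points with |z| \<le> r / 2 stay within radius 3 r / 4, where f is bounded by
    compactness.\<close>
  define \<rho> where "\<rho> = r / (8 * \<kappa>)"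
  have \<rho>: "\<rho> > 0" using r \<kappa> by (simp add: \<rho>_def)
  let ?V = "alpha_n CARD('n)"
  have V: "?V > 0" by (rule alpha_n_pos)
  have bnd: "norm (z + t *s cvec Q y) \<le> 3 * r / 4" if "norm z \<le> r / 2" "norm t \<le> \<rho>" "norm y \<le> 2" for z t and y :: "real^'n"
  proof -
    have "norm (cvec Q y) \<le> \<kappa> * 2"
      using norm_cvec_le[of Q y] that(3) onorm_pos_le[OF matrix_vector_mul_bounded_linear, of Q]
        mult_mono[of "onorm ((*v) Q)" \<kappa> "norm y" 2] by (simp add: \<kappa>_def)
    then have "norm t * norm (cvec Q y) \<le> \<rho> * (\<kappa> * 2)" using that \<rho> by (intro mult_mono) auto
    also have "\<dots> = r / 4" using \<kappa> by (simp add: \<rho>_def)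
    finally show ?thesis
      using norm_triangle_ineq[of z "t *s cvec Q y"] that(1) by (simp add: norm_vec_smult)
  qed
  have disc: "shift_disc Q (ball 0 r) z \<rho>" if "norm z \<le> r / 2" for z
  proof
    show "z + t *s cvec Q y \<in> ball 0 r" if "norm t \<le> \<rho>" "norm y < 2" for t and y :: "real^'n"
      using bnd[OF \<open>norm z \<le> r / 2\<close> that(1), of y] that(2) r by simp
  qed (use \<rho> in auto)
  have "continuous_on (cball 0 (3 * r / 4)) f"
    by (rule continuous_on_subset[OF cn.hol_continuous_on[OF f]]) (use r in auto)
  then obtain M where "\<And>w. w \<in> cball 0 (3 * r / 4) \<Longrightarrow> norm (f w) \<le> M"
    by (rule compact_norm_bound[OF compact_cball]) blast
  then have M: "norm (f w) \<le> M" if "norm w \<le> 3 * r / 4" for w using that by simp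
  have M0: "M \<ge> 0" using order_trans[OF norm_ge_zero M[of 0]] r by simp
  have n2: "real CARD('n) / 2 > 0" by simp
  define C where "C = max 1 (real CARD('n) / 2 / 1)"
  \<comment> \<open>4 comes from 4^j, \<open>C\<close> from replacing (n/2)_j by j!, and \<rho>^2
    from the degree 2j; the maximum secures K \<ge> 1.\<close>
  define K where "K = max 1 (4 * C / \<rho>\<^sup>2)"
  have pp: "pochhammer (real CARD('n) / 2) j > 0" for j by (rule pochhammer_pos) simp
  have ub: "norm (ucoef A f j z) \<le> M * K ^ j * fact j" if z: "norm z \<le> r / 2" for z j
  proof -
    interpret shift_disc Q "ball 0 r" z \<rho> by (rule disc[OF z])
    have "norm (smean Q f z (2 * j)) \<le> ?V * (M / \<rho> ^ (2 * j))"
      by (rule norm_smean_le[OF f]) (rule M, rule bnd[OF z], auto)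
    then have "norm (ucoef A f j z) / pochhammer (real CARD('n) / 2) j / 4 ^ j \<le> M / \<rho> ^ (2 * j)"
      unfolding smean_even_ucoef[OF f Q] norm_scaleR abs_of_pos[OF V] mult_le_cancel_left_pos[OF V]
      by (simp add: norm_divide norm_mult norm_power abs_of_pos[OF pp])
    then have "norm (ucoef A f j z) \<le> M / \<rho> ^ (2 * j) * 4 ^ j * pochhammer (real CARD('n) / 2) j"
      using pp[of j] by (simp add: field_simps)
    also have "\<dots> \<le> M / \<rho> ^ (2 * j) * 4 ^ j * (C ^ j * pochhammer 1 j)"
      unfolding C_def using M0 \<rho> by (intro mult_left_mono pochhammer_le n2) auto
    also have "\<dots> = M * (4 * C / \<rho>\<^sup>2) ^ j * fact j"
      by (simp add: pochhammer_fact power_mult power_divide power_mult_distrib)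
    also have "\<dots> \<le> M * K ^ j * fact j"
      using M0 \<rho> by (intro mult_right_mono mult_left_mono power_mono) (auto simp: K_def C_def)
    finally show ?thesis .
  qed
  show ?thesis
  proof (rule that[of "min \<rho> (r / 2)" K M])
    show "norm (ucoef A f j z) \<le> M * K ^ j * fact j" if "norm z < min \<rho> (r / 2)" for z j
      using ub that by simp
  next
    fix z :: "complex^'n" and t :: complex assume zt: "norm z < min \<rho> (r / 2)" "norm t < min \<rho> (r / 2)"
    interpret shift_disc Q "ball 0 r" z \<rho> by (rule disc) (use zt in simp)
    have t: "norm t < \<rho>" using zt by simp
    have tt: "(t\<^sup>2 / 4) ^ j = t ^ (2 * j) / 4 ^ j" for j by (simp add: power_divide power_mult)
    have "(1 / ?V) *\<^sub>R (smean Q f z (2 * j) * t ^ (2 * j)) =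
       ucoef A f j z / of_real (pochhammer (real CARD('n) / 2) j) * (t\<^sup>2 / 4) ^ j" for j
      unfolding smean_even_ucoef[OF f Q] tt using V by (simp add: scaleR_conv_of_real)
    then show "(\<lambda>j. ucoef A f j z / of_real (pochhammer (real CARD('n) / 2) j) * (t\<^sup>2 / 4) ^ j) sums
        ((1 / ?V) *\<^sub>R integral (ball 0 1) (\<lambda>y. f (z + t *s cvec Q (scaleR (1 / norm y) y))))"
      using sums_scaleR_right[OF sphere_mean_sums(1)[OF f Q t], of "1 / ?V"] by simp
    have "(1 / ?V) *\<^sub>R ((real CARD('n) / real (CARD('n) + 2 * j)) *\<^sub>R smean Q f z (2 * j) * t ^ (2 * j)) =
       ucoef A f j z / of_real (pochhammer (real CARD('n) / 2 + 1) j) * (t\<^sup>2 / 4) ^ j" for j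
    proof -
      let ?n = "real CARD('n)"
      have np: "?n > 0" by simp
      \<comment> \<open>With a = n/2, (a)_(j+1) is written both as a (a + 1)_j and as (a)_j (a +
        j).\<close>
      have "?n / 2 * pochhammer (?n / 2 + 1) j = pochhammer (?n / 2) j * (?n / 2 + real j)"
        using pochhammer_rec[of "?n / 2" j] pochhammer_rec'[of "?n / 2" j] by (simp add: pochhammer_Suc)
      then have "pochhammer (?n / 2 + 1) j = pochhammer (?n / 2) j * ((?n + 2 * real j) / ?n)"
        using np by (simp add: field_simps)
      then have p1: "1 / pochhammer (?n / 2 + 1) j = ?n / (?n + 2 * real j) * (1 / pochhammer (?n / 2) j)"
        by simp
      have "ucoef A f j z / of_real (pochhammer (?n / 2 + 1) j) = ucoef A f j z * of_real (1 / pochhammer (?n / 2 + 1) j)"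
        by simp
      then show ?thesis
        unfolding p1 smean_even_ucoef[OF f Q] tt using V by (simp add: scaleR_conv_of_real mult_ac)
    qed
    then show "(\<lambda>j. ucoef A f j z / of_real (pochhammer (real CARD('n) / 2 + 1) j) * (t\<^sup>2 / 4) ^ j) sums
        ((1 / ?V) *\<^sub>R integral (ball 0 1) (\<lambda>y. f (z + t *s cvec Q y)))"
      using sums_scaleR_right[OF sphere_mean_sums(2)[OF f Q t], of "1 / ?V"] by simp
  qed (use \<rho> r M0 in \<open>auto simp: K_def\<close>)
qed

section \<open>Disc-sectors and exponential growth\<close>

lemma hol_compose_snd:
  assumes f: "cnt.hol S f" and S: "\<And>p. p \<in> T \<Longrightarrow> (fst p, h (snd p)) \<in> S"
    and h: "\<And>p. p \<in> T \<Longrightarrow> (h has_field_derivative h' (snd p)) (at (snd p))"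
  shows "cnt.hol T (\<lambda>p. f (fst p, h (snd p)))"
proof (rule cnt.holI[where L = "\<lambda>p v. cnt.Dd f (fst p, h (snd p)) (fst v, h' (snd p) * snd v)"])
  fix p assume p: "p \<in> T"
  have "((\<lambda>p. (fst p, h (snd p))) has_derivative (\<lambda>v. (fst v, h' (snd p) * snd v))) (at p)"
  proof (rule has_derivative_Pair)
    have "(h \<circ> snd has_derivative (*) (h' (snd p)) \<circ> snd) (at p)"
      by (intro diff_chain_at has_derivative_snd[OF has_derivative_ident])
         (use h[OF p] in \<open>simp add: has_field_derivative_def\<close>)
    then show "((\<lambda>p. h (snd p)) has_derivative (\<lambda>v. h' (snd p) * snd v)) (at p)" by (simp add: o_def)
  qed (auto intro!: derivative_eq_intros)
  from diff_chain_at[OF this cnt.hol_has_derivative(1)[OF f S[OF p]]]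
  show "((\<lambda>p. f (fst p, h (snd p))) has_derivative (\<lambda>v. cnt.Dd f (fst p, h (snd p)) (fst v, h' (snd p) * snd v))) (at p)"
    by (simp add: o_def)
  show "cnt.Dd f (fst p, h (snd p)) (fst (smult_pair c v), h' (snd p) * snd (smult_pair c v))
     = c * cnt.Dd f (fst p, h (snd p)) (fst v, h' (snd p) * snd v)" for c v
    using cnt.hol_has_derivative(2)[OF f S[OF p], of c "(fst v, h' (snd p) * snd v)"]
    by (simp add: smult_pair_def mult.left_commute)
qed

lemma hol_snd: "cnt.hol S (\<lambda>p. snd p)"
  by (rule cnt.holI[where L = "\<lambda>_. snd"]) (auto intro!: derivative_eq_intros simp: smult_pair_def)

lemma hol_snd_power: "cnt.hol S (\<lambda>p. snd p ^ j)"
  by (induction j) (auto intro!: cnt.hol_const cnt.hol_mult hol_snd)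

lemma hol_fst:
  assumes f: "cn.hol S f" and S: "\<And>p. p \<in> T \<Longrightarrow> fst p \<in> S"
  shows "cnt.hol T (\<lambda>p. f (fst p))"
proof (rule cnt.holI[where L = "\<lambda>p v. cn.Dd f (fst p) (fst v)"])
  fix p assume p: "p \<in> T"
  have "(f \<circ> fst has_derivative cn.Dd f (fst p) \<circ> fst) (at p)"
    by (intro diff_chain_at has_derivative_fst[OF has_derivative_ident] cn.hol_has_derivative(1)[OF f S[OF p]])
  then show "((\<lambda>p. f (fst p)) has_derivative (\<lambda>v. cn.Dd f (fst p) (fst v))) (at p)" by (simp add: o_def)
  show "cn.Dd f (fst p) (fst (smult_pair c v)) = c * cn.Dd f (fst p) (fst v)" for c v
    using cn.hol_has_derivative(2)[OF f S[OF p]] by (simp add: smult_pair_def)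
qed

lemma hol_snd_line:
  assumes "cnt.hol S f" "(z, s) \<in> S"
  shows "((\<lambda>s. f (z, s)) has_field_derivative cnt.Dd f (z, s) (0, 1)) (at s)"
  using cnt.hol_line[OF assms(1), of "(z, 0)" s "(0, 1)"] assms(2) by (simp add: smult_pair_def)

text \<open>The distance is measured relative to |s|, so the hypothesis says that w / s is near 1,
  where \<open>Arg\<close> is continuous. Angles are existential and not principal values, so no
  direction meets a branch cut.\<close>

lemma angle_perturb:
  assumes e: "e > 0"
  obtains c where "c > 0" and "\<And>s w \<theta>. s \<noteq> 0 \<Longrightarrow> s = of_real (norm s) * cis \<theta> \<Longrightarrow> dist w s < c * norm s \<Longrightarrow>
      w \<noteq> 0 \<and> (\<exists>\<theta>'. \<bar>\<theta>' - \<theta>\<bar> < e \<and> w = of_real (norm w) * cis \<theta>')"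
proof -
  have "isCont Arg 1" by (rule continuous_at_Arg) auto
  then obtain c0 where c0: "c0 > 0" "\<And>x. dist x 1 < c0 \<Longrightarrow> dist (Arg x) (Arg 1) < e"
    using e unfolding continuous_at_eps_delta by (metis dist_norm)
  show ?thesis
  proof (rule that[of "min c0 1"])
    fix s w :: complex and \<theta> assume s: "s \<noteq> 0" "s = of_real (norm s) * cis \<theta>" and w: "dist w s < min c0 1 * norm s"
    define x where "x = w / s"
    have "dist x 1 * norm s = dist w s"
      using s(1) by (simp add: x_def dist_norm norm_mult[symmetric] algebra_simps)
    then have "dist x 1 * norm s < min c0 1 * norm s" using w by simp
    then have d: "dist x 1 < min c0 1" using s(1) by (simp add: mult_less_cancel_right)
    then have x0: "x \<noteq> 0" by (auto simp: dist_norm)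
    have wx: "w = s * x" using s(1) by (simp add: x_def)
    have "\<bar>Arg x\<bar> < e" using c0(2)[of x] d by (simp add: dist_real_def)
    moreover have "w = of_real (norm w) * cis (\<theta> + Arg x)"
    proof -
      have "x = of_real (norm x) * cis (Arg x)" using x0 by (simp add: cis_Arg sgn_eq)
      then have "s * x = (of_real (norm s) * cis \<theta>) * (of_real (norm x) * cis (Arg x))" using s(2) by simp
      then show ?thesis by (simp add: wx norm_mult cis_mult mult_ac)
    qed
    ultimately show "w \<noteq> 0 \<and> (\<exists>\<theta>'. \<bar>\<theta>' - \<theta>\<bar> < e \<and> w = of_real (norm w) * cis \<theta>')"
      using wx s(1) x0 by (intro conjI exI[of _ "\<theta> + Arg x"]) auto
  qed (use c0 in auto)
qed

lemma open_sector: "open (sector d \<epsilon>)"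
  unfolding open_contains_ball
proof
  fix s assume "s \<in> sector d \<epsilon>"
  then obtain \<theta> where s: "s \<noteq> 0" "s = of_real (norm s) * cis \<theta>" and \<theta>: "\<bar>\<theta> - d\<bar> < \<epsilon> / 2"
    by (auto simp: sector_def)
  obtain c where c: "c > 0" "\<And>s w \<theta>'. s \<noteq> 0 \<Longrightarrow> s = of_real (norm s) * cis \<theta>' \<Longrightarrow> dist w s < c * norm s \<Longrightarrow>
    w \<noteq> 0 \<and> (\<exists>\<theta>''. \<bar>\<theta>'' - \<theta>'\<bar> < \<epsilon> / 2 - \<bar>\<theta> - d\<bar> \<and> w = of_real (norm w) * cis \<theta>'')"
    using angle_perturb[of "\<epsilon> / 2 - \<bar>\<theta> - d\<bar>"] \<theta> by auto
  have "ball s (c * norm s) \<subseteq> sector d \<epsilon>"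
  proof
    fix w assume "w \<in> ball s (c * norm s)"
    then have "w \<noteq> 0 \<and> (\<exists>\<theta>''. \<bar>\<theta>'' - \<theta>\<bar> < \<epsilon> / 2 - \<bar>\<theta> - d\<bar> \<and> w = of_real (norm w) * cis \<theta>'')"
      by (intro c(2)[OF s]) (simp add: dist_commute)
    then obtain \<theta>'' where w: "w \<noteq> 0" "\<bar>\<theta>'' - \<theta>\<bar> < \<epsilon> / 2 - \<bar>\<theta> - d\<bar>" "w = of_real (norm w) * cis \<theta>''"
      by blast
    have "\<bar>\<theta>'' - d\<bar> < \<epsilon> / 2" using w(2) by linarith
    then show "w \<in> sector d \<epsilon>" using w unfolding sector_def by blast
  qed
  then show "\<exists>e>0. ball s e \<subseteq> sector d \<epsilon>" using c(1) s(1) by (intro exI[of _ "c * norm s"]) auto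
qed

lemma open_disc_sector: "open (disc_sector d \<epsilon> r)"
  unfolding disc_sector_def by (intro open_Un open_sector open_ball)

lemma disc_sector_mono: "\<epsilon> \<le> \<epsilon>' \<Longrightarrow> r \<le> r' \<Longrightarrow> disc_sector d \<epsilon> r \<subseteq> disc_sector d \<epsilon>' r'"
  unfolding disc_sector_def sector_def by force

text \<open>Keeps averages of f(z, y^2 t) over y in [0, 1] inside the domain: disc-sectors are
  star-shaped about 0.\<close>

lemma disc_sector_scale:
  assumes "t \<in> disc_sector d \<epsilon> r" "0 \<le> c" "c \<le> 1" "r > 0"
  shows "of_real c * t \<in> disc_sector d \<epsilon> r"
proof (cases "c = 0")
  case False
  show ?thesis
  proof (cases "norm t < r")
    case True
    then have "norm (of_real c * t) < r"
      using assms(2,3) mult_left_le_one_le[of "norm t" c] by (simp add: norm_mult)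
    then show ?thesis by (simp add: disc_sector_def)
  next
    case f: False
    then obtain \<theta> where t: "t \<noteq> 0" "\<bar>\<theta> - d\<bar> < \<epsilon> / 2" "t = of_real (norm t) * cis \<theta>"
      using assms(1) by (auto simp: disc_sector_def sector_def)
    have "of_real c * t = of_real (norm (of_real c * t)) * cis \<theta>"
      using assms(2) t(3) by (simp add: norm_mult mult.assoc)
    then show ?thesis using t False unfolding disc_sector_def sector_def by auto
  qed
qed (use assms in \<open>simp add: disc_sector_def\<close>)

text \<open>The gap between the two sectors grows in proportion to |s|, and near the vertex the disc
  takes over; so one margin serves the whole unbounded domain.\<close>

lemma disc_sector_margin:
  assumes \<rho>: "\<rho> > 0"
  obtains \<mu> where "\<mu> > 0" "\<And>s. s \<in> disc_sector d (\<rho> / 2) (\<rho> / 2) \<Longrightarrow> cball s \<mu> \<subseteq> disc_sector d \<rho> \<rho>"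
proof -
  obtain c where c: "c > 0" "\<And>s w \<theta>. s \<noteq> 0 \<Longrightarrow> s = of_real (norm s) * cis \<theta> \<Longrightarrow> dist w s < c * norm s \<Longrightarrow>
      w \<noteq> 0 \<and> (\<exists>\<theta>'. \<bar>\<theta>' - \<theta>\<bar> < \<rho> / 4 \<and> w = of_real (norm w) * cis \<theta>')"
    using angle_perturb[of "\<rho> / 4"] \<rho> by auto
  \<comment> \<open>The first bound serves |s| < \<rho> / 2. For |s| \<ge> \<rho> / 2 the second is
    below c |s|, a distance that changes the angle by less than \<rho> / 4.\<close>
  define \<mu> where "\<mu> = min (\<rho> / 4) (c * \<rho> / 4)"
  have "cball s \<mu> \<subseteq> disc_sector d \<rho> \<rho>" if s: "s \<in> disc_sector d (\<rho> / 2) (\<rho> / 2)" for s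
  proof
    fix w assume w: "w \<in> cball s \<mu>"
    show "w \<in> disc_sector d \<rho> \<rho>"
    proof (cases "norm s < \<rho> / 2")
      case True
      have "norm w \<le> norm s + \<rho> / 4"
        using w norm_triangle_ineq[of s "w - s"] by (simp add: \<mu>_def dist_norm norm_minus_commute)
      then show ?thesis using True \<rho> by (simp add: disc_sector_def)
    next
      case False
      then obtain \<theta> where t: "s \<noteq> 0" "\<bar>\<theta> - d\<bar> < \<rho> / 2 / 2" "s = of_real (norm s) * cis \<theta>"
        using s by (auto simp: disc_sector_def sector_def)
      have "dist w s \<le> c * \<rho> / 4" using w by (simp add: \<mu>_def dist_commute)
      also have "\<dots> < c * norm s"
        using False c(1) \<rho> by simp
      finally have "w \<noteq> 0 \<and> (\<exists>\<theta>'. \<bar>\<theta>' - \<theta>\<bar> < \<rho> / 4 \<and> w = of_real (norm w) * cis \<theta>')"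
        by (rule c(2)[OF t(1,3)])
      then obtain \<theta>' where w: "w \<noteq> 0" "\<bar>\<theta>' - \<theta>\<bar> < \<rho> / 4" "w = of_real (norm w) * cis \<theta>'"
        by blast
      have "\<bar>\<theta>' - d\<bar> < \<rho> / 2" using w(2) t(2) by linarith
      then show ?thesis using w unfolding disc_sector_def sector_def by blast
    qed
  qed
  then show ?thesis using that[of \<mu>] \<rho> c(1) by (simp add: \<mu>_def)
qed

text \<open>A normal form of membership in the spaces of functions of exponential growth on a disc-sector: a single parameter
  for all radii and openings, and one growth bound on the whole domain.\<close>
definition sector_growth :: "real \<Rightarrow> real \<Rightarrow> ((complex^'n) \<times> complex \<Rightarrow> complex) \<Rightarrow> bool" where
  "sector_growth k d F \<longleftrightarrow> (\<exists>\<rho> A B f. 0 < \<rho> \<and> \<rho> \<le> 1 \<and> 0 \<le> A \<and> 0 \<le> B \<and>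
     cnt.hol (ball 0 \<rho> \<times> disc_sector d \<rho> \<rho>) f \<and>
     (\<exists>\<delta>>0. \<forall>z t. norm z < \<delta> \<longrightarrow> norm t < \<delta> \<longrightarrow> f (z, t) = F (z, t)) \<and>
     (\<forall>z t. norm z < \<rho> \<longrightarrow> t \<in> disc_sector d \<rho> \<rho> \<longrightarrow> norm (f (z, t)) \<le> A * exp (B * norm t powr k)))"

text \<open>Half of the least given parameter is strictly smaller than each of them, so the bound
  granted for that one choice covers the whole normalised domain. Conversely, smaller domains
  inherit the bound, and \<rho> \<le> 1 keeps the opening below 2 pi.\<close>

lemma O_sector_iff_sector_growth:
  fixes F :: "(complex^'n) \<times> complex \<Rightarrow> complex"
  shows "O_sector k d F \<longleftrightarrow> sector_growth k d F"
proof
  assume "O_sector k d F"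
  then obtain r r1 \<epsilon> f \<delta> where r: "r > 0" "r1 > 0" "\<epsilon> > 0"
    and f: "cnt.hol (ball 0 r \<times> disc_sector d \<epsilon> r1) f"
    and \<delta>: "\<delta> > 0" "\<forall>z t. norm z < \<delta> \<longrightarrow> norm t < \<delta> \<longrightarrow> f (z, t) = F (z, t)"
    and g: "\<forall>r' r1' \<epsilon>'. r' < r \<longrightarrow> r1' < r1 \<longrightarrow> \<epsilon>' < \<epsilon> \<longrightarrow> (\<exists>A B. \<forall>z t. norm z \<le> r' \<longrightarrow>
           t \<in> disc_sector d \<epsilon>' r1' \<longrightarrow> norm (f (z, t)) \<le> A * exp (B * norm t powr k))"
    unfolding O_sector_def holo_nt_iff_hol by (elim exE conjE) blast
  define \<rho> where "\<rho> = min (min 1 r) (min r1 \<epsilon>) / 2"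
  have \<rho>: "0 < \<rho>" "\<rho> \<le> 1" "\<rho> < r" "\<rho> < r1" "\<rho> < \<epsilon>" using r by (auto simp: \<rho>_def)
  obtain A B where AB: "\<And>z t. norm z \<le> \<rho> \<Longrightarrow> t \<in> disc_sector d \<rho> \<rho> \<Longrightarrow> norm (f (z, t)) \<le> A * exp (B * norm t powr k)"
    using g \<rho> by blast
  show "sector_growth k d F"
    unfolding sector_growth_def
  proof (rule exI[of _ \<rho>], rule exI[of _ "\<bar>A\<bar>"], rule exI[of _ "\<bar>B\<bar>"], rule exI[of _ f], intro conjI)
    show "cnt.hol (ball 0 \<rho> \<times> disc_sector d \<rho> \<rho>) f"
      by (rule cnt.hol_subset[OF f]) (use \<rho> disc_sector_mono[of \<rho> \<epsilon> \<rho> r1 d] in auto)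
    show "\<forall>z t. norm z < \<rho> \<longrightarrow> t \<in> disc_sector d \<rho> \<rho> \<longrightarrow> norm (f (z, t)) \<le> \<bar>A\<bar> * exp (\<bar>B\<bar> * norm t powr k)"
    proof (intro allI impI)
      fix z :: "complex^'n" and t assume "norm z < \<rho>" "t \<in> disc_sector d \<rho> \<rho>"
      then have "norm (f (z, t)) \<le> A * exp (B * norm t powr k)" by (intro AB) auto
      also have "\<dots> \<le> \<bar>A\<bar> * exp (\<bar>B\<bar> * norm t powr k)"
        by (intro mult_mono) (auto intro!: mult_right_mono)
      finally show "norm (f (z, t)) \<le> \<bar>A\<bar> * exp (\<bar>B\<bar> * norm t powr k)" .
    qed
  qed (use \<rho> \<delta> in auto)
next
  assume "sector_growth k d F"
  then obtain \<rho> A B f where \<rho>: "0 < \<rho>" "\<rho> \<le> 1" and f: "cnt.hol (ball 0 \<rho> \<times> disc_sector d \<rho> \<rho>) f"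
    and \<delta>: "\<exists>\<delta>>0. \<forall>z t. norm z < \<delta> \<longrightarrow> norm t < \<delta> \<longrightarrow> f (z, t) = F (z, t)"
    and g: "\<And>z t. norm z < \<rho> \<Longrightarrow> t \<in> disc_sector d \<rho> \<rho> \<Longrightarrow> norm (f (z, t)) \<le> A * exp (B * norm t powr k)"
    unfolding sector_growth_def by blast
  show "O_sector k d F"
    unfolding O_sector_def holo_nt_iff_hol
  proof (rule exI[of _ \<rho>], rule conjI[OF \<rho>(1)], rule exI[of _ \<rho>], rule conjI[OF \<rho>(1)], rule exI[of _ \<rho>], rule conjI[OF \<rho>(1)],
      rule conjI, goal_cases)
    case 1
    show ?case using \<rho>(2) pi_gt3 by simp
  next
    case 2
    show ?case
    proof (rule exI[of _ f], intro conjI f \<delta> allI impI)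
      fix r' r1' \<epsilon>' assume "r' < \<rho>" "r1' < \<rho>" "\<epsilon>' < \<rho>"
      then show "\<exists>A B. \<forall>z t. norm z \<le> r' \<longrightarrow> t \<in> disc_sector d \<epsilon>' r1' \<longrightarrow> norm (f (z, t)) \<le> A * exp (B * norm t powr k)"
        using disc_sector_mono[of \<epsilon>' \<rho> r1' \<rho> d] by (intro exI[of _ A] exI[of _ B] allI impI g) auto
    qed
  qed
qed

lemma sector_growth_cong:
  assumes "\<delta> > 0" "\<And>z t. norm z < \<delta> \<Longrightarrow> norm t < \<delta> \<Longrightarrow> F (z, t) = G (z, t)" "sector_growth k d F"
  shows "sector_growth k d G"
proof -
  obtain \<rho> A B f \<delta>' where *: "0 < \<rho>" "\<rho> \<le> 1" "0 \<le> A" "0 \<le> B"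
    "cnt.hol (ball 0 \<rho> \<times> disc_sector d \<rho> \<rho>) f"
    and \<delta>': "\<delta>' > 0" "\<forall>z t. norm z < \<delta>' \<longrightarrow> norm t < \<delta>' \<longrightarrow> f (z, t) = F (z, t)"
    and g: "\<forall>z t. norm z < \<rho> \<longrightarrow> t \<in> disc_sector d \<rho> \<rho> \<longrightarrow> norm (f (z, t)) \<le> A * exp (B * norm t powr k)"
    using assms(3) unfolding sector_growth_def by (elim exE conjE) blast
  have "\<exists>\<delta>>0. \<forall>z t. norm z < \<delta> \<longrightarrow> norm t < \<delta> \<longrightarrow> f (z, t) = G (z, t)"
    using assms(1,2) \<delta>' by (intro exI[of _ "min \<delta> \<delta>'"]) auto
  then show ?thesis unfolding sector_growth_def using * g by blast
qed

section \<open>Changing the parameter of the series\<close>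

text \<open>Differentiation under the integral sign. The parameter p ranges over several complex
  dimensions, so the derivative is packed into a bounded linear map whose continuity is checked
  direction by direction.\<close>

lemma hol_integral_scale:
  fixes f :: "(complex^'n) \<times> complex \<Rightarrow> complex" and w :: "real \<Rightarrow> real"
  assumes D: "open D" and f: "cnt.hol D f" and w: "continuous_on {0..1} w"
    and sc: "\<And>p y. p \<in> D \<Longrightarrow> y \<in> {0..1} \<Longrightarrow> (fst p, of_real (y\<^sup>2) * snd p) \<in> D"
  shows "cnt.hol D (\<lambda>p. integral {0..1} (\<lambda>y. of_real (w y) * f (fst p, of_real (y\<^sup>2) * snd p)))"
proof -
  define F where "F p y = of_real (w y) * f (fst p, of_real (y\<^sup>2) * snd p)" for p y
  define G where "G p y v = of_real (w y) * cnt.Dd f (fst p, of_real (y\<^sup>2) * snd p) (fst v, of_real (y\<^sup>2) * snd v)" for p y v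
  have hF: "cnt.hol D (\<lambda>p. F p y)" and dF: "p \<in> D \<Longrightarrow> cnt.Dd (\<lambda>p. F p y) p = G p y" if y: "y \<in> {0..1}" for y p
  proof -
    have g: "cnt.hol D (\<lambda>p. f (fst p, of_real (y\<^sup>2) * snd p))"
      by (rule hol_compose_snd[OF f sc[OF _ y], where h' = "\<lambda>_. of_real (y\<^sup>2)"])
        (auto intro!: derivative_eq_intros)
    show "cnt.hol D (\<lambda>p. F p y)" unfolding F_def by (intro cnt.hol_cmult g)
    assume p: "p \<in> D"
    have b: "((\<lambda>p. (fst p, of_real (y\<^sup>2) * snd p)) has_derivative (\<lambda>v. (fst v, of_real (y\<^sup>2) * snd v))) (at p)"
      by (intro has_derivative_Pair has_derivative_fst has_derivative_mult_right has_derivative_snd has_derivative_ident)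
    have "((\<lambda>p. F p y) has_derivative G p y) (at p)"
      unfolding F_def G_def
      using has_derivative_mult_right[OF diff_chain_at[OF b cnt.hol_has_derivative(1)[OF f sc[OF p y]]]]
      by (simp add: o_def)
    then show "cnt.Dd (\<lambda>p. F p y) p = G p y"
      using cnt.hol_has_derivative(1)[OF \<open>cnt.hol D (\<lambda>p. F p y)\<close> p] has_derivative_unique by blast
  qed
  have dm: "((\<lambda>p. F p y) has_derivative G p y) (at p)" "bounded_linear (G p y)"
     "G p y (smult_pair c v) = c * G p y v" if "p \<in> D" "y \<in> {0..1}" for p y c v
    using cnt.hol_has_derivative[OF hF[OF that(2)] that(1)] cnt.linear_Dd[OF hF[OF that(2)] that(1)]
    unfolding dF[OF that(2,1)] by blast+
  have cw: "continuous_on (D \<times> cbox 0 1) (\<lambda>q. w (snd q))"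
    by (rule continuous_on_compose2[OF w]) (auto intro!: continuous_intros)
  have arg: "continuous_on (D \<times> cbox 0 1) (\<lambda>q. h (fst (fst q), of_real ((snd q)\<^sup>2) * snd (fst q)))" if "cnt.hol D h" for h
    by (rule continuous_on_compose2[OF cnt.hol_continuous_on[OF that]])
      (use sc in \<open>auto intro!: continuous_intros\<close>)
  have cF: "continuous_on (D \<times> cbox 0 1) (\<lambda>(p, y). F p y)"
    unfolding F_def split_beta by (intro continuous_intros cw arg f)
  have cG: "continuous_on (D \<times> cbox 0 1) (\<lambda>(p, y). G p y v)" for v
  proof -
    \<comment> \<open>The direction of differentiation depends on y. Split into a fixed vector plus
      y^2 times a fixed vector, it leaves only \<open>Dd f\<close> in fixed directions, which is
      holomorphic and hence continuous.\<close>
    have "continuous_on (D \<times> cbox 0 1) (\<lambda>q. of_real (w (snd q)) *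
       (cnt.Dd f (fst (fst q), of_real ((snd q)\<^sup>2) * snd (fst q)) (fst v, 0)
         + of_real ((snd q)\<^sup>2) * cnt.Dd f (fst (fst q), of_real ((snd q)\<^sup>2) * snd (fst q)) (0, snd v)))"
      by (intro continuous_intros cw arg cnt.hol_Dd[OF D f])
    then show ?thesis
    proof (rule continuous_on_eq)
      fix q assume "q \<in> D \<times> cbox (0::real) 1"
      then have q: "(fst (fst q), of_real ((snd q)\<^sup>2) * snd (fst q)) \<in> D" using sc by auto
      interpret bounded_linear "cnt.Dd f (fst (fst q), of_real ((snd q)\<^sup>2) * snd (fst q))"
        by (rule cnt.linear_Dd[OF f q])
      have "(fst v, of_real ((snd q)\<^sup>2) * snd v) = (fst v, 0) + smult_pair (of_real ((snd q)\<^sup>2)) (0, snd v)"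
        by (simp add: smult_pair_def)
      then show "of_real (w (snd q)) *
       (cnt.Dd f (fst (fst q), of_real ((snd q)\<^sup>2) * snd (fst q)) (fst v, 0)
         + of_real ((snd q)\<^sup>2) * cnt.Dd f (fst (fst q), of_real ((snd q)\<^sup>2) * snd (fst q)) (0, snd v)) = (\<lambda>(p, y). G p y v) q"
        by (simp only: G_def split_beta add cnt.hol_has_derivative(2)[OF f q])
    qed
  qed
  show ?thesis
  proof (rule cnt.holI[where L = "\<lambda>p v. integral {0..1} (\<lambda>y. G p y v)"])
    fix p assume "p \<in> D"
    then obtain e where e: "e > 0" "ball p e \<subseteq> D" using D openE by blast
    define fx where "fx q y = (if q \<in> D \<and> y \<in> {0..1} then Blinfun (G q y) else 0)" for q y
    have fx: "blinfun_apply (fx q y) = G q y" if "q \<in> D" "y \<in> {0..1}" for q y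
      using that dm(2) by (simp add: fx_def bounded_linear_Blinfun_apply)
    have cfx: "continuous_on (ball p e \<times> cbox 0 1) (\<lambda>(q, y). fx q y)"
    proof (rule continuous_on_blinfun_componentwise)
      fix i :: "(complex^'n) \<times> complex"
      have "continuous_on (ball p e \<times> cbox 0 1) (\<lambda>(q, y). G q y i)"
        by (rule continuous_on_subset[OF cG]) (use e in auto)
      then show "continuous_on (ball p e \<times> cbox 0 1) (\<lambda>x. blinfun_apply (case x of (q, y) \<Rightarrow> fx q y) i)"
        by (rule continuous_on_eq) (use e fx in auto)
    qed
    have pe: "p \<in> ball p e" using e by simp
    have cp: "continuous_on (cbox 0 1) (fx p)"
    proof -
      have "continuous_on (cbox 0 1) (\<lambda>y. (\<lambda>(q, y). fx q y) (p, y))"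
        by (rule continuous_on_compose2[OF cfx]) (use pe in \<open>auto intro!: continuous_intros\<close>)
      then show ?thesis by simp
    qed
    have "((\<lambda>q. integral (cbox 0 1) (F q)) has_derivative blinfun_apply (integral (cbox 0 1) (fx p))) (at p within ball p e)"
    proof (rule leibniz_rule[OF _ _ cfx pe convex_ball])
      show "((\<lambda>q. F q y) has_derivative blinfun_apply (fx q y)) (at q within ball p e)"
        if "q \<in> ball p e" "y \<in> cbox 0 1" for q y
      proof -
        have q: "q \<in> D" "y \<in> {0..1}" using that e by auto
        show ?thesis using dm(1)[OF q] fx[OF q] by (simp add: has_derivative_at_withinI)
      qed
      show "F q integrable_on cbox 0 1" if "q \<in> ball p e" for q
      proof -
        have "continuous_on (cbox 0 1) (\<lambda>y. (\<lambda>(p, y). F p y) (q, y))"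
          by (rule continuous_on_compose2[OF cF]) (use that e in \<open>auto intro!: continuous_intros\<close>)
        then show ?thesis by (intro integrable_continuous) simp
      qed
    qed
    moreover have "blinfun_apply (integral (cbox 0 1) (fx p)) = (\<lambda>v. integral {0..1} (\<lambda>y. G p y v))"
    proof
      fix v
      have "blinfun_apply (integral (cbox 0 1) (fx p)) v = integral (cbox 0 1) (\<lambda>y. blinfun_apply (fx p y) v)"
        by (rule blinfun_apply_integral) (rule integrable_continuous[OF cp])
      also have "\<dots> = integral {0..1} (\<lambda>y. G p y v)"
        unfolding cbox_interval by (rule integral_cong) (simp add: fx[OF \<open>p \<in> D\<close>])
      finally show "blinfun_apply (integral (cbox 0 1) (fx p)) v = integral {0..1} (\<lambda>y. G p y v)" .
    qed
    ultimately have "((\<lambda>q. integral (cbox 0 1) (F q)) has_derivative (\<lambda>v. integral {0..1} (\<lambda>y. G p y v))) (at p)"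
      using at_within_open[OF pe open_ball] by simp
    then show "((\<lambda>p. integral {0..1} (\<lambda>y. of_real (w y) * f (fst p, of_real (y\<^sup>2) * snd p))) has_derivative (\<lambda>v. integral {0..1} (\<lambda>y. G p y v))) (at p)"
      by (simp add: F_def[abs_def])
    show "integral {0..1} (\<lambda>y. G p y (smult_pair c v)) = c * integral {0..1} (\<lambda>y. G p y v)" for c v
    proof -
      have "integral {0..1} (\<lambda>y. G p y (smult_pair c v)) = integral {0..1} (\<lambda>y. c * G p y v)"
        by (rule integral_cong) (rule dm(3)[OF \<open>p \<in> D\<close>])
      then show ?thesis by (simp only: Henstock_Kurzweil_Integration.integral_mult_right)
    qed
  qed
qed

text \<open>\<open>c j\<close> is half the Beta function at (m/2 + j, 3/2). Only its ratio to
  \<open>c 0\<close> matters, and that follows from a two-term recursion obtained by integrating a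
  derivative.\<close>

lemma integral_power_sqrt:
  fixes m :: nat
  assumes m: "m \<ge> 1"
  defines "c \<equiv> \<lambda>j. integral {0..1} (\<lambda>y::real. y ^ (m - 1) * sqrt (1 - y\<^sup>2) * y ^ (2 * j))"
  shows "c 0 > 0" and "c j * pochhammer (real m / 2 + 3 / 2) j = c 0 * pochhammer (real m / 2) j"
proof -
  have ct: "continuous_on {0..1} (\<lambda>y::real. y ^ (m - 1) * sqrt (1 - y\<^sup>2) * y ^ (2 * j))" for j
    by (intro continuous_intros)
  have sq: "0 \<le> 1 - y\<^sup>2" if "y \<in> {0..1}" for y :: real using that by (simp add: power_le_one)
  have nn: "c 0 \<ge> 0"
    unfolding c_def by (rule Henstock_Kurzweil_Integration.integral_nonneg) (use sq integrable_continuous_real[OF ct[of 0]] in auto)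
  have "c 0 \<noteq> 0"
  proof
    assume "c 0 = 0"
    then have "((\<lambda>y::real. y ^ (m - 1) * sqrt (1 - y\<^sup>2)) has_integral 0) (cbox 0 1)"
      using integrable_integral[OF integrable_continuous_real[OF ct[of 0]]] by (simp add: c_def)
    \<comment> \<open>A nonnegative continuous integrand with integral 0 vanishes at every point; at
      1/2 this one does not.\<close>
    then have "(1/2::real) ^ (m - 1) * sqrt (1 - (1/2)\<^sup>2) = 0"
      by (rule has_integral_0_cbox_imp_0[rotated 2]) (use ct[of 0] sq in auto)
    moreover have "sqrt (1 - (1/2)\<^sup>2) > (0::real)" by (simp add: power2_eq_square)
    ultimately show False by simp
  qed
  with nn show "c 0 > 0" by simp
  have rec: "real (m + 2 * j) * c j = real (m + 2 * j + 3) * c (Suc j)" for j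
  proof -
    define k where "k = m + 2 * j"
    have k: "k \<ge> 1" "m - 1 + 2 * j = k - 1" "m - 1 + 2 * Suc j = k + 1" using m by (auto simp: k_def)
    \<comment> \<open>y^k (1 - y^2)^(3/2) vanishes at both ends of the interval, and its derivative
      is a combination of the integrands for j and j + 1.\<close>
    define f where "f y = y ^ k * (1 - y\<^sup>2) * sqrt (1 - y\<^sup>2)" for y :: real
    define f' where "f' y = real k * (y ^ (k - 1) * sqrt (1 - y\<^sup>2)) - real (k + 3) * (y ^ (k + 1) * sqrt (1 - y\<^sup>2))" for y :: real
    have "(f' has_integral (f 1 - f 0)) {0..1}"
    proof (rule fundamental_theorem_of_calculus_interior)
      show "continuous_on {0..1} f" unfolding f_def by (intro continuous_intros)
      fix y :: real assume y: "y \<in> {0<..<1}"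
      then have p: "1 - y\<^sup>2 > 0" by (simp add: power_less_one_iff abs_square_less_1)
      have s2: "(1 - y\<^sup>2) / sqrt (1 - y\<^sup>2) = sqrt (1 - y\<^sup>2)" using p by (simp add: real_div_sqrt)
      have "(f has_real_derivative (real k * y ^ (k - 1) * (1 - y\<^sup>2) + y ^ k * (- (2 * y))) * sqrt (1 - y\<^sup>2)
         + y ^ k * (1 - y\<^sup>2) * (- (2 * y) / (2 * sqrt (1 - y\<^sup>2)))) (at y)"
        unfolding f_def using p by (auto intro!: derivative_eq_intros simp: divide_simps)
      also have "y ^ k * (1 - y\<^sup>2) * (- (2 * y) / (2 * sqrt (1 - y\<^sup>2))) = - y * y ^ k * ((1 - y\<^sup>2) / sqrt (1 - y\<^sup>2))"
        by simp
      also have "(real k * y ^ (k - 1) * (1 - y\<^sup>2) + y ^ k * (- (2 * y))) * sqrt (1 - y\<^sup>2) + - y * y ^ k * ((1 - y\<^sup>2) / sqrt (1 - y\<^sup>2)) = f' y"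
      proof -
        obtain l where l: "k = Suc l" using k(1) by (cases k) auto
        show ?thesis unfolding s2 f'_def l by (simp add: algebra_simps power2_eq_square)
      qed
      finally show "(f has_vector_derivative f' y) (at y)"
        by (simp add: has_real_derivative_iff_has_vector_derivative)
    qed simp
    then have 0: "(f' has_integral 0) {0..1}" using k(1) by (simp add: f_def zero_power)
    have 1: "((\<lambda>y. y ^ (k - 1) * sqrt (1 - y\<^sup>2)) has_integral c j) {0..1}"
    proof -
      have "(\<lambda>y::real. y ^ (m - 1) * sqrt (1 - y\<^sup>2) * y ^ (2 * j)) = (\<lambda>y. y ^ (k - 1) * sqrt (1 - y\<^sup>2))"
        unfolding k(2)[symmetric] power_add by (simp add: mult_ac)
      then show ?thesis using integrable_integral[OF integrable_continuous_real[OF ct[of j]]] by (simp add: c_def)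
    qed
    have 2: "((\<lambda>y. y ^ (k + 1) * sqrt (1 - y\<^sup>2)) has_integral c (Suc j)) {0..1}"
    proof -
      have "(\<lambda>y::real. y ^ (m - 1) * sqrt (1 - y\<^sup>2) * y ^ (2 * Suc j)) = (\<lambda>y. y ^ (k + 1) * sqrt (1 - y\<^sup>2))"
        unfolding k(3)[symmetric] power_add by (simp add: mult_ac)
      then show ?thesis using integrable_integral[OF integrable_continuous_real[OF ct[of "Suc j"]]] unfolding c_def by simp
    qed
    have "(f' has_integral (real k * c j - real (k + 3) * c (Suc j))) {0..1}"
      unfolding f'_def by (intro has_integral_diff has_integral_mult_right 1 2)
    with 0 have "real k * c j - real (k + 3) * c (Suc j) = 0" by (rule has_integral_unique[rotated])
    then show ?thesis by (simp add: k_def)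
  qed
  show "c j * pochhammer (real m / 2 + 3 / 2) j = c 0 * pochhammer (real m / 2) j"
  proof (induction j)
    case (Suc j)
    have "c (Suc j) * pochhammer (real m / 2 + 3 / 2) (Suc j) = (real (m + 2 * j + 3) * c (Suc j)) / 2 * pochhammer (real m / 2 + 3 / 2) j"
      by (simp add: pochhammer_Suc field_simps)
    also have "\<dots> = real (m + 2 * j) / 2 * (c j * pochhammer (real m / 2 + 3 / 2) j)"
      unfolding rec[of j, symmetric] by simp
    also have "\<dots> = c 0 * pochhammer (real m / 2) (Suc j)"
      unfolding Suc by (simp add: pochhammer_Suc field_simps)
    finally show ?case .
  qed simp
qed


text \<open>W_a for an arbitrary coefficient sequence. Where the series diverges
  \<open>suminf\<close> carries no information, so continuations to sectors are separate functions
  that agree with it near 0.\<close>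

definition pseries :: "(nat \<Rightarrow> complex^'n \<Rightarrow> complex) \<Rightarrow> real \<Rightarrow> (complex^'n) \<times> complex \<Rightarrow> complex" where
  "pseries u a = (\<lambda>(z, s). \<Sum>j. u j z / of_real (pochhammer a j) * s ^ j)"

text \<open>All that the equation contributes to the growth questions: holomorphic coefficients with
  at most factorial growth in j, uniformly near z = 0.\<close>

locale growth_coeffs =
  fixes u :: "nat \<Rightarrow> complex^'n \<Rightarrow> complex" and r0 K M :: real
  assumes r0: "r0 > 0" and K: "K \<ge> 1" and M: "M \<ge> 0"
    and hol_u: "\<And>j. cn.hol (ball 0 r0) (u j)"
    and u_le: "\<And>z j. norm z < r0 \<Longrightarrow> norm (u j z) \<le> M * K ^ j * fact j"
begin

text \<open>Half of the radius that the coefficient bound guarantees, so that the j-th term is at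
  most M / 2^j.\<close>

definition Rad :: "real \<Rightarrow> real" where "Rad a = 1 / (2 * (K * max 1 (1 / a)))"

lemma Rad_pos: "Rad a > 0"
  using K by (simp add: Rad_def)

lemma coeff_le:
  assumes "a > 0" "norm z < r0"
  shows "norm (u j z / of_real (pochhammer a j)) \<le> M * (K * max 1 (1 / a)) ^ j"
proof -
  have p: "pochhammer a j > 0" using assms(1) by (rule pochhammer_pos)
  have "norm (u j z) \<le> M * K ^ j * pochhammer 1 j"
    using u_le[OF assms(2), of j] by (simp add: pochhammer_fact)
  also have "\<dots> \<le> M * K ^ j * (max 1 (1 / a) ^ j * pochhammer a j)"
    using M K assms(1) by (intro mult_left_mono pochhammer_le) auto
  finally show ?thesis using p by (simp add: norm_divide power_mult_distrib field_simps)
qed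

lemma term_le:
  assumes "a > 0" "norm z < r0" "norm s < Rad a"
  shows "norm (u j z / of_real (pochhammer a j) * s ^ j) \<le> M * (1 / 2) ^ j"
proof -
  let ?C = "K * max 1 (1 / a)"
  have C: "?C > 0" using K by simp
  have "norm (u j z / of_real (pochhammer a j) * s ^ j) \<le> (M * ?C ^ j) * norm s ^ j"
    unfolding norm_mult norm_power by (intro mult_right_mono coeff_le assms) auto
  also have "\<dots> = M * (?C * norm s) ^ j" by (simp only: power_mult_distrib mult.assoc)
  also have "\<dots> \<le> M * (1 / 2) ^ j"
  proof (intro mult_left_mono power_mono)
    show "?C * norm s \<le> 1 / 2" using assms(3) C by (simp add: Rad_def field_simps)
    show "0 \<le> ?C * norm s" using K by (intro mult_nonneg_nonneg) auto
  qed (rule M)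
  finally show ?thesis .
qed

lemma summable_half: "summable (\<lambda>j. M * (1 / 2) ^ j)"
  by (intro summable_mult summable_geometric) simp

lemma pseries_sums:
  assumes "a > 0" "norm z < r0" "norm s < Rad a"
  shows "(\<lambda>j. u j z / of_real (pochhammer a j) * s ^ j) sums pseries u a (z, s)"
  unfolding pseries_def split_conv
  by (intro summable_sums summable_comparison_test[OF _ summable_half] exI[of _ 0] allI impI term_le assms)

lemma hol_term: "cnt.hol (ball 0 r0 \<times> T) (\<lambda>p. u j (fst p) / of_real (pochhammer a j) * snd p ^ j)"
proof -
  have "cnt.hol (ball 0 r0 \<times> T) (\<lambda>p. of_real (1 / pochhammer a j) * (u j (fst p) * snd p ^ j))"
    by (intro cnt.hol_cmult cnt.hol_mult hol_snd_power hol_fst[OF hol_u]) auto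
  then show ?thesis by simp
qed

lemma hol_pseries:
  assumes "a > 0"
  shows "cnt.hol (ball 0 r0 \<times> ball 0 (Rad a)) (pseries u a)"
proof -
  have "cnt.hol (ball 0 r0 \<times> ball 0 (Rad a)) (\<lambda>p. \<Sum>j. u j (fst p) / of_real (pochhammer a j) * snd p ^ j)"
    by (rule cnt.hol_suminf[OF _ hol_term _ summable_half]) (use term_le[OF assms] in \<open>auto intro: open_Times\<close>)
  then show ?thesis by (simp add: pseries_def case_prod_beta')
qed

text \<open>The step is \<open>3/2\<close> and not \<open>1/2\<close> because the kernel for \<open>1/2\<close> is singular at \<open>y = 1\<close>; together with the unit steps down
  both reach all half-integers.\<close>
lemma pseries_raise:
  fixes m :: nat
  assumes m: "m \<ge> 1" and g: "sector_growth 1 d (pseries u (real m / 2))"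
  shows "sector_growth 1 d (pseries u (real (m + 3) / 2))"
proof -
  define a where "a = real m / 2"
  have a: "a > 0" using m by (simp add: a_def)
  have a3: "real (m + 3) / 2 = a + 3 / 2" by (simp add: a_def)
  obtain \<rho> A B f \<delta> where \<rho>: "0 < \<rho>" "\<rho> \<le> 1" and AB: "0 \<le> A" "0 \<le> B"
    and f: "cnt.hol (ball 0 \<rho> \<times> disc_sector d \<rho> \<rho>) f"
    and \<delta>: "\<delta> > 0" "\<And>z t. norm z < \<delta> \<Longrightarrow> norm t < \<delta> \<Longrightarrow> f (z, t) = pseries u a (z, t)"
    and gr: "\<And>z t. norm z < \<rho> \<Longrightarrow> t \<in> disc_sector d \<rho> \<rho> \<Longrightarrow> norm (f (z, t)) \<le> A * exp (B * norm t powr 1)"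
    using g unfolding sector_growth_def a_def by (elim exE conjE) blast
  define w where "w y = y ^ (m - 1) * sqrt (1 - y\<^sup>2)" for y :: real
  define c where "c j = integral {0..1} (\<lambda>y::real. w y * y ^ (2 * j))" for j
  have c0: "c 0 > 0" and cj: "c j * pochhammer (a + 3 / 2) j = c 0 * pochhammer a j" for j
    using integral_power_sqrt[OF m] unfolding c_def w_def a_def by auto
  have cw: "continuous_on {0..1} w" unfolding w_def by (intro continuous_intros)
  have w01: "0 \<le> w y" "w y \<le> 1" if "y \<in> {0..1}" for y
  proof -
    have "y\<^sup>2 \<le> 1" "0 \<le> y" "y \<le> 1" using that by (auto simp: power_le_one)
    then show "0 \<le> w y" "w y \<le> 1"
      unfolding w_def by (auto intro!: mult_le_one power_le_one)
  qed
  have y2: "0 \<le> y\<^sup>2" "y\<^sup>2 \<le> 1" if "y \<in> {0..1}" for y :: real using that by (auto simp: power_le_one)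
  let ?D = "ball (0::complex^'n) \<rho> \<times> disc_sector d \<rho> \<rho>"
  let ?I = "\<lambda>p. integral {0..1} (\<lambda>y. of_real (w y) * f (fst p, of_real (y\<^sup>2) * snd p))"
  have dsc: "(fst p, of_real (y\<^sup>2) * snd p) \<in> ?D" if "p \<in> ?D" "y \<in> {0..1}" for p y
    using that disc_sector_scale[OF _ y2[OF that(2)] \<rho>(1), of "snd p" d \<rho>] by auto
  have I: "cnt.hol ?D ?I"
    by (rule hol_integral_scale[OF _ f cw dsc]) (auto intro: open_Times open_disc_sector)
  define \<delta>' where "\<delta>' = min (min \<delta> r0) (min (Rad a) (Rad (a + 3 / 2)))"
  have \<delta>': "\<delta>' > 0" using \<delta>(1) r0 Rad_pos by (simp add: \<delta>'_def)
  \<comment> \<open>Termwise integration turns y^(2j) into \<open>c j\<close>, and c_j / c_0 = (a)_j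
    / (a + 3/2)_j exchanges the Pochhammer symbols.\<close>
  have near: "of_real (1 / c 0) * ?I (z, s) = pseries u (a + 3 / 2) (z, s)" if zs: "norm z < \<delta>'" "norm s < \<delta>'" for z s
  proof -
    let ?t = "\<lambda>j. u j z / of_real (pochhammer a j) * s ^ j"
    have zs': "norm z < r0" "norm s < Rad a" "norm s < Rad (a + 3 / 2)" "norm z < \<delta>" "norm s < \<delta>"
      using zs by (auto simp: \<delta>'_def)
    have ys: "norm (of_real (y\<^sup>2) * s) \<le> norm s" if "y \<in> {0..1}" for y :: real
      using y2[OF that] mult_left_le_one_le[of "norm s" "y\<^sup>2"] by (simp add: norm_mult norm_power)
    have s: "(\<lambda>j. integral {0..1} (\<lambda>y. of_real (w y) * (?t j * of_real y ^ (2 * j)))) sums ?I (z, s)"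
    proof (rule integral_sums_dominated[where C = "\<lambda>j. M * (1 / 2) ^ j"])
      show "(\<lambda>y. of_real (w y) * (?t j * of_real y ^ (2 * j))) integrable_on {0..1}" for j
        by (intro integrable_continuous_real continuous_intros cw)
      show "norm (of_real (w y) * (?t j * of_real y ^ (2 * j))) \<le> M * (1 / 2) ^ j" if "y \<in> {0..1}" for j y
      proof -
        have "norm (of_real (w y) * (?t j * of_real y ^ (2 * j))) = norm (?t j) * (w y * y ^ (2 * j))"
          using w01[OF that] that by (simp add: norm_mult norm_power norm_divide)
        also have "\<dots> \<le> M * (1 / 2) ^ j * 1"
          using that w01[OF that] M
          by (intro mult_mono term_le a zs' mult_le_one) (auto intro!: power_le_one)
        finally show ?thesis by simp
      qed
      show "(\<lambda>j. of_real (w y) * (?t j * of_real y ^ (2 * j))) sums (of_real (w y) * f (fst (z, s), of_real (y\<^sup>2) * snd (z, s)))"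
        if "y \<in> {0..1}" for y
      proof (rule sums_mult)
        have n: "norm (of_real (y\<^sup>2) * s) < Rad a" "norm (of_real (y\<^sup>2) * s) < \<delta>"
          using ys[OF that] zs' by auto
        show "(\<lambda>j. ?t j * of_real y ^ (2 * j)) sums f (fst (z, s), of_real (y\<^sup>2) * snd (z, s))"
        proof -
          have "?t j * of_real y ^ (2 * j) = u j z / of_real (pochhammer a j) * (of_real (y\<^sup>2) * s) ^ j" for j
            by (simp add: power_mult_distrib power_mult[of _ 2 j])
          then show ?thesis
            using pseries_sums[OF a zs'(1) n(1)] \<delta>(2)[OF zs'(4) n(2)] by (simp only: fst_conv snd_conv)
        qed
      qed
    qed (use M summable_half in \<open>auto intro!: integrable_continuous_real\<close>)
    have e: "integral {0..1} (\<lambda>y. of_real (w y) * (?t j * of_real y ^ (2 * j))) = ?t j * of_real (c j)" for j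
    proof -
      have "((\<lambda>y. w y * y ^ (2 * j)) has_integral c j) {0..1}"
        unfolding c_def by (intro integrable_integral integrable_continuous_real continuous_intros cw)
      from has_integral_mult_right[OF has_integral_linear[OF this bounded_linear_of_real[where 'a = complex]], of "?t j"]
      show ?thesis by (intro integral_unique) (simp add: o_def mult_ac)
    qed
    have "(\<lambda>j. of_real (1 / c 0) * (?t j * of_real (c j))) sums (of_real (1 / c 0) * ?I (z, s))"
      using sums_mult[OF s, of "of_real (1 / c 0)"] unfolding e .
    moreover have "of_real (1 / c 0) * (?t j * of_real (c j)) = u j z / of_real (pochhammer (a + 3 / 2) j) * s ^ j" for j
    proof -
      have "pochhammer a j > 0" "pochhammer (a + 3 / 2) j > 0" using a by (auto intro!: pochhammer_pos)
      then have "c j / c 0 / pochhammer a j = 1 / pochhammer (a + 3 / 2) j"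
        using cj[of j] c0 by (simp add: field_simps)
      then have "complex_of_real (c j / c 0 / pochhammer a j) = of_real (1 / pochhammer (a + 3 / 2) j)" by simp
      then have "u j z * s ^ j * complex_of_real (c j / c 0 / pochhammer a j) = u j z * s ^ j * of_real (1 / pochhammer (a + 3 / 2) j)"
        by simp
      then show ?thesis by (simp add: field_simps)
    qed
    ultimately have "(\<lambda>j. u j z / of_real (pochhammer (a + 3 / 2) j) * s ^ j) sums (of_real (1 / c 0) * ?I (z, s))" by simp
    moreover have "(\<lambda>j. u j z / of_real (pochhammer (a + 3 / 2) j) * s ^ j) sums pseries u (a + 3 / 2) (z, s)"
      using a zs' by (intro pseries_sums) auto
    ultimately show ?thesis by (rule sums_unique2)
  qed
  show ?thesis
    unfolding sector_growth_def a3
  proof (rule exI[of _ \<rho>], rule exI[of _ "1 / c 0 * A"], rule exI[of _ B], rule exI[of _ "\<lambda>p. of_real (1 / c 0) * ?I p"],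
      intro conjI \<rho> AB)
    show "0 \<le> 1 / c 0 * A" using c0 AB by simp
    show "cnt.hol ?D (\<lambda>p. of_real (1 / c 0) * ?I p)" by (intro cnt.hol_cmult I)
    show "\<exists>\<delta>>0. \<forall>z t. norm z < \<delta> \<longrightarrow> norm t < \<delta> \<longrightarrow> of_real (1 / c 0) * ?I (z, t) = pseries u (a + 3 / 2) (z, t)"
      using near \<delta>' by blast
    show "\<forall>z t. norm z < \<rho> \<longrightarrow> t \<in> disc_sector d \<rho> \<rho> \<longrightarrow>
      norm (of_real (1 / c 0) * ?I (z, t)) \<le> 1 / c 0 * A * exp (B * norm t powr 1)"
    proof (intro allI impI)
      fix z :: "complex^'n" and t assume zt: "norm z < \<rho>" "t \<in> disc_sector d \<rho> \<rho>"
      \<comment> \<open>The argument y^2 t only moves towards 0 and the kernel lies between 0 and 1,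
        so the bound of f is inherited with the same A and B.\<close>
      have "norm (?I (z, t)) \<le> integral {0..1} (\<lambda>y::real. A * exp (B * norm t powr 1))"
      proof (rule integral_norm_bound_integral)
        have "continuous_on {0..1} (\<lambda>y. f (z, of_real (y\<^sup>2) * t))"
          by (rule continuous_on_compose2[OF cnt.hol_continuous_on[OF f]])
            (use dsc[of "(z, t)"] zt in \<open>auto intro!: continuous_intros\<close>)
        then show "(\<lambda>y. of_real (w y) * f (fst (z, t), of_real (y\<^sup>2) * snd (z, t))) integrable_on {0..1}"
          by (auto intro!: integrable_continuous_real continuous_intros cw)
        fix y :: real assume y: "y \<in> {0..1}"
        have "norm (f (z, of_real (y\<^sup>2) * t)) \<le> A * exp (B * norm (of_real (y\<^sup>2) * t) powr 1)"
          using dsc[of "(z, t)" y] zt y by (intro gr) auto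
        also have "\<dots> \<le> A * exp (B * norm t powr 1)"
          using y2[OF y] mult_left_le_one_le[of "norm t" "y\<^sup>2"] AB
          by (intro mult_left_mono) (auto simp: norm_mult norm_power intro!: mult_left_mono)
        finally have "w y * norm (f (z, of_real (y\<^sup>2) * t)) \<le> 1 * (A * exp (B * norm t powr 1))"
          using w01[OF y] AB by (intro mult_mono) auto
        then show "norm (of_real (w y) * f (fst (z, t), of_real (y\<^sup>2) * snd (z, t))) \<le> A * exp (B * norm t powr 1)"
          using w01[OF y] by (simp add: norm_mult)
      qed auto
      then have "norm (?I (z, t)) \<le> A * exp (B * norm t powr 1)" by simp
      then show "norm (of_real (1 / c 0) * ?I (z, t)) \<le> 1 / c 0 * A * exp (B * norm t powr 1)"
        using c0 unfolding norm_mult norm_of_real by (simp add: divide_right_mono)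
    qed
  qed
qed

text \<open>Since (1 + j/a) / (a + 1)_j = 1 / (a)_j, the operator 1 + (s/a) d/ds lowers the
  parameter. Cauchy's estimate on balls of fixed radius bounds the derivative with the same B, and
  the factor |s| is absorbed by exp |s|, which raises B by 1.\<close>

lemma pseries_lower:
  assumes a: "a > 0" and g: "sector_growth 1 d (pseries u (a + 1))"
  shows "sector_growth 1 d (pseries u a)"
proof -
  obtain \<rho> A B f \<delta> where \<rho>: "0 < \<rho>" "\<rho> \<le> 1" and AB: "0 \<le> A" "0 \<le> B"
    and f: "cnt.hol (ball 0 \<rho> \<times> disc_sector d \<rho> \<rho>) f"
    and \<delta>: "\<delta> > 0" "\<And>z t. norm z < \<delta> \<Longrightarrow> norm t < \<delta> \<Longrightarrow> f (z, t) = pseries u (a + 1) (z, t)"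
    and gr: "\<And>z t. norm z < \<rho> \<Longrightarrow> t \<in> disc_sector d \<rho> \<rho> \<Longrightarrow> norm (f (z, t)) \<le> A * exp (B * norm t powr 1)"
    using g unfolding sector_growth_def by (elim exE conjE) blast
  let ?D = "ball (0::complex^'n) \<rho> \<times> disc_sector d \<rho> \<rho>"
  let ?D' = "ball (0::complex^'n) (\<rho> / 2) \<times> disc_sector d (\<rho> / 2) (\<rho> / 2)"
  have oD: "open ?D" by (intro open_Times open_disc_sector open_ball)
  have sub: "?D' \<subseteq> ?D" using \<rho> disc_sector_mono[of "\<rho> / 2" \<rho> "\<rho> / 2" \<rho> d] by auto
  obtain \<mu>0 where \<mu>0: "\<mu>0 > 0" "\<And>s. s \<in> disc_sector d (\<rho> / 2) (\<rho> / 2) \<Longrightarrow> cball s \<mu>0 \<subseteq> disc_sector d \<rho> \<rho>"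
    using disc_sector_margin[OF \<rho>(1)] by metis
  \<comment> \<open>\<mu>0 is the margin in s, and \<rho> / 4 fits between the radii \<rho> / 2 and
    \<rho> in z.\<close>
  define \<mu> where "\<mu> = min \<mu>0 (\<rho> / 4)"
  have \<mu>: "\<mu> > 0" using \<mu>0 \<rho> by (simp add: \<mu>_def)
  define G where "G p = f p + of_real (1 / a) * (snd p * cnt.Dd f p (0, 1))" for p
  have hG: "cnt.hol ?D' G"
    by (rule cnt.hol_subset[OF _ sub], unfold G_def)
      (intro cnt.hol_add cnt.hol_cmult cnt.hol_mult hol_snd f cnt.hol_Dd oD)
  have cb: "cball (z, s) \<mu> \<subseteq> ?D" if zs: "(z, s) \<in> ?D'" for z s
  proof
    fix p assume p: "p \<in> cball (z, s) \<mu>"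
    have 1: "dist z (fst p) \<le> \<mu>" "dist s (snd p) \<le> \<mu>"
      using p dist_fst_le[of "(z, s)" p] dist_snd_le[of "(z, s)" p] by auto
    have "norm (fst p) \<le> norm z + \<mu>"
      using 1(1) norm_triangle_ineq[of z "fst p - z"] by (simp add: dist_norm norm_minus_commute)
    also have "\<dots> < \<rho>" using zs \<rho> by (auto simp: \<mu>_def)
    finally have "fst p \<in> ball 0 \<rho>" by simp
    moreover have "snd p \<in> cball s \<mu>0" using 1(2) by (simp add: \<mu>_def)
    ultimately show "p \<in> ?D" using \<mu>0(2)[of s] zs by (cases p) auto
  qed
  have dle: "norm (cnt.Dd f (z, s) (0, 1)) \<le> A * exp (B * \<mu>) / \<mu> * exp (B * norm s)" if zs: "(z, s) \<in> ?D'" for z s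
  proof -
    have "norm (cnt.Dd f (z, s) (0, 1)) \<le> A * exp (B * (norm s + \<mu>)) / \<mu> * norm ((0::complex^'n), (1::complex))"
    proof (rule cnt.norm_Dd_le[OF f cb[OF zs] \<mu>])
      fix p assume p: "p \<in> cball (z, s) \<mu>"
      have "dist s (snd p) \<le> \<mu>" using p dist_snd_le[of "(z, s)" p] by auto
      then have n: "norm (snd p) \<le> norm s + \<mu>"
        using norm_triangle_ineq[of s "snd p - s"] by (simp add: dist_norm norm_minus_commute)
      have "p \<in> ?D" using cb[OF zs] p by blast
      then have "norm (f p) \<le> A * exp (B * norm (snd p) powr 1)" using gr[of "fst p" "snd p"] by auto
      also have "\<dots> \<le> A * exp (B * (norm s + \<mu>))" using AB n by (auto intro!: mult_left_mono)
      finally show "norm (f p) \<le> A * exp (B * (norm s + \<mu>))" .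
    qed
    then show ?thesis by (simp add: norm_prod_def distrib_left exp_add mult_ac)
  qed
  define \<delta>' where "\<delta>' = min (min \<delta> r0) (min (min (Rad a) (Rad (a + 1))) \<rho>)"
  have \<delta>': "\<delta>' > 0" using \<delta>(1) r0 Rad_pos \<rho> by (simp add: \<delta>'_def)
  have near: "G (z, s) = pseries u a (z, s)" if zs: "norm z < \<delta>'" "norm s < \<delta>'" for z s
  proof -
    let ?c = "\<lambda>j. u j z / of_real (pochhammer (a + 1) j)"
    have zs': "norm z < r0" "norm s < Rad a" "norm z < \<delta>" "norm z < \<rho>" "norm s < \<rho>"
      using zs by (auto simp: \<delta>'_def)
    have ser: "(\<lambda>j. ?c j * t ^ j) sums f (z, t)" if t: "norm t < \<delta>'" for t
      using pseries_sums[of "a + 1" z t] \<delta>(2)[OF zs'(3), of t] a zs'(1) t by (auto simp: \<delta>'_def)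
    have "(\<lambda>j. of_nat j * ?c j * s ^ j) sums (s * cnt.Dd f (z, s) (0, 1))"
      by (rule powser_times_deriv_sums[OF ser zs(2) hol_snd_line[OF f]])
        (use zs' in \<open>auto simp: disc_sector_def\<close>)
    from sums_add[OF ser[OF zs(2)] sums_mult[OF this, of "of_real (1 / a)"]]
    have "(\<lambda>j. ?c j * s ^ j + of_real (1 / a) * (of_nat j * ?c j * s ^ j)) sums G (z, s)" by (simp add: G_def)
    moreover have "?c j * s ^ j + of_real (1 / a) * (of_nat j * ?c j * s ^ j) = u j z / of_real (pochhammer a j) * s ^ j" for j
    proof -
      have "a * pochhammer (a + 1) j = (a + real j) * pochhammer a j"
        using pochhammer_rec[of a j] pochhammer_rec'[of a j] by simp
      moreover have "pochhammer a j > 0" "pochhammer (a + 1) j > 0" using a by (auto intro!: pochhammer_pos)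
      ultimately have "(a + real j) / (a * pochhammer (a + 1) j) = 1 / pochhammer a j"
        using a by (subst frac_eq_eq) auto
      moreover have "1 / pochhammer (a + 1) j * (1 + 1 / a * real j) = (a + real j) / (a * pochhammer (a + 1) j)"
        using a by (simp add: add_divide_distrib)
      ultimately have "1 / pochhammer (a + 1) j * (1 + 1 / a * real j) = 1 / pochhammer a j"
        by (simp only:)
      then have "complex_of_real (1 / pochhammer (a + 1) j * (1 + 1 / a * real j)) = of_real (1 / pochhammer a j)" by (simp only:)
      then have "u j z * s ^ j * complex_of_real (1 / pochhammer (a + 1) j * (1 + 1 / a * real j)) = u j z * s ^ j * of_real (1 / pochhammer a j)"
        by (simp only:)
      then show ?thesis by (simp add: algebra_simps add_divide_distrib)
    qed
    ultimately have "(\<lambda>j. u j z / of_real (pochhammer a j) * s ^ j) sums G (z, s)" by simp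
    then show ?thesis using pseries_sums[OF a zs'(1,2)] by (rule sums_unique2)
  qed
  define A' where "A' = A + 1 / a * (A * exp (B * \<mu>) / \<mu>)"
  show ?thesis
    unfolding sector_growth_def
  proof (rule exI[of _ "\<rho> / 2"], rule exI[of _ A'], rule exI[of _ "B + 1"], rule exI[of _ G], intro conjI hG)
    show "0 < \<rho> / 2" "\<rho> / 2 \<le> 1" "0 \<le> B + 1" using \<rho> AB by auto
    show "0 \<le> A'" using a AB \<mu> by (simp add: A'_def)
    show "\<exists>\<delta>>0. \<forall>z t. norm z < \<delta> \<longrightarrow> norm t < \<delta> \<longrightarrow> G (z, t) = pseries u a (z, t)"
      using near \<delta>' by blast
    show "\<forall>z t. norm z < \<rho> / 2 \<longrightarrow> t \<in> disc_sector d (\<rho> / 2) (\<rho> / 2) \<longrightarrow> norm (G (z, t)) \<le> A' * exp ((B + 1) * norm t powr 1)"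
    proof (intro allI impI)
      fix z :: "complex^'n" and t assume zt: "norm z < \<rho> / 2" "t \<in> disc_sector d (\<rho> / 2) (\<rho> / 2)"
      then have D': "(z, t) \<in> ?D'" by simp
      then have "(z, t) \<in> ?D" using sub by blast
      then have 1: "norm (f (z, t)) \<le> A * exp (B * norm t)" using gr[of z t] by simp
      have et: "norm t \<le> exp (norm t)" using exp_ge_add_one_self[of "norm t"] by linarith
      have "norm (G (z, t)) \<le> norm (f (z, t)) + 1 / a * (norm t * norm (cnt.Dd f (z, t) (0, 1)))"
        unfolding G_def using norm_triangle_ineq[of "f (z, t)" "of_real (1 / a) * (t * cnt.Dd f (z, t) (0, 1))"] a
        by (simp add: norm_mult norm_divide)
      also have "\<dots> \<le> A * (exp (norm t) * exp (B * norm t)) + 1 / a * (exp (norm t) * (A * exp (B * \<mu>) / \<mu> * exp (B * norm t)))"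
      proof (intro add_mono mult_left_mono mult_mono dle D' et)
        show "norm (f (z, t)) \<le> A * (exp (norm t) * exp (B * norm t))"
        proof (rule order_trans[OF 1], rule mult_left_mono)
          show "exp (B * norm t) \<le> exp (norm t) * exp (B * norm t)" by simp
        qed (rule AB)
      qed (use a AB \<mu> in auto)
      also have "\<dots> = A' * exp ((B + 1) * norm t powr 1)"
        by (simp add: A'_def distrib_right exp_add[symmetric] algebra_simps add.commute)
      finally show "norm (G (z, t)) \<le> A' * exp ((B + 1) * norm t powr 1)" .
    qed
  qed
qed

text \<open>In terms of m = 2a the available moves are +3 and -2, and these generate all steps by
  one.\<close>

lemma pseries_half_integers:
  fixes m m' :: nat
  assumes "m \<ge> 1" "m' \<ge> 1"
  shows "sector_growth 1 d (pseries u (real m / 2)) \<longleftrightarrow> sector_growth 1 d (pseries u (real m' / 2))"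
proof -
  let ?G = "\<lambda>m. sector_growth 1 d (pseries u (real m / 2))"
  have low: "?G (k + 2) \<Longrightarrow> ?G k" if "k \<ge> 1" for k :: nat
    using pseries_lower[of "real k / 2" d] that by (simp add: add_divide_distrib add.commute)
  have up: "?G k \<Longrightarrow> ?G (k + 3)" if "k \<ge> 1" for k
    using pseries_raise[OF that] .
  \<comment> \<open>Upwards the route is k, k + 3, k + 1; downwards it is k + 1, k + 4, k + 2, k. No
    stop falls below 1.\<close>
  have step: "?G (Suc k) \<longleftrightarrow> ?G k" if "k \<ge> 1" for k
  proof
    assume "?G k"
    then have "?G (Suc k + 2)" using up[OF that] by (simp add: numeral_3_eq_3)
    then show "?G (Suc k)" by (rule low[rotated]) simp
  next
    assume "?G (Suc k)"
    then have "?G (Suc k + 3)" by (rule up[rotated]) simp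
    then have "?G ((k + 2) + 2)" by (simp add: numeral_3_eq_3 numeral_2_eq_2)
    then have "?G (k + 2)" by (rule low[rotated]) simp
    then show "?G k" by (rule low[OF that])
  qed
  have "?G k \<longleftrightarrow> ?G 1" if "k \<ge> 1" for k
    using that by (induction k rule: dec_induct) (use step in auto)
  then show ?thesis using assms by blast
qed

end

section \<open>The substitution of a square\<close>

lemma norm_powr_2: "norm (t::complex) powr 2 = (norm t)\<^sup>2"
  by simp

text \<open>Squaring doubles angles, hence the halved opening. The direction enters through
  \<open>cis\<close>, so that e = d/2 and e = d/2 + pi, which double to d modulo 2 pi, are treated
  alike.\<close>

lemma square_in_disc_sector:
  assumes t: "t \<in> disc_sector e (\<rho> / 2) (\<rho> / 2)" and \<rho>: "0 < \<rho>" "\<rho> \<le> 1" and e: "cis (2 * e) = cis d"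
  shows "t\<^sup>2 / 4 \<in> disc_sector d \<rho> \<rho>"
proof (cases "norm t < \<rho> / 2")
  case True
  have "(norm t)\<^sup>2 \<le> norm t" using True \<rho> by (simp add: power2_eq_square mult_left_le_one_le)
  then have "norm (t\<^sup>2 / 4) < \<rho>" using True \<rho> by (simp add: norm_divide norm_power)
  then show ?thesis by (simp add: disc_sector_def)
next
  case False
  then obtain \<theta> where \<theta>: "t \<noteq> 0" "\<bar>\<theta> - e\<bar> < \<rho> / 2 / 2" "t = of_real (norm t) * cis \<theta>"
    using t by (auto simp: disc_sector_def sector_def)
  have "t\<^sup>2 / 4 = (of_real (norm t) * cis \<theta>)\<^sup>2 / 4" using \<theta>(3) by simp
  also have "\<dots> = of_real (norm (t\<^sup>2 / 4)) * cis (2 * \<theta>)"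
  proof -
    have "cis (2 * \<theta>) = cis \<theta> * cis \<theta>" by (simp add: cis_mult)
    then show ?thesis by (simp add: power2_eq_square norm_mult norm_divide)
  qed
  \<comment> \<open>The angle is moved by a multiple of 2 pi to the representative near d.\<close>
  also have "cis (2 * \<theta>) = cis (2 * \<theta> - 2 * e + d)"
    using e by (simp add: cis_mult[symmetric] cis_divide[symmetric])
  finally have "t\<^sup>2 / 4 = of_real (norm (t\<^sup>2 / 4)) * cis (2 * \<theta> - 2 * e + d)" .
  moreover have "\<bar>2 * \<theta> - 2 * e + d - d\<bar> < \<rho> / 2" using \<theta>(2) by linarith
  moreover have "t\<^sup>2 / 4 \<noteq> 0" using \<theta>(1) by simp
  ultimately show ?thesis unfolding disc_sector_def sector_def by blast
qed

lemma sector_growth_square: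
  fixes F :: "(complex^'n) \<times> complex \<Rightarrow> complex"
  assumes g: "sector_growth 1 d F" and e: "cis (2 * e) = cis d"
  shows "sector_growth 2 e (\<lambda>(z, t). F (z, t\<^sup>2 / 4))"
proof -
  obtain \<rho> A B f \<delta> where \<rho>: "0 < \<rho>" "\<rho> \<le> 1" and AB: "0 \<le> A" "0 \<le> B"
    and f: "cnt.hol (ball 0 \<rho> \<times> disc_sector d \<rho> \<rho>) f"
    and \<delta>: "\<delta> > 0" "\<And>z t. norm z < \<delta> \<Longrightarrow> norm t < \<delta> \<Longrightarrow> f (z, t) = F (z, t)"
    and gr: "\<And>z t. norm z < \<rho> \<Longrightarrow> t \<in> disc_sector d \<rho> \<rho> \<Longrightarrow> norm (f (z, t)) \<le> A * exp (B * norm t powr 1)"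
    using g unfolding sector_growth_def by (elim exE conjE) blast
  show ?thesis
    unfolding sector_growth_def
  proof (rule exI[of _ "\<rho> / 2"], rule exI[of _ A], rule exI[of _ B], rule exI[of _ "\<lambda>p. f (fst p, (snd p)\<^sup>2 / 4)"], intro conjI AB)
    show "0 < \<rho> / 2" "\<rho> / 2 \<le> 1" using \<rho> by auto
    show "cnt.hol (ball 0 (\<rho> / 2) \<times> disc_sector e (\<rho> / 2) (\<rho> / 2)) (\<lambda>p. f (fst p, (snd p)\<^sup>2 / 4))"
    proof (rule hol_compose_snd[OF f, where h' = "\<lambda>t. t / 2"])
      fix p :: "(complex^'n) \<times> complex" assume p: "p \<in> ball 0 (\<rho> / 2) \<times> disc_sector e (\<rho> / 2) (\<rho> / 2)"
      then show "(fst p, (snd p)\<^sup>2 / 4) \<in> ball 0 \<rho> \<times> disc_sector d \<rho> \<rho>"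
        using square_in_disc_sector[OF _ \<rho> e, of "snd p"] \<rho> by (cases p) auto
      show "((\<lambda>a. a\<^sup>2 / 4) has_field_derivative snd p / 2) (at (snd p))"
        by (auto intro!: derivative_eq_intros)
    qed
    show "\<exists>\<delta>>0. \<forall>z t. norm z < \<delta> \<longrightarrow> norm t < \<delta> \<longrightarrow>
       f (fst (z, t), (snd (z, t))\<^sup>2 / 4) = (case (z, t) of (z, t) \<Rightarrow> F (z, t\<^sup>2 / 4))"
    proof (rule exI[of _ "min 1 \<delta>"], intro conjI allI impI)
      fix z :: "complex^'n" and t :: complex assume zt: "norm z < min 1 \<delta>" "norm t < min 1 \<delta>"
      have "(norm t)\<^sup>2 \<le> norm t" using zt by (simp add: power2_eq_square mult_left_le_one_le)
      then have "(norm t)\<^sup>2 < \<delta> * 4" using zt \<delta>(1) by simp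
      then have "norm (t\<^sup>2 / 4) < \<delta>" by (simp add: norm_divide norm_power)
      then show "f (fst (z, t), (snd (z, t))\<^sup>2 / 4) = (case (z, t) of (z, t) \<Rightarrow> F (z, t\<^sup>2 / 4))"
        using \<delta>(2) zt by simp
    qed (use \<delta> in simp)
    show "\<forall>z t. norm z < \<rho> / 2 \<longrightarrow> t \<in> disc_sector e (\<rho> / 2) (\<rho> / 2) \<longrightarrow>
       norm (f (fst (z, t), (snd (z, t))\<^sup>2 / 4)) \<le> A * exp (B * norm t powr 2)"
    proof (intro allI impI)
      fix z :: "complex^'n" and t assume zt: "norm z < \<rho> / 2" "t \<in> disc_sector e (\<rho> / 2) (\<rho> / 2)"
      have "norm (f (z, t\<^sup>2 / 4)) \<le> A * exp (B * norm (t\<^sup>2 / 4) powr 1)"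
        using zt \<rho> by (intro gr square_in_disc_sector[OF _ \<rho> e]) auto
      also have "\<dots> \<le> A * exp (B * norm t powr 2)"
        using AB by (auto simp: norm_divide norm_power intro!: mult_left_mono)
      finally show "norm (f (fst (z, t), (snd (z, t))\<^sup>2 / 4)) \<le> A * exp (B * norm t powr 2)" by simp
    qed
  qed
qed

text \<open>The branch of 2 sqrt(s) that maps direction d to d/2: turning s by -d first places the
  cut of \<open>csqrt\<close> opposite to the sector.\<close>

definition sector_root :: "real \<Rightarrow> complex \<Rightarrow> complex" where
  "sector_root d s = 2 * cis (d / 2) * csqrt (s * cis (- d))"

text \<open>Angles within 1/2 of d become angles in the right half-plane after the turn, off the
  cut, and there the principal root is the one with half the angle.\<close>

lemma sector_root:
  assumes s: "s \<in> sector d \<rho>" and \<rho>: "\<rho> \<le> 1"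
  shows "sector_root d s \<in> sector (d / 2) \<rho>" "(sector_root d s)\<^sup>2 / 4 = s" "(norm (sector_root d s))\<^sup>2 = 4 * norm s"
    "\<exists>D. (sector_root d has_field_derivative D) (at s)"
proof -
  obtain \<theta> where \<theta>: "s \<noteq> 0" "\<bar>\<theta> - d\<bar> < \<rho> / 2" "s = of_real (norm s) * cis \<theta>"
    using s by (auto simp: sector_def)
  have eta: "\<bar>\<theta> - d\<bar> < 1 / 2" using \<theta>(2) \<rho> by linarith
  have x: "s * cis (- d) = of_real (norm s) * cis (\<theta> - d)"
    by (subst \<theta>(3)) (simp add: cis_mult mult.assoc)
  have c: "cos (\<theta> - d) > 0" "cos ((\<theta> - d) / 2) > 0"
  proof -
    have b: "- (1 / 2) < \<theta> - d" "\<theta> - d < 1 / 2" using eta by linarith+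
    show "cos (\<theta> - d) > 0" by (rule cos_gt_zero_pi) (use b pi_gt3 in linarith)+
    have "- (1 / 2) < (\<theta> - d) / 2" "(\<theta> - d) / 2 < 1 / 2" using b by simp_all
    then show "cos ((\<theta> - d) / 2) > 0" using pi_gt3 by (intro cos_gt_zero_pi; simp)
  qed
  have rt: "csqrt (s * cis (- d)) = of_real (sqrt (norm s)) * cis ((\<theta> - d) / 2)"
  proof (rule csqrt_unique)
    show "(of_real (sqrt (norm s)) * cis ((\<theta> - d) / 2))\<^sup>2 = s * cis (- d)"
    proof -
      have "(complex_of_real (sqrt (norm s)))\<^sup>2 = of_real (norm s)"
        by (simp add: of_real_power[symmetric] del: of_real_power)
      moreover have "(cis ((\<theta> - d) / 2))\<^sup>2 = cis (\<theta> - d)"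
        by (simp add: power2_eq_square cis_mult)
      ultimately show ?thesis unfolding x power_mult_distrib by (simp only:)
    qed
    show "0 < Re (of_real (sqrt (norm s)) * cis ((\<theta> - d) / 2)) \<or>
      Re (of_real (sqrt (norm s)) * cis ((\<theta> - d) / 2)) = 0 \<and> 0 \<le> Im (of_real (sqrt (norm s)) * cis ((\<theta> - d) / 2))"
      using c(2) \<theta>(1) by simp
  qed
  have r: "sector_root d s = of_real (2 * sqrt (norm s)) * cis (d / 2 + (\<theta> - d) / 2)"
    by (simp add: sector_root_def rt cis_mult[symmetric])
  then have nr: "norm (sector_root d s) = 2 * sqrt (norm s)" by (simp add: norm_mult)
  then show "(norm (sector_root d s))\<^sup>2 = 4 * norm s" by (simp add: power_mult_distrib)
  show "sector_root d s \<in> sector (d / 2) \<rho>"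
    unfolding sector_def
  proof (intro CollectI conjI exI[of _ "d / 2 + (\<theta> - d) / 2"])
    show "sector_root d s \<noteq> 0" using nr \<theta>(1) by auto
    show "sector_root d s = of_real (norm (sector_root d s)) * cis (d / 2 + (\<theta> - d) / 2)"
      unfolding nr by (rule r)
    have "\<bar>d / 2 + (\<theta> - d) / 2 - d / 2\<bar> = \<bar>\<theta> - d\<bar> / 2" by (simp add: abs_divide)
    also have "\<dots> \<le> \<bar>\<theta> - d\<bar>" by simp
    also have "\<dots> < \<rho> / 2" by (rule \<theta>(2))
    finally show "\<bar>d / 2 + (\<theta> - d) / 2 - d / 2\<bar> < \<rho> / 2" .
  qed
  have "(sector_root d s)\<^sup>2 / 4 = (cis (d / 2) * cis (d / 2)) * (s * cis (- d))"
    by (simp add: sector_root_def power_mult_distrib) (simp add: power2_eq_square)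
  also have "\<dots> = s" unfolding cis_mult by (simp add: mult.left_commute cis_mult)
  finally show "(sector_root d s)\<^sup>2 / 4 = s" .
  have "Re (s * cis (- d)) > 0" unfolding x using c(1) \<theta>(1) by simp
  then have np: "s * cis (- d) \<notin> \<real>\<^sub>\<le>\<^sub>0" by (auto simp: complex_nonpos_Reals_iff)
  have "((\<lambda>s. s * cis (- d)) has_field_derivative cis (- d)) (at s)" by (auto intro!: derivative_eq_intros)
  from DERIV_chain2[OF has_field_derivative_csqrt[OF np] this]
  have "((\<lambda>s. csqrt (s * cis (- d))) has_field_derivative inverse (2 * csqrt (s * cis (- d))) * cis (- d)) (at s)" .
  from DERIV_cmult[OF this, of "2 * cis (d / 2)"]
  show "\<exists>D. (sector_root d has_field_derivative D) (at s)" unfolding sector_root_def[abs_def] by blast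
qed

context growth_coeffs
begin

lemma norm_pseries_le:
  assumes "a > 0" "norm z < r0" "norm s < Rad a"
  shows "norm (pseries u a (z, s)) \<le> 2 * M"
proof -
  have "(\<lambda>j. M * (1 / 2) ^ j) sums (M * (1 / (1 - 1 / 2)))"
    by (intro sums_mult geometric_sums) simp
  then have 1: "(\<Sum>j. M * (1 / 2) ^ j) = 2 * M" by (simp add: sums_iff)
  have "norm (pseries u a (z, s)) \<le> (\<Sum>j. M * (1 / 2) ^ j)"
    unfolding sums_unique[OF pseries_sums[OF assms]]
    by (rule norm_suminf_le[OF term_le[OF assms] summable_half])
  then show ?thesis using 1 by simp
qed

text \<open>The root is singular at s = 0, so the extension is glued: the series on a disc, f
  composed with the root in the sector. They agree on the overlap because the square of the root is
  4 s.\<close>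

lemma sector_growth_root:
  assumes a: "a > 0" and g: "sector_growth 2 (d / 2) (\<lambda>(z, t). pseries u a (z, t\<^sup>2 / 4))"
  shows "sector_growth 1 d (pseries u a)"
proof -
  obtain \<rho> A B f \<delta> where \<rho>: "0 < \<rho>" "\<rho> \<le> 1" and AB: "0 \<le> A" "0 \<le> B"
    and f: "cnt.hol (ball 0 \<rho> \<times> disc_sector (d / 2) \<rho> \<rho>) f"
    and \<delta>: "\<delta> > 0" "\<And>z t. norm z < \<delta> \<Longrightarrow> norm t < \<delta> \<Longrightarrow> f (z, t) = (case (z, t) of (z, t) \<Rightarrow> pseries u a (z, t\<^sup>2 / 4))"
    and gr: "\<And>z t. norm z < \<rho> \<Longrightarrow> t \<in> disc_sector (d / 2) \<rho> \<rho> \<Longrightarrow> norm (f (z, t)) \<le> A * exp (B * norm t powr 2)"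
    using g unfolding sector_growth_def by (elim exE conjE) blast
  \<comment> \<open>The root has squared modulus 4 |s|, so |s| < \<delta>^2 / 4 puts it where f is
    known to coincide with the series.\<close>
  define \<delta>1 where "\<delta>1 = min (Rad a) (\<delta>\<^sup>2 / 4)"
  \<comment> \<open>With \<rho>1 \<le> \<delta>1 the disc part lies in the region of the series, so
    every point of modulus at least \<delta>1 belongs to the sector.\<close>
  define \<rho>1 where "\<rho>1 = min (min \<rho> r0) (min \<delta>1 \<delta>)"
  have d1: "\<delta>1 > 0" "\<delta>1 \<le> Rad a" "\<delta>1 \<le> \<delta>\<^sup>2 / 4" using \<delta>(1) Rad_pos by (auto simp: \<delta>1_def)
  have r1: "\<rho>1 > 0" "\<rho>1 \<le> \<rho>" "\<rho>1 \<le> r0" "\<rho>1 \<le> \<delta>1" "\<rho>1 \<le> \<delta>" "\<rho>1 \<le> 1"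
    using \<rho> r0 d1 \<delta>(1) by (auto simp: \<rho>1_def)
  let ?S = "sector d \<rho>1"
  let ?g = "\<lambda>p. f (fst p, sector_root d (snd p))"
  note root = sector_root[OF _ r1(6)]
  have rs: "sector_root d s \<in> disc_sector (d / 2) \<rho> \<rho>" if "s \<in> ?S" for s
    using root(1)[OF that] disc_sector_mono[OF r1(2) r1(2), of "d / 2"] by (auto simp: disc_sector_def)
  define G where "G p = (if norm (snd p) < \<delta>1 then pseries u a p else ?g p)" for p
  have overlap: "G p = ?g p" if p: "p \<in> ball 0 \<rho>1 \<times> ?S" for p
  proof (cases "norm (snd p) < \<delta>1")
    case True
    have s: "snd p \<in> ?S" using p by auto
    have "(norm (sector_root d (snd p)))\<^sup>2 < \<delta>\<^sup>2"
      using root(3)[OF s] True d1(3) by simp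
    then have "norm (sector_root d (snd p)) < \<delta>" using \<delta>(1) by (simp add: power2_less_imp_less)
    then have "?g p = pseries u a (fst p, (sector_root d (snd p))\<^sup>2 / 4)"
      using \<delta>(2)[of "fst p" "sector_root d (snd p)"] p r1(5) by auto
    also have "\<dots> = pseries u a p" unfolding root(2)[OF s] by simp
    finally show ?thesis using True by (simp add: G_def)
  qed (simp add: G_def)
  have hg: "cnt.hol (ball 0 \<rho>1 \<times> ?S) ?g"
  proof -
    have h': "(sector_root d has_field_derivative deriv (sector_root d) s) (at s)" if s: "s \<in> ?S" for s
    proof -
      obtain D where D: "(sector_root d has_field_derivative D) (at s)" using root(4)[OF s] by blast
      then show ?thesis using DERIV_imp_deriv[OF D] by simp
    qed
    show ?thesis
      by (rule hol_compose_snd[OF f, where h' = "deriv (sector_root d)"]) (use h' rs r1(2) in auto)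
  qed
  have hG: "cnt.hol (ball 0 \<rho>1 \<times> disc_sector d \<rho>1 \<rho>1) G"
  proof (rule cnt.hol_local)
    fix p :: "(complex^'n) \<times> complex" assume p: "p \<in> ball 0 \<rho>1 \<times> disc_sector d \<rho>1 \<rho>1"
    show "\<exists>U g. open U \<and> p \<in> U \<and> cnt.hol U g \<and> (\<forall>w\<in>U. G w = g w)"
    proof (cases "norm (snd p) < \<delta>1")
      case True
      show ?thesis
      proof (intro exI[of _ "ball 0 \<rho>1 \<times> ball 0 \<delta>1"] exI[of _ "pseries u a"] conjI)
        show "cnt.hol (ball 0 \<rho>1 \<times> ball 0 \<delta>1) (pseries u a)"
          by (rule cnt.hol_subset[OF hol_pseries[OF a]]) (use r1 d1 in auto)
      qed (use p True in \<open>auto simp: G_def intro: open_Times\<close>)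
    next
      case False
      then have "p \<in> ball 0 \<rho>1 \<times> ?S" using p r1(4) by (auto simp: disc_sector_def)
      then show ?thesis
        using hg overlap by (intro exI[of _ "ball 0 \<rho>1 \<times> ?S"] exI[of _ ?g] conjI) (auto intro: open_Times open_sector)
    qed
  qed
  show ?thesis
    unfolding sector_growth_def
  \<comment> \<open>2 M bounds the series on the disc, and 4 B comes from the squared modulus 4 |t|
    of the root.\<close>
  proof (rule exI[of _ \<rho>1], rule exI[of _ "2 * M + A"], rule exI[of _ "4 * B"], rule exI[of _ G], intro conjI r1(1,6) hG)
    show "0 \<le> 2 * M + A" "0 \<le> 4 * B" using M AB by auto
    show "\<exists>\<delta>>0. \<forall>z t. norm z < \<delta> \<longrightarrow> norm t < \<delta> \<longrightarrow> G (z, t) = pseries u a (z, t)"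
      using d1(1) by (intro exI[of _ \<delta>1]) (auto simp: G_def)
    show "\<forall>z t. norm z < \<rho>1 \<longrightarrow> t \<in> disc_sector d \<rho>1 \<rho>1 \<longrightarrow> norm (G (z, t)) \<le> (2 * M + A) * exp (4 * B * norm t powr 1)"
    proof (intro allI impI)
      fix z :: "complex^'n" and t assume zt: "norm z < \<rho>1" "t \<in> disc_sector d \<rho>1 \<rho>1"
      have e1: "exp (4 * B * norm t) \<ge> 1" using AB by simp
      show "norm (G (z, t)) \<le> (2 * M + A) * exp (4 * B * norm t powr 1)"
      proof (cases "norm t < \<delta>1")
        case True
        have "norm (G (z, t)) \<le> 2 * M"
          using True zt r1 d1 by (auto simp: G_def intro!: norm_pseries_le a)
        also have "\<dots> \<le> (2 * M + A) * 1" using AB by simp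
        also have "\<dots> \<le> (2 * M + A) * exp (4 * B * norm t powr 1)"
          using e1 M AB by (intro mult_left_mono) auto
        finally show ?thesis .
      next
        case False
        then have t: "t \<in> ?S" using zt r1(4) by (auto simp: disc_sector_def)
        have "norm (G (z, t)) \<le> A * exp (B * norm (sector_root d t) powr 2)"
          using False gr[OF _ rs[OF t], of z] zt r1(2) by (simp add: G_def)
        also have "\<dots> = A * exp (4 * B * norm t powr 1)"
          unfolding norm_powr_2 root(3)[OF t] by simp
        also have "\<dots> \<le> (2 * M + A) * exp (4 * B * norm t powr 1)"
          using M by (intro mult_right_mono) auto
        finally show ?thesis .
      qed
    qed
  qed
qed

lemma sector_growth_pseries_iff:
  assumes a: "a > 0"
  shows "sector_growth 1 d (pseries u a) \<longleftrightarrow>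
    sector_growth 2 (d / 2) (\<lambda>(z, t). pseries u a (z, t\<^sup>2 / 4)) \<and>
    sector_growth 2 (d / 2 + pi) (\<lambda>(z, t). pseries u a (z, t\<^sup>2 / 4))"
proof -
  have "cis (2 * (d / 2)) = cis d" "cis (2 * (d / 2 + pi)) = cis d"
    by (simp_all add: distrib_left cis_mult[symmetric])
  then show ?thesis using sector_growth_square sector_growth_root[OF a] by blast
qed

section \<open>Convergence of the formal solution and entire extensions\<close>

lemma exp_growth_sums: "(\<lambda>j. c * (L * x) ^ j / fact j) sums (c * exp (L * x :: real))"
  using sums_mult[OF exp_converges[of "L * x"], of c] by (simp add: divide_inverse mult_ac)

text \<open>Cauchy's estimate in t on the circle of radius r / 2 bounds u_j geometrically. Division
  by (a)_j, comparable to j!, leaves terms dominated by an exponential series in s, and s = t^2 / 4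
  makes this growth of order 2.\<close>

lemma O_entire_of_convergent:
  assumes a: "a > 0" and r: "r > 0" and U: "\<And>z t. norm z < r \<Longrightarrow> norm t < r \<Longrightarrow> (\<lambda>j. u j z * t ^ j) sums U (z, t)"
    and hU: "cnt.hol (ball 0 r \<times> ball 0 r) U"
  shows "O_entire 2 (\<lambda>(z, t). pseries u a (z, t\<^sup>2 / 4))"
proof -
  have "continuous_on (cball 0 (r / 2) \<times> cball 0 (r / 2)) U"
    by (rule continuous_on_subset[OF cnt.hol_continuous_on[OF hU]]) (use r in auto)
  then obtain M1 where M1: "\<And>p. p \<in> cball 0 (r / 2) \<times> cball 0 (r / 2) \<Longrightarrow> norm (U p) \<le> M1"
    by (rule compact_norm_bound[OF compact_Times[OF compact_cball compact_cball]]) blast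
  have M10: "M1 \<ge> 0" using order_trans[OF norm_ge_zero M1[of "(0, 0)"]] r by simp
  define r2 where "r2 = min (r / 2) r0"
  have r2: "r2 > 0" "r2 \<le> r / 2" "r2 \<le> r0" using r r0 by (auto simp: r2_def)
  define C where "C = max 1 (1 / a)"
  \<comment> \<open>2 / r from Cauchy's estimate, \<open>C\<close> from replacing (a)_j by
    j!.\<close>
  define L where "L = 2 / r * C"
  have L: "L \<ge> 0" using r by (simp add: L_def C_def)
  have ule: "norm (u j z) \<le> M1 * (2 / r) ^ j" if z: "norm z < r2" for z j
  proof -
    let ?g = "\<lambda>t. U (z, t)"
    have hg: "?g holomorphic_on ball 0 r"
    proof (rule holomorphic_onI)
      fix t :: complex assume "t \<in> ball 0 r"
      then have "(z, t) \<in> ball 0 r \<times> ball 0 r" using z r2 r by auto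
      from hol_snd_line[OF hU this] show "?g field_differentiable (at t within ball 0 r)"
        using field_differentiable_at_within field_differentiable_def by blast
    qed
    have e1: "u j z = (deriv ^^ j) ?g 0 / fact j"
    proof (rule powser_unique[OF r])
      show "(\<lambda>j. u j z * t ^ j) sums U (z, t)" if "norm t < r" for t
        using U[of z t] that z r2 r by simp
      show "(\<lambda>j. (deriv ^^ j) ?g 0 / fact j * t ^ j) sums U (z, t)" if "norm t < r" for t
        using holomorphic_power_series[OF hg, of t] that by simp
    qed
    have "norm ((deriv ^^ j) ?g 0) \<le> fact j * M1 / (r / 2) ^ j"
    proof (rule Cauchy_inequality)
      show "?g holomorphic_on ball 0 (r / 2)" using hg by (rule holomorphic_on_subset) (use r in auto)
      show "continuous_on (cball 0 (r / 2)) ?g"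
        by (rule continuous_on_subset[OF holomorphic_on_imp_continuous_on[OF hg]]) (use r in auto)
      show "norm (U (z, t)) \<le> M1" if "norm (0 - t) = r / 2" for t
        using that z r2 by (intro M1) auto
    qed (use r in simp)
    then have "norm ((deriv ^^ j) ?g 0) / fact j \<le> (fact j * M1 / (r / 2) ^ j) / fact j"
      by (rule divide_right_mono) simp
    then show ?thesis unfolding e1 by (simp add: norm_divide power_divide)
  qed
  have tle: "norm (u j z / of_real (pochhammer a j) * s ^ j) \<le> M1 * (L * norm s) ^ j / fact j" if z: "norm z < r2" for z s j
  proof -
    have p: "pochhammer a j > 0" using a by (rule pochhammer_pos)
    have "fact j \<le> C ^ j * pochhammer a j"
      using pochhammer_le[OF a, of 1 j] by (simp add: C_def pochhammer_fact)
    then have "1 / pochhammer a j \<le> C ^ j / fact j" using p by (simp add: field_simps)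
    then have "norm (u j z) * (1 / pochhammer a j) \<le> (M1 * (2 / r) ^ j) * (C ^ j / fact j)"
      using ule[OF z] p M10 r by (intro mult_mono) auto
    then have "(norm (u j z) * (1 / pochhammer a j)) * norm s ^ j \<le> ((M1 * (2 / r) ^ j) * (C ^ j / fact j)) * norm s ^ j"
      by (rule mult_right_mono) simp
    moreover have "(L * norm s) ^ j = (2 / r) ^ j * C ^ j * norm s ^ j"
      by (simp only: L_def power_mult_distrib)
    ultimately show ?thesis using p by (simp add: norm_mult norm_divide norm_power mult_ac)
  qed
  have hW: "cnt.hol (ball 0 r2 \<times> UNIV) (pseries u a)"
  proof (rule cnt.hol_local)
    fix p :: "(complex^'n) \<times> complex" assume p: "p \<in> ball 0 r2 \<times> UNIV"
    define R where "R = norm (snd p) + 1"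
    have "cnt.hol (ball 0 r2 \<times> ball 0 R) (\<lambda>p. \<Sum>j. u j (fst p) / of_real (pochhammer a j) * snd p ^ j)"
    proof (rule cnt.hol_suminf)
      show "cnt.hol (ball 0 r2 \<times> ball 0 R) (\<lambda>p. u j (fst p) / of_real (pochhammer a j) * snd p ^ j)" for j
        by (rule cnt.hol_subset[OF hol_term]) (use r2 in auto)
      show "norm (u j (fst p) / of_real (pochhammer a j) * snd p ^ j) \<le> M1 * (L * R) ^ j / fact j"
        if "p \<in> ball 0 r2 \<times> ball 0 R" for j p
      proof (rule order_trans[OF tle])
        show "M1 * (L * norm (snd p)) ^ j / fact j \<le> M1 * (L * R) ^ j / fact j"
          using that M10 L by (intro divide_right_mono mult_left_mono power_mono) auto
      qed (use that in auto)
      show "summable (\<lambda>j. M1 * (L * R) ^ j / fact j)" using exp_growth_sums by (rule sums_summable)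
    qed (auto intro: open_Times)
    then have "cnt.hol (ball 0 r2 \<times> ball 0 R) (pseries u a)" by (simp add: pseries_def case_prod_beta')
    then show "\<exists>U g. open U \<and> p \<in> U \<and> cnt.hol U g \<and> (\<forall>w\<in>U. pseries u a w = g w)"
      using p by (intro exI[of _ "ball 0 r2 \<times> ball 0 R"] exI[of _ "pseries u a"] conjI) (auto simp: R_def intro: open_Times)
  qed
  show ?thesis
    unfolding O_entire_def holo_nt_iff_hol
  proof (rule exI[of _ r2], rule conjI[OF r2(1)], rule exI[of _ "\<lambda>p. pseries u a (fst p, (snd p)\<^sup>2 / 4)"], intro conjI allI impI)
    show "cnt.hol (ball 0 r2 \<times> UNIV) (\<lambda>p. pseries u a (fst p, (snd p)\<^sup>2 / 4))"
      by (rule hol_compose_snd[OF hW, where h' = "\<lambda>t. t / 2"]) (auto intro!: derivative_eq_intros)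
    show "\<exists>\<delta>>0. \<forall>z t. norm z < \<delta> \<longrightarrow> norm t < \<delta> \<longrightarrow> pseries u a (fst (z, t), (snd (z, t))\<^sup>2 / 4) = (case (z, t) of (z, t) \<Rightarrow> pseries u a (z, t\<^sup>2 / 4))"
      by (intro exI[of _ 1]) simp
    fix r' assume r': "r' < r2"
    show "\<exists>A B. \<forall>z t. norm z \<le> r' \<longrightarrow> norm (pseries u a (fst (z, t), (snd (z, t))\<^sup>2 / 4)) \<le> A * exp (B * norm t powr 2)"
    proof (rule exI[of _ M1], rule exI[of _ "L / 4"], intro allI impI)
      fix z :: "complex^'n" and t assume "norm z \<le> r'"
      then have z: "norm z < r2" using r' by simp
      have "norm (pseries u a (z, t\<^sup>2 / 4)) \<le> (\<Sum>j. M1 * (L * norm (t\<^sup>2 / 4)) ^ j / fact j)"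
        unfolding pseries_def split_conv
        by (rule norm_suminf_le[OF tle[OF z]]) (rule sums_summable[OF exp_growth_sums])
      also have "\<dots> = M1 * exp (L * norm (t\<^sup>2 / 4))" using exp_growth_sums by (rule sums_unique[symmetric])
      also have "\<dots> = M1 * exp (L / 4 * norm t powr 2)" by (simp add: norm_divide norm_power)
      finally show "norm (pseries u a (fst (z, t), (snd (z, t))\<^sup>2 / 4)) \<le> M1 * exp (L / 4 * norm t powr 2)" by simp
    qed
  qed
qed

text \<open>For each small z the extension is entire in t, so its Taylor coefficients may be
  estimated on circles whose radius depends on j.\<close>

lemma convergent_of_O_entire:
  assumes a: "a > 0" and E: "O_entire 2 (\<lambda>(z, t). pseries u a (z, t\<^sup>2 / 4))"
  shows "\<exists>r>0. \<exists>U. (\<forall>z t. norm z < r \<longrightarrow> norm t < r \<longrightarrow> (\<lambda>j. u j z * t ^ j) sums U (z, t)) \<and> cnt.hol (ball 0 r \<times> ball 0 r) U"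
proof -
  obtain r f \<delta> where r: "r > 0" and f: "cnt.hol (ball 0 r \<times> UNIV) f" and \<delta>: "\<delta> > 0"
      "\<And>z t. norm z < \<delta> \<Longrightarrow> norm t < \<delta> \<Longrightarrow> f (z, t) = (case (z, t) of (z, t) \<Rightarrow> pseries u a (z, t\<^sup>2 / 4))"
    and gr: "\<And>r'. r' < r \<Longrightarrow> \<exists>A B. \<forall>z t. norm z \<le> r' \<longrightarrow> norm (f (z, t)) \<le> A * exp (B * norm t powr 2)"
    using E unfolding O_entire_def holo_nt_iff_hol by (elim exE conjE) blast
  obtain A B where AB: "\<And>z t. norm z \<le> r / 2 \<Longrightarrow> norm (f (z, t)) \<le> A * exp (B * norm t powr 2)"
    using gr[of "r / 2"] r by auto
  have A0: "A \<ge> 0" using order_trans[OF norm_ge_zero AB[of 0 0]] r by simp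
  define \<delta>2 where "\<delta>2 = min (min \<delta> (r / 2)) r0"
  have d2: "\<delta>2 > 0" "\<delta>2 \<le> \<delta>" "\<delta>2 \<le> r / 2" "\<delta>2 \<le> r0" using \<delta> r r0 by (auto simp: \<delta>2_def)
  define \<tau> where "\<tau> = min (min \<delta> 1) (Rad a)"
  have \<tau>: "\<tau> > 0" "\<tau> \<le> \<delta>" "\<tau> \<le> 1" "\<tau> \<le> Rad a" using \<delta> Rad_pos by (auto simp: \<tau>_def)
  define C where "C = max 1 (a / 1)"
  define L where "L = 4 * exp B * C"
  have L: "L > 0" by (simp add: L_def C_def)
  have ule: "norm (u j z) \<le> A * exp B * L ^ j" if z: "norm z < \<delta>2" for z j
  proof -
    let ?g = "\<lambda>t. f (z, t)"
    have hg: "?g holomorphic_on UNIV"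
    proof (rule holomorphic_onI)
      fix t :: complex
      have "(z, t) \<in> ball 0 r \<times> UNIV" using z d2 r by auto
      from hol_snd_line[OF f this] show "?g field_differentiable (at t within UNIV)"
        using field_differentiable_at_within field_differentiable_def by blast
    qed
    \<comment> \<open>W_a(z, t^2 / 4) as a full power series in t, with 4^(-j) in the even
      coefficients, for comparison with the Taylor coefficients of the extension.\<close>
    define b where "b n = (if even n then u (n div 2) z / of_real (pochhammer a (n div 2)) / 4 ^ (n div 2) else 0)" for n
    have bs: "(\<lambda>n. b n * t ^ n) sums ?g t" if t: "norm t < \<tau>" for t
    proof -
      have "(norm t)\<^sup>2 \<le> norm t" using t \<tau> by (simp add: power2_eq_square mult_left_le_one_le)
      then have "norm (t\<^sup>2 / 4) < Rad a" using t \<tau> by (simp add: norm_divide norm_power)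
      then have "(\<lambda>j. u j z / of_real (pochhammer a j) * (t\<^sup>2 / 4) ^ j) sums pseries u a (z, t\<^sup>2 / 4)"
        using z d2 by (intro pseries_sums a) auto
      moreover have "?g t = pseries u a (z, t\<^sup>2 / 4)" using \<delta>(2)[of z t] z d2 t \<tau> by simp
      moreover have "u j z / of_real (pochhammer a j) * (t\<^sup>2 / 4) ^ j = b (2 * j) * t ^ (2 * j)" for j
        by (simp add: b_def power_divide power_mult)
      ultimately have "(\<lambda>j. b (2 * j) * t ^ (2 * j)) sums ?g t" by simp
      moreover have "b n * t ^ n = 0" if "n \<notin> range (\<lambda>j. 2 * j)" for n
        using that by (auto simp: b_def elim!: evenE)
      moreover have "strict_mono (\<lambda>j::nat. 2 * j)" by (simp add: strict_mono_def)
      ultimately show ?thesis using sums_mono_reindex[of "\<lambda>j. 2 * j" "\<lambda>n. b n * t ^ n"] by blast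
    qed
    have b: "b n = (deriv ^^ n) ?g 0 / fact n" for n
    proof (rule powser_unique[OF \<tau>(1) bs])
      show "(\<lambda>j. (deriv ^^ j) ?g 0 / fact j * t ^ j) sums ?g t" for t
        using holomorphic_power_series[of ?g 0 "norm t + 1" t] holomorphic_on_subset[OF hg] by simp
    qed
    \<comment> \<open>R^2 is j + 1 and not j, which keeps the radius positive for j = 0.\<close>
    define R where "R = sqrt (real (j + 1))"
    have R: "R > 0" "R\<^sup>2 = real (j + 1)" by (auto simp: R_def)
    have "norm ((deriv ^^ (2 * j)) ?g 0) \<le> fact (2 * j) * (A * exp (B * R powr 2)) / R ^ (2 * j)"
    proof (rule Cauchy_inequality)
      show "?g holomorphic_on ball 0 R" using hg by (rule holomorphic_on_subset) auto
      show "continuous_on (cball 0 R) ?g"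
        by (rule continuous_on_subset[OF holomorphic_on_imp_continuous_on[OF hg]]) auto
      show "norm (f (z, t)) \<le> A * exp (B * R powr 2)" if "norm (0 - t) = R" for t
        using AB[of z t] that z d2 R(1) by simp
    qed (rule R)
    then have "norm ((deriv ^^ (2 * j)) ?g 0) / fact (2 * j) \<le> fact (2 * j) * (A * exp (B * R powr 2)) / R ^ (2 * j) / fact (2 * j)"
      by (rule divide_right_mono) simp
    moreover have "R ^ (2 * j) = real (j + 1) ^ j" "R powr 2 = real (j + 1)"
      using R by (simp_all only: power_mult powr_numeral)
    ultimately have b1: "norm (b (2 * j)) \<le> A * exp (B * real (j + 1)) / real (j + 1) ^ j"
      unfolding b by (simp add: norm_divide)
    have b2: "norm (u j z) = norm (b (2 * j)) * pochhammer a j * 4 ^ j"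
      using pochhammer_pos[OF a, of j] by (simp add: b_def norm_divide norm_mult norm_power)
    have "norm (u j z) \<le> A * exp (B * real (j + 1)) / real (j + 1) ^ j * pochhammer a j * 4 ^ j"
      unfolding b2 using pochhammer_pos[OF a, of j] by (intro mult_right_mono b1) auto
    \<comment> \<open>(j + 1)^j \<ge> j! in the denominator cancels the j! in the bound for (a)_j;
      what remains is geometric with ratio \<open>L\<close>.\<close>
    also have "\<dots> \<le> A * exp (B * real (j + 1)) / fact j * (C ^ j * fact j) * 4 ^ j"
    proof (intro mult_right_mono mult_mono divide_left_mono)
      show "pochhammer a j \<le> C ^ j * fact j"
        using pochhammer_le[of 1 a j] a by (simp add: C_def pochhammer_fact)
      have "fact j \<le> real (j ^ j)" by (rule fact_le_power)
      also have "\<dots> \<le> real (j + 1) ^ j" by (simp add: power_mono)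
      finally show "fact j \<le> real (j + 1) ^ j" .
    qed (use A0 pochhammer_pos[OF a, of j] in \<open>auto simp: C_def\<close>)
    also have "\<dots> = A * exp B * L ^ j"
      by (simp add: L_def power_mult_distrib distrib_left exp_add exp_of_nat_mult[symmetric] mult_ac)
    finally show ?thesis .
  qed
  \<comment> \<open>At most half of 1 / L, so that the terms are dominated by a geometric series
    with ratio 1/2.\<close>
  define r1 where "r1 = min \<delta>2 (1 / (2 * L))"
  have r1: "r1 > 0" "r1 \<le> \<delta>2" "r1 \<le> 1 / (2 * L)" using d2 L by (auto simp: r1_def)
  have tle: "norm (u j z * t ^ j) \<le> A * exp B * (1 / 2) ^ j" if "norm z < r1" "norm t < r1" for z t j
  proof -
    have "norm (u j z * t ^ j) \<le> (A * exp B * L ^ j) * (1 / (2 * L)) ^ j"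
      unfolding norm_mult norm_power using that r1 A0 L by (intro mult_mono ule power_mono) auto
    also have "\<dots> = A * exp B * (L * (1 / (2 * L))) ^ j" by (simp only: power_mult_distrib mult.assoc)
    also have "L * (1 / (2 * L)) = 1 / 2" using L by simp
    finally show ?thesis .
  qed
  have sm: "summable (\<lambda>j. A * exp B * (1 / 2) ^ j)"
    by (intro summable_mult summable_geometric) simp
  define U where "U p = (\<Sum>j. u j (fst p) * snd p ^ j)" for p
  have "cnt.hol (ball 0 r1 \<times> ball 0 r1) U"
    unfolding U_def
  proof (rule cnt.hol_suminf[OF _ _ _ sm])
    show "cnt.hol (ball 0 r1 \<times> ball 0 r1) (\<lambda>p. u j (fst p) * snd p ^ j)" for j
      by (intro cnt.hol_mult hol_snd_power hol_fst[OF hol_u]) (use r1 d2 in auto)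
  qed (use tle in \<open>auto intro: open_Times\<close>)
  moreover have "(\<lambda>j. u j z * t ^ j) sums U (z, t)" if "norm z < r1" "norm t < r1" for z t
    unfolding U_def fst_conv snd_conv
    by (intro summable_sums summable_comparison_test[OF _ sm] exI[of _ 0] allI impI tle that)
  ultimately show ?thesis using r1(1) by blast
qed

end

section \<open>The heat equation\<close>

lemma O_entire_cong:
  assumes "\<delta> > 0" "\<And>z t. norm z < \<delta> \<Longrightarrow> norm t < \<delta> \<Longrightarrow> F (z, t) = G (z, t)" "O_entire k F"
  shows "O_entire k G"
proof -
  obtain r f \<delta>' where r: "r > 0" "holo_nt (ball 0 r \<times> UNIV) f" and \<delta>': "\<delta>' > 0"
      "\<forall>z t. norm z < \<delta>' \<longrightarrow> norm t < \<delta>' \<longrightarrow> f (z, t) = F (z, t)"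
    and g: "\<forall>r'. r' < r \<longrightarrow> (\<exists>A B. \<forall>z t. norm z \<le> r' \<longrightarrow> norm (f (z, t)) \<le> A * exp (B * norm t powr k))"
    using assms(3) unfolding O_entire_def by (elim exE conjE) blast
  have "\<exists>\<delta>>0. \<forall>z t. norm z < \<delta> \<longrightarrow> norm t < \<delta> \<longrightarrow> f (z, t) = G (z, t)"
    using assms(1,2) \<delta>' by (intro exI[of _ "min \<delta> \<delta>'"]) auto
  then show ?thesis unfolding O_entire_def using r g by blast
qed

text \<open>D D^T = \<Lambda> for the diagonal root D, and orthogonality turns C^T A C = \<Lambda>
  into A = C \<Lambda> C^T.\<close>

lemma sqrt_diag_square:
  fixes A C :: "real^'n^'n"
  assumes orthC: "orthogonal_matrix C"
    and diag: "\<And>i j. i \<noteq> j \<Longrightarrow> (transpose C ** A ** C) $ i $ j = 0"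
    and diagpos: "\<And>i. (transpose C ** A ** C) $ i $ i > 0"
  shows "(C ** sqrt_diag (transpose C ** A ** C)) ** transpose (C ** sqrt_diag (transpose C ** A ** C)) = A"
proof -
  let ?L = "transpose C ** A ** C" and ?D = "sqrt_diag (transpose C ** A ** C)"
  have D: "?D ** transpose ?D = ?L"
  proof -
    have "(?D ** transpose ?D) $ i $ j = ?L $ i $ j" for i j
    proof -
      have "(?D ** transpose ?D) $ i $ j = (\<Sum>k\<in>UNIV. ?D $ i $ k * ?D $ j $ k)"
        by (simp add: matrix_matrix_mult_def transpose_def)
      also have "\<dots> = (\<Sum>k\<in>UNIV. if k = i then sqrt (?L $ i $ i) * ?D $ j $ i else 0)"
        by (rule sum.cong) (auto simp: sqrt_diag_def)
      also have "\<dots> = sqrt (?L $ i $ i) * ?D $ j $ i" by simp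
      also have "\<dots> = ?L $ i $ j"
        using diag[of i j] diagpos[of i] by (cases "i = j") (auto simp: sqrt_diag_def)
      finally show ?thesis .
    qed
    then show ?thesis by (simp add: vec_eq_iff)
  qed
  have "(C ** ?D) ** transpose (C ** ?D) = C ** (?D ** transpose ?D) ** transpose C"
    by (simp add: matrix_transpose_mul matrix_mul_assoc)
  also have "\<dots> = (C ** transpose C) ** A ** (C ** transpose C)"
    unfolding D by (simp add: matrix_mul_assoc)
  also have "\<dots> = A" using orthC by (simp add: orthogonal_matrix_def)
  finally show ?thesis .
qed

lemma hol_ucoef:
  assumes "open S" "cn.hol S f"
  shows "cn.hol S (ucoef A f j)"
proof -
  have "cn.hol S (\<lambda>z. (1 / of_nat (fact j)) * (Pop A ^^ j) f z)"
    by (intro cn.hol_cmult hol_Pop_power assms)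
  then show ?thesis by (simp add: ucoef_def[abs_def])
qed

context growth_coeffs
begin

lemma borel_series_summable:
  "\<exists>\<delta>>0. \<forall>z t. norm z < \<delta> \<longrightarrow> norm t < \<delta> \<longrightarrow> summable (\<lambda>j. u j z / of_real (pochhammer 1 j) * t ^ j)"
  using pseries_sums[of 1] r0 Rad_pos[of 1]
  by (intro exI[of _ "min r0 (Rad 1)"]) (auto simp: sums_iff)

lemma O_entire_iff:
  assumes a: "a > 0" and \<delta>: "\<delta> > 0" and F: "\<And>z t. norm z < \<delta> \<Longrightarrow> norm t < \<delta> \<Longrightarrow> F (z, t) = pseries u a (z, t\<^sup>2 / 4)"
  shows "(\<exists>r>0. \<exists>U. (\<forall>z t. norm z < r \<longrightarrow> norm t < r \<longrightarrow> (\<lambda>j. u j z * t ^ j) sums U (z, t)) \<and>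
      holo_nt (ball 0 r \<times> ball 0 r) U) \<longleftrightarrow> O_entire 2 F"
proof
  assume "\<exists>r>0. \<exists>U. (\<forall>z t. norm z < r \<longrightarrow> norm t < r \<longrightarrow> (\<lambda>j. u j z * t ^ j) sums U (z, t)) \<and>
      holo_nt (ball 0 r \<times> ball 0 r) U"
  then have "O_entire 2 (\<lambda>(z, t). pseries u a (z, t\<^sup>2 / 4))"
    unfolding holo_nt_iff_hol using O_entire_of_convergent[OF a] by blast
  then show "O_entire 2 F" by (rule O_entire_cong[OF \<delta>, rotated]) (use F in simp)
next
  assume "O_entire 2 F"
  then have "O_entire 2 (\<lambda>(z, t). pseries u a (z, t\<^sup>2 / 4))"
    by (rule O_entire_cong[OF \<delta>, rotated]) (use F in simp)
  then show "\<exists>r>0. \<exists>U. (\<forall>z t. norm z < r \<longrightarrow> norm t < r \<longrightarrow> (\<lambda>j. u j z * t ^ j) sums U (z, t)) \<and>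
      holo_nt (ball 0 r \<times> ball 0 r) U"
    unfolding holo_nt_iff_hol by (rule convergent_of_O_entire[OF a])
qed

text \<open>The parameter 1 of the Borel series is 2/2, so it belongs to the same half-integer
  family as the parameters of the means.\<close>

lemma O_sector_iff:
  fixes m :: nat
  assumes m: "m \<ge> 1" and \<delta>: "\<delta> > 0"
    and F: "\<And>z t. norm z < \<delta> \<Longrightarrow> norm t < \<delta> \<Longrightarrow> F (z, t) = pseries u (real m / 2) (z, t\<^sup>2 / 4)"
  shows "O_sector 1 d (pseries u 1) \<longleftrightarrow> O_sector 2 (d / 2) F \<and> O_sector 2 (d / 2 + pi) F"
proof -
  let ?G = "\<lambda>(z, t). pseries u (real m / 2) (z, t\<^sup>2 / 4)"
  have "sector_growth 1 d (pseries u 1) \<longleftrightarrow> sector_growth 1 d (pseries u (real m / 2))"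
    using pseries_half_integers[of 2 m d] m by simp
  also have "\<dots> \<longleftrightarrow> sector_growth 2 (d / 2) ?G \<and> sector_growth 2 (d / 2 + pi) ?G"
    using m by (intro sector_growth_pseries_iff) simp
  also have "\<dots> \<longleftrightarrow> sector_growth 2 (d / 2) F \<and> sector_growth 2 (d / 2 + pi) F"
    using sector_growth_cong[OF \<delta>, of F ?G] sector_growth_cong[OF \<delta>, of ?G F] F by auto
  finally show ?thesis unfolding O_sector_iff_sector_growth .
qed

end

theorem theorem2:
  fixes A C :: "real^'n^'n" and \<phi> :: "complex^'n \<Rightarrow> complex" and r d :: real
  assumes symA: "transpose A = A"
    and posdefA: "\<And>x. x \<noteq> 0 \<Longrightarrow> x \<bullet> (A *v x) > 0"
    and orthC: "orthogonal_matrix C"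
    and diag: "\<And>i j. i \<noteq> j \<Longrightarrow> (transpose C ** A ** C) $ i $ j = 0"
    and diagpos: "\<And>i. (transpose C ** A ** C) $ i $ i > 0"
    and r: "r > 0"
    and holo: "holo_n (ball 0 r) \<phi>"
  shows "(formal_converges A \<phi> \<longleftrightarrow> O_entire 2 (M_ball A C \<phi>)) \<and>
         (formal_converges A \<phi> \<longleftrightarrow> O_entire 2 (M_sphere A C \<phi>)) \<and>
         (k_summable 1 d A \<phi> \<longleftrightarrow>
            O_sector 2 (d / 2) (M_ball A C \<phi>) \<and> O_sector 2 (d / 2 + pi) (M_ball A C \<phi>)) \<and>
         (k_summable 1 d A \<phi> \<longleftrightarrow>
            O_sector 2 (d / 2) (M_sphere A C \<phi>) \<and> O_sector 2 (d / 2 + pi) (M_sphere A C \<phi>))"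
proof -
  let ?Q = "C ** sqrt_diag (transpose C ** A ** C)" and ?n = "CARD('n)" and ?u = "ucoef A \<phi>"
  have Q: "?Q ** transpose ?Q = A" by (rule sqrt_diag_square[OF orthC diag diagpos])
  have f: "cn.hol (ball 0 r) \<phi>" using holo by (simp add: holo_n_iff_hol)
  obtain \<rho> K M where \<rho>: "\<rho> > 0" "K \<ge> 1" "M \<ge> 0" "\<rho> \<le> r"
    and ule: "\<And>z j. norm z < \<rho> \<Longrightarrow> norm (?u j z) \<le> M * K ^ j * fact j"
    and S: "\<And>z t. norm z < \<rho> \<Longrightarrow> norm t < \<rho> \<Longrightarrow>
      (\<lambda>j. ?u j z / of_real (pochhammer (real ?n / 2) j) * (t\<^sup>2 / 4) ^ j) sums
        ((1 / alpha_n CARD('n)) *\<^sub>R integral (ball 0 1) (\<lambda>y. \<phi> (z + t *s cvec ?Q (scaleR (1 / norm y) y))))"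
    and B: "\<And>z t. norm z < \<rho> \<Longrightarrow> norm t < \<rho> \<Longrightarrow>
      (\<lambda>j. ?u j z / of_real (pochhammer (real ?n / 2 + 1) j) * (t\<^sup>2 / 4) ^ j) sums
        ((1 / alpha_n CARD('n)) *\<^sub>R integral (ball 0 1) (\<lambda>y. \<phi> (z + t *s cvec ?Q y)))"
    by (rule mean_expansion[OF r f Q]) (rule that)
  interpret growth_coeffs ?u \<rho> K M
  proof
    show "cn.hol (ball 0 \<rho>) (?u j)" for j
      by (rule cn.hol_subset[OF hol_ucoef[OF open_ball f]]) (use \<rho> in auto)
  qed (use \<rho> ule in auto)
  \<comment> \<open>The factor n inside \<open>sphere_integral\<close> cancels against the
    normalisation 1 / (n \<alpha>(n)), leaving 1 / \<alpha>(n).\<close>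
  have MS: "M_sphere A C \<phi> (z, t) = pseries ?u (real ?n / 2) (z, t\<^sup>2 / 4)" if "norm z < \<rho>" "norm t < \<rho>" for z t
    unfolding pseries_def split_conv sums_unique[OF S[OF that], symmetric]
    by (simp add: M_sphere_def sphere_integral_def shift_pt_eq scaleR_conv_of_real)
  have MB: "M_ball A C \<phi> (z, t) = pseries ?u (real (?n + 2) / 2) (z, t\<^sup>2 / 4)" if "norm z < \<rho>" "norm t < \<rho>" for z t
  proof -
    have n2: "real (?n + 2) / 2 = real ?n / 2 + 1" by simp
    show ?thesis
      unfolding n2 pseries_def split_conv sums_unique[OF B[OF that], symmetric]
      by (simp add: M_ball_def shift_pt_eq scaleR_conv_of_real)
  qed
  \<comment> \<open>Gamma(1 + j) = j! = (1)_j.\<close>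
  have G: "complex_of_real (Gamma (1 + real j / 1)) = of_real (pochhammer 1 j)" for j
    by (simp add: Gamma_fact pochhammer_fact[symmetric])
  have k: "k_summable 1 d A \<phi> \<longleftrightarrow> O_sector 1 d (pseries ?u 1)"
    unfolding k_summable_def G pseries_def[symmetric] using borel_series_summable by blast
  show ?thesis
    unfolding k formal_converges_def
    by (intro conjI O_entire_iff[OF _ \<rho>(1) MB] O_entire_iff[OF _ \<rho>(1) MS] O_sector_iff[OF _ \<rho>(1) MB] O_sector_iff[OF _ \<rho>(1) MS]) auto
qed

end
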